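(* Let $l\ge3$ be an integer and let $G$ be a smooth Riemannian metric on $\mathrm{Imm}^l(M,\mathbb R^d)$ such that $$\|h\|_{G_f}\gtrsim\|\nabla h\|_{L^2(g)}$$ for all $f\in\mathrm{Imm}^l(M,\mathbb R^d)$ and $h\in T_f\mathrm{Imm}^l(M,\mathbb R^d)$. Then the function $$\sqrt{\mathrm{Vol}}:(\mathrm{Imm}^l(M,\mathbb R^d),G)\to\mathbb R$$ is Lipschitz continuous, and thus uniformly bounded, on any $G$-metric ball in $\mathrm{Imm}^l(M,\mathbb R^d)$.
   Context: $M$ is a smooth, closed (compact, without boundary), oriented two-dimensional manifold and $d\ge3$. $\mathrm{Imm}^l(M,\mathbb R^d)$ is the set of $f\in H^l(M,\mathbb R^d)$ with $T_xf$ injective for all $x\in M$; it is open in the Hilbert space $H^l(M,\mathbb R^d)$, so $T_f\mathrm{Imm}^l(M,\mathbb R^d)\cong H^l(M,\mathbb R^d)$. For an immersion $f$: $g=f^*\langle\cdot,\cdot\rangle_{\mathbb R^d}$ is the pullback metric, also denoting the induced fiber metric on $T^*M\otimes\mathbb R^d$; $\mathrm{vol}$ is its volume form; $\mathrm{Vol}=\int_M\mathrm{vol}$ is the total volume of $f$; $\nabla h=Th$ for $h:M\to\mathbb R^d$. $\|\nabla h\|_{L^2(g)}^2=\int_Mg(\nabla h,\nabla h)\,\mathrm{vol}$ and $\|h\|_{G_f}=\sqrt{G_f(h,h)}$. The notation $A\gtrsim B$ means $A\ge cB$ with a constant $c>0$ independent of $f$ and $h$. Lipschitz continuity and metric balls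 refer to the geodesic distance of $G$. *)

theory Defs
  imports "HOL-Analysis.Analysis" "HOL-Library.Function_Algebras"
begin

section \<open>Pointwise vector space structure on functions\<close>

instantiation "fun" :: (type, scaleR) scaleR
begin
definition scaleR_fun_def: "r *\<^sub>R f = (\<lambda>x. r *\<^sub>R f x)"
instance ..
end

instance "fun" :: (type, real_vector) real_vector
  by standard (auto simp: scaleR_fun_def fun_eq_iff scaleR_add_right scaleR_add_left)


section \<open>Calculus on open subsets of the plane\<close>

definition partial :: "2 \<Rightarrow> (real^2 \<Rightarrow> 'b::real_normed_vector) \<Rightarrow> real^2 \<Rightarrow> 'b" where
  "partial i u y = frechet_derivative u (at y) (axis i 1)"

text \<open>A list of directions plays the role of a multi-index.\<close>

definition partials :: "2 list \<Rightarrow> (real^2 \<Rightarrow> 'b::real_normed_vector) \<Rightarrow> real^2 \<Rightarrow> 'b" where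
  "partials \<alpha> u = foldr partial \<alpha> u"

definition C1_on :: "(real^2) set \<Rightarrow> (real^2 \<Rightarrow> 'b::real_normed_vector) \<Rightarrow> bool" where
  "C1_on \<Omega> u \<longleftrightarrow> (\<forall>y\<in>\<Omega>. u differentiable (at y)) \<and> (\<forall>i. continuous_on \<Omega> (partial i u))"

definition Cinf_on :: "(real^2) set \<Rightarrow> (real^2 \<Rightarrow> 'b::real_normed_vector) \<Rightarrow> bool" where
  "Cinf_on \<Omega> u \<longleftrightarrow> (\<forall>\<alpha>. \<forall>y\<in>\<Omega>. partials \<alpha> u differentiable (at y))"

definition test_function :: "(real^2) set \<Rightarrow> (real^2 \<Rightarrow> real) \<Rightarrow> bool" where
  "test_function \<Omega> \<psi> \<longleftrightarrow> Cinf_on UNIV \<psi> \<and>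
     compact (closure {y. \<psi> y \<noteq> 0}) \<and> closure {y. \<psi> y \<noteq> 0} \<subseteq> \<Omega>"

definition L2_loc :: "(real^2) set \<Rightarrow> (real^2 \<Rightarrow> 'b::euclidean_space) \<Rightarrow> bool" where
  "L2_loc \<Omega> v \<longleftrightarrow> set_borel_measurable lborel \<Omega> v \<and>
     (\<forall>K. compact K \<and> K \<subseteq> \<Omega> \<longrightarrow> set_integrable lborel K (\<lambda>y. (norm (v y))\<^sup>2))"

definition is_weak_partial ::
    "(real^2) set \<Rightarrow> 2 list \<Rightarrow> (real^2 \<Rightarrow> 'b::euclidean_space) \<Rightarrow> (real^2 \<Rightarrow> 'b) \<Rightarrow> bool" where
  "is_weak_partial \<Omega> \<alpha> u v \<longleftrightarrow> (\<forall>\<psi>. test_function \<Omega> \<psi> \<longrightarrow>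
     (LINT y:\<Omega>|lborel. partials \<alpha> \<psi> y *\<^sub>R u y)
       = (-1) ^ length \<alpha> *\<^sub>R (LINT y:\<Omega>|lborel. \<psi> y *\<^sub>R v y))"

text \<open>The weak derivative is unique up to null sets; it is only used under integrals.\<close>

definition weak_partial ::
    "(real^2) set \<Rightarrow> 2 list \<Rightarrow> (real^2 \<Rightarrow> 'b::euclidean_space) \<Rightarrow> real^2 \<Rightarrow> 'b" where
  "weak_partial \<Omega> \<alpha> u = (SOME v. L2_loc \<Omega> v \<and> is_weak_partial \<Omega> \<alpha> u v)"


section \<open>Closed oriented surfaces\<close>

text \<open>The surface is the type \<open>'m\<close> with its topology; its smooth structure and orientation are
  given by an oriented atlas (not necessarily maximal).\<close>

type_synonym 'm chart = "'m set \<times> ('m \<Rightarrow> real^2)"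

definition chart_image :: "'m chart \<Rightarrow> (real^2) set" where
  "chart_image c = snd c ` fst c"

definition local_rep :: "'m chart \<Rightarrow> ('m \<Rightarrow> 'b) \<Rightarrow> real^2 \<Rightarrow> 'b" where
  "local_rep c f = f \<circ> inv_into (fst c) (snd c)"

definition is_chart :: "'m::topological_space chart \<Rightarrow> bool" where
  "is_chart c \<longleftrightarrow> open (fst c) \<and> open (chart_image c) \<and>
     homeomorphism (fst c) (chart_image c) (snd c) (inv_into (fst c) (snd c))"

definition closed_oriented_surface :: "'m::t2_space chart set \<Rightarrow> bool" where
  "closed_oriented_surface A \<longleftrightarrow>
     compact (UNIV :: 'm set) \<and>
     (\<forall>c\<in>A. is_chart c) \<and> (\<Union>c\<in>A. fst c) = UNIV \<and>
     (\<forall>c\<in>A. \<forall>c'\<in>A.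
        Cinf_on (snd c ` (fst c \<inter> fst c')) (local_rep c (snd c')) \<and>
        (\<forall>y \<in> snd c ` (fst c \<inter> fst c').
           det (matrix (frechet_derivative (local_rep c (snd c')) (at y))) > 0))"

text \<open>Finite smooth partition of unity; each function comes with a chart containing its support.\<close>

definition partition_of_unity ::
    "'m::t2_space chart set \<Rightarrow> ('m chart \<times> ('m \<Rightarrow> real)) set \<Rightarrow> bool" where
  "partition_of_unity A P \<longleftrightarrow> finite P \<and>
     (\<forall>(c, \<rho>)\<in>P. c \<in> A \<and> closure {x. \<rho> x \<noteq> 0} \<subseteq> fst c \<and> (\<forall>x. 0 \<le> \<rho> x) \<and>
        (\<forall>c'\<in>A. Cinf_on (chart_image c') (local_rep c' \<rho>))) \<and>
     (\<forall>x. (\<Sum>(c, \<rho>)\<in>P. \<rho> x) = 1)"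

text \<open>Integral over the surface of a family \<open>F\<close> of local densities, \<open>F c\<close> being the density with
  respect to Lebesgue measure in the chart \<open>c\<close>. If \<open>F\<close> transforms like a density (in particular,
  for a function times a volume form), the value is independent of \<open>P\<close>.\<close>

definition surface_integral ::
    "('m chart \<times> ('m \<Rightarrow> real)) set \<Rightarrow> ('m chart \<Rightarrow> real^2 \<Rightarrow> real) \<Rightarrow> real" where
  "surface_integral P F =
     (\<Sum>(c, \<rho>)\<in>P. LINT y:chart_image c|lborel. local_rep c \<rho> y * F c y)"


section \<open>The Sobolev space and the immersions\<close>

text \<open>The classes in \<open>H\<^sup>l\<close> are identified with their representatives of class \<open>C\<^sup>1\<close>, which exist
  and are unique for \<open>l \<ge> 3\<close> in dimension two by the Sobolev embedding theorem. This is what gives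
  \<open>T\<^sub>xf\<close> a meaning at every point \<open>x\<close>. As the surface is compact, local square integrability in
  all charts is the same as square integrability.\<close>

definition sobolev_space ::
    "'m chart set \<Rightarrow> nat \<Rightarrow> ('m \<Rightarrow> real^'d) set" where
  "sobolev_space A l = {f. \<forall>c\<in>A. C1_on (chart_image c) (local_rep c f) \<and>
     (\<forall>\<alpha>. length \<alpha> \<le> l \<longrightarrow>
        (\<exists>v. L2_loc (chart_image c) v \<and> is_weak_partial (chart_image c) \<alpha> (local_rep c f) v))}"

text \<open>The Hilbert norm of \<open>H\<^sup>l\<close>. The integrands are not densities, so the norm depends on \<open>P\<close>,
  but different \<open>P\<close> (and atlases of the same smooth structure) give equivalent norms.\<close>

definition sobolev_norm ::
    "('m chart \<times> ('m \<Rightarrow> real)) set \<Rightarrow> nat \<Rightarrow> ('m \<Rightarrow> real^'d) \<Rightarrow> real" where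
  "sobolev_norm P l f = sqrt (\<Sum>\<alpha> | length \<alpha> \<le> l.
     surface_integral P (\<lambda>c y. (norm (weak_partial (chart_image c) \<alpha> (local_rep c f) y))\<^sup>2))"

definition Imm :: "'m chart set \<Rightarrow> nat \<Rightarrow> ('m \<Rightarrow> real^'d) set" where
  "Imm A l = {f \<in> sobolev_space A l.
     \<forall>c\<in>A. \<forall>x\<in>fst c. inj (frechet_derivative (local_rep c f) (at (snd c x)))}"


section \<open>Pullback metric, total volume and the gradient norm\<close>

text \<open>The matrix \<open>g\<^sub>i\<^sub>j\<close> of the pullback metric for a local representative \<open>u\<close> of the immersion.\<close>

definition pullback_metric :: "(real^2 \<Rightarrow> real^'d) \<Rightarrow> real^2 \<Rightarrow> real^2^2" where
  "pullback_metric u y = (\<chi> i j. partial i u y \<bullet> partial j u y)"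

definition vol_density :: "(real^2 \<Rightarrow> real^'d) \<Rightarrow> real^2 \<Rightarrow> real" where
  "vol_density u y = sqrt (det (pullback_metric u y))"

definition Vol :: "('m chart \<times> ('m \<Rightarrow> real)) set \<Rightarrow> ('m \<Rightarrow> real^'d) \<Rightarrow> real" where
  "Vol P f = surface_integral P (\<lambda>c. vol_density (local_rep c f))"

text \<open>\<open>g(\<nabla>h, \<nabla>h) = g\<^sup>i\<^sup>j \<langle>\<partial>\<^sub>ih, \<partial>\<^sub>jh\<rangle>\<close> in a chart, where \<open>u\<close> and \<open>w\<close> represent \<open>f\<close> and \<open>h\<close>.\<close>

definition grad_sq :: "(real^2 \<Rightarrow> real^'d) \<Rightarrow> (real^2 \<Rightarrow> real^'d) \<Rightarrow> real^2 \<Rightarrow> real" where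
  "grad_sq u w y = (\<Sum>i\<in>UNIV. \<Sum>j\<in>UNIV.
     matrix_inv (pullback_metric u y) $ i $ j * (partial i w y \<bullet> partial j w y))"

definition grad_L2_norm ::
    "('m chart \<times> ('m \<Rightarrow> real)) set \<Rightarrow> ('m \<Rightarrow> real^'d) \<Rightarrow> ('m \<Rightarrow> real^'d) \<Rightarrow> real" where
  "grad_L2_norm P f h = sqrt (surface_integral P
     (\<lambda>c y. grad_sq (local_rep c f) (local_rep c h) y * vol_density (local_rep c f) y))"


section \<open>Riemannian metrics on an open subset of a normed space\<close>

text \<open>In this section \<open>E\<close> is a linear subspace of a real vector space, normed by \<open>N\<close> (which need
  only be a norm on \<open>E\<close>), and \<open>U\<close> is an open subset of \<open>(E, N)\<close>.\<close>

definition bounded_multilinear_form ::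
    "'v::real_vector set \<Rightarrow> ('v \<Rightarrow> real) \<Rightarrow> nat \<Rightarrow> ('v list \<Rightarrow> real) \<Rightarrow> bool" where
  "bounded_multilinear_form E N n T \<longleftrightarrow>
     (\<forall>us vs v w a. set us \<subseteq> E \<and> set vs \<subseteq> E \<and> v \<in> E \<and> w \<in> E \<and> length us + 1 + length vs = n \<longrightarrow>
        T (us @ (a *\<^sub>R v + w) # vs) = a * T (us @ v # vs) + T (us @ w # vs)) \<and>
     (\<exists>B. \<forall>vs. set vs \<subseteq> E \<and> length vs = n \<longrightarrow> \<bar>T vs\<bar> \<le> B * prod_list (map N vs))"

text \<open>\<open>G\<close> is of class \<open>C\<^sup>\<infinity>\<close> as a map from \<open>U\<close> to the bounded bilinear forms on \<open>E\<close> (with the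
  operator norm): \<open>D f [v\<^sub>m, \<dots>, v\<^sub>1, h, k]\<close> is the \<open>m\<close>-th Frechet derivative of \<open>G\<close> at \<open>f\<close> in the
  directions \<open>v\<^sub>1, \<dots>, v\<^sub>m\<close>, evaluated at \<open>(h, k)\<close>.\<close>

definition smooth_bilinear_field ::
    "'v::real_vector set \<Rightarrow> ('v \<Rightarrow> real) \<Rightarrow> 'v set \<Rightarrow> ('v \<Rightarrow> 'v \<Rightarrow> 'v \<Rightarrow> real) \<Rightarrow> bool" where
  "smooth_bilinear_field E N U G \<longleftrightarrow> (\<exists>D :: 'v \<Rightarrow> 'v list \<Rightarrow> real. \<forall>f\<in>U.
     (\<forall>h\<in>E. \<forall>k\<in>E. D f [h, k] = G f h k) \<and>
     (\<forall>n\<ge>2. bounded_multilinear_form E N n (D f)) \<and>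
     (\<forall>n\<ge>2. \<forall>\<epsilon>>0. \<exists>\<delta>>0. \<forall>v\<in>E. N v < \<delta> \<and> f + v \<in> U \<longrightarrow>
        (\<forall>vs. set vs \<subseteq> E \<and> length vs = n \<longrightarrow>
           \<bar>D (f + v) vs - D f vs - D f (v # vs)\<bar> \<le> \<epsilon> * N v * prod_list (map N vs))))"

text \<open>The inner products \<open>G f\<close> are not required to induce the topology of \<open>E\<close>: both strong and
  weak Riemannian metrics are included.\<close>

definition riemannian_metric ::
    "'v::real_vector set \<Rightarrow> ('v \<Rightarrow> real) \<Rightarrow> 'v set \<Rightarrow> ('v \<Rightarrow> 'v \<Rightarrow> 'v \<Rightarrow> real) \<Rightarrow> bool" where
  "riemannian_metric E N U G \<longleftrightarrow> smooth_bilinear_field E N U G \<and>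
     (\<forall>f\<in>U. (\<forall>h\<in>E. \<forall>k\<in>E. G f h k = G f k h) \<and> (\<forall>h\<in>E. h \<noteq> 0 \<longrightarrow> G f h h > 0))"

text \<open>\<open>\<gamma>\<close> is a \<open>C\<^sup>1\<close> curve \<open>[a, b] \<rightarrow> U\<close> with velocity \<open>\<gamma>'\<close> (one-sided at the end points).\<close>

definition C1_curve ::
    "'v::real_vector set \<Rightarrow> ('v \<Rightarrow> real) \<Rightarrow> 'v set \<Rightarrow> real \<Rightarrow> real \<Rightarrow>
     (real \<Rightarrow> 'v) \<Rightarrow> (real \<Rightarrow> 'v) \<Rightarrow> bool" where
  "C1_curve E N U a b \<gamma> \<gamma>' \<longleftrightarrow> (\<forall>t\<in>{a..b}. \<gamma> t \<in> U \<and> \<gamma>' t \<in> E \<and>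
     (\<forall>\<epsilon>>0. \<exists>\<delta>>0. \<forall>s\<in>{a..b}. \<bar>s - t\<bar> < \<delta> \<longrightarrow>
        N (\<gamma> s - \<gamma> t - (s - t) *\<^sub>R \<gamma>' t) \<le> \<epsilon> * \<bar>s - t\<bar> \<and> N (\<gamma>' s - \<gamma>' t) < \<epsilon>))"

text \<open>\<open>f0\<close> and \<open>f1\<close> are joined by a piecewise \<open>C\<^sup>1\<close> curve \<open>[0, 1] \<rightarrow> U\<close> of length \<open>L\<close>; the curve is
  \<open>C\<^sup>1\<close> on the closed intervals of the subdivision \<open>0 = \<tau> 0 < \<dots> < \<tau> n = 1\<close>.\<close>

definition joined_with_length ::
    "'v::real_vector set \<Rightarrow> ('v \<Rightarrow> real) \<Rightarrow> 'v set \<Rightarrow> ('v \<Rightarrow> 'v \<Rightarrow> 'v \<Rightarrow> real) \<Rightarrow>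
     'v \<Rightarrow> 'v \<Rightarrow> real \<Rightarrow> bool" where
  "joined_with_length E N U G f0 f1 L \<longleftrightarrow>
     (\<exists>(n::nat) (\<tau> :: nat \<Rightarrow> real) \<gamma> (\<gamma>' :: nat \<Rightarrow> real \<Rightarrow> 'v).
        \<tau> 0 = 0 \<and> \<tau> n = 1 \<and> \<gamma> 0 = f0 \<and> \<gamma> 1 = f1 \<and>
        (\<forall>i<n. \<tau> i < \<tau> (Suc i) \<and> C1_curve E N U (\<tau> i) (\<tau> (Suc i)) \<gamma> (\<gamma>' i)) \<and>
        L = (\<Sum>i<n. integral {\<tau> i..\<tau> (Suc i)} (\<lambda>t. sqrt (G (\<gamma> t) (\<gamma>' i t) (\<gamma>' i t)))))"

text \<open>Points which cannot be joined have distance \<open>\<infinity>\<close>.\<close>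

definition geodesic_dist ::
    "'v::real_vector set \<Rightarrow> ('v \<Rightarrow> real) \<Rightarrow> 'v set \<Rightarrow> ('v \<Rightarrow> 'v \<Rightarrow> 'v \<Rightarrow> real) \<Rightarrow>
     'v \<Rightarrow> 'v \<Rightarrow> ennreal" where
  "geodesic_dist E N U G f0 f1 = (INF L \<in> {L. joined_with_length E N U G f0 f1 L}. ennreal L)"

definition geodesic_ball ::
    "'v::real_vector set \<Rightarrow> ('v \<Rightarrow> real) \<Rightarrow> 'v set \<Rightarrow> ('v \<Rightarrow> 'v \<Rightarrow> 'v \<Rightarrow> real) \<Rightarrow>
     'v \<Rightarrow> real \<Rightarrow> 'v set" where
  "geodesic_ball E N U G f0 r = {f \<in> U. geodesic_dist E N U G f0 f < ennreal r}"

definition geodesic_lipschitz_on ::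
    "'v::real_vector set \<Rightarrow> ('v \<Rightarrow> real) \<Rightarrow> 'v set \<Rightarrow> ('v \<Rightarrow> 'v \<Rightarrow> 'v \<Rightarrow> real) \<Rightarrow>
     real \<Rightarrow> 'v set \<Rightarrow> ('v \<Rightarrow> real) \<Rightarrow> bool" where
  "geodesic_lipschitz_on E N U G C S \<Phi> \<longleftrightarrow> 0 \<le> C \<and>
     (\<forall>f\<in>S. \<forall>f'\<in>S. ennreal \<bar>\<Phi> f - \<Phi> f'\<bar> \<le> ennreal C * geodesic_dist E N U G f f')"

end

theory Submission
  imports Defs "HOL-Computational_Algebra.Polynomial"
begin

text \<open>
Let \<open>h\<close> be the velocity of a path of immersions \<open>f\<close>. The volume changes at the rate
\<open>\<integral> tr (g\<^sup>-\<^sup>1 \<langle>\<nabla>f, \<nabla>h\<rangle>) vol\<close>, and since \<open>|\<nabla>f|\<^sup>2 = 2\<close> pointwise, the Cauchy-Schwarz inequality bounds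
this rate by \<open>sqrt (2 Vol) * \<parallel>\<nabla>h\<parallel>\<close>. Hence \<open>sqrt Vol\<close> changes at a rate of at most
\<open>\<parallel>\<nabla>h\<parallel> / sqrt 2\<close>, which is at most \<open>\<parallel>h\<parallel>\<^sub>G / (sqrt 2 * c)\<close> with the constant \<open>c\<close> of the hypothesis on
\<open>G\<close>. Integration along the path bounds the change of \<open>sqrt Vol\<close> by \<open>1 / (sqrt 2 * c)\<close> times the length
(\<open>sqrt_Vol_le_length\<close>). So \<open>sqrt Vol\<close> is Lipschitz continuous on all of the space of immersions, and
on a ball it is bounded by its value at the centre plus a multiple of the radius.

The analytic point is that the volume is differentiable along a path which is \<open>C\<^sup>1\<close> for the
Sobolev norm. The volume density is the norm of the bivector \<open>\<partial>\<^sub>1u \<and> \<partial>\<^sub>2u\<close>, which is quadratic in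
the gradient, so the difference of two volumes is controlled by \<open>L\<^sup>2\<close> norms of gradients
(\<open>area_diff\<close>). Up to a small error in \<open>L\<^sup>2\<close> the path may be replaced by a straight line, along which
dominated convergence applies (\<open>area_integral_curve_derivative\<close>).

What remains is to extract the \<open>L\<^sup>2\<close> norm of the gradient from the Sobolev norm
(\<open>gradient_le_sobolev_norm\<close>). As the latter is built from arbitrarily chosen weak derivatives, this
rests on their uniqueness almost everywhere (\<open>fundamental_lemma\<close>) and on integration by parts for
\<open>C\<^sup>1\<close> functions (\<open>C1_on_is_weak_partial\<close>). Uniqueness also makes the weak derivatives additive almost
everywhere, so that the norm obeys a triangle inequality up to a constant. This yields the continuity
of the speed \<open>t \<mapsto> sqrt (G (\<gamma> t) (\<gamma>' t) (\<gamma>' t))\<close> (\<open>continuous_on_speed_square\<close>), without which the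
integral defining the length would carry no information.
\<close>

section \<open>Smooth functions approximating boxes\<close>

lemma partialI: "(u has_derivative u') (at y) \<Longrightarrow> partial i u y = u' (axis i 1)"
  unfolding partial_def by (metis frechet_derivative_at)

text \<open>For \<open>p = 1\<close> this is the standard smooth function that vanishes to infinite order at \<open>0\<close>. The factor
\<open>p (1 / x)\<close> makes the family closed under differentiation, so that one differentiability proof
covers the derivatives of all orders.\<close>

definition flat :: "real poly \<Rightarrow> real \<Rightarrow> real" where
  "flat p x = (if x > 0 then poly p (1 / x) * exp (- (1 / x)) else 0)"

lemma poly_times_exp_minus_tendsto_0: "((\<lambda>z. poly p z * exp (- z)) \<longlongrightarrow> (0::real)) at_top"
proof -
  have "((\<lambda>z. \<Sum>i\<le>degree p. coeff p i * (z ^ i / exp z)) \<longlongrightarrow> (\<Sum>i\<le>degree p. coeff p i * 0)) at_top"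
    by (intro tendsto_intros tendsto_power_div_exp_0)
  then show ?thesis
    by (simp add: poly_altdef sum_distrib_right exp_minus divide_inverse mult.assoc)
qed

text \<open>For \<open>x > 0\<close> the chain rule turns \<open>p(1/x)\<close> into \<open>(p - p')(1/x) / x\<^sup>2\<close>, which is again a polynomial in
\<open>1/x\<close>. At \<open>0\<close> the difference quotient is a polynomial in \<open>z = 1/x\<close> times \<open>exp (-z)\<close>, with
\<open>z\<close> tending to infinity.\<close>

lemma flat_has_derivative:
  "(flat p has_real_derivative flat ([:0, 0, 1:] * (p - pderiv p)) x) (at x)"
proof -
  consider "x > 0" | "x < 0" | "x = 0" by linarith
  then show ?thesis
  proof cases
    case 1
    have "((\<lambda>x. poly p (1 / x) * exp (- (1 / x))) has_real_derivative
        flat ([:0, 0, 1:] * (p - pderiv p)) x) (at x)"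
      using 1 by (auto intro!: derivative_eq_intros DERIV_chain2[OF poly_DERIV]
          simp: flat_def field_simps power2_eq_square)
    then show ?thesis
      by (rule has_field_derivative_transform_within_open[where S="{0<..}"])
         (use 1 in \<open>auto simp: flat_def\<close>)
  next
    case 2
    have "((\<lambda>_. 0) has_real_derivative flat ([:0, 0, 1:] * (p - pderiv p)) x) (at x)"
      using 2 by (simp add: flat_def)
    then show ?thesis
      by (rule has_field_derivative_transform_within_open[where S="{..<0}"])
         (use 2 in \<open>auto simp: flat_def\<close>)
  next
    case 3
    have "((\<lambda>h. flat p h / h) \<longlongrightarrow> 0) (at_left 0)"
      by (rule Lim_transform_eventually[OF tendsto_const])
         (auto simp: flat_def eventually_at_filter)
    moreover have "((\<lambda>h. flat p h / h) \<longlongrightarrow> 0) (at_right 0)"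
      unfolding filterlim_at_right_to_top
    proof (rule Lim_transform_eventually[OF poly_times_exp_minus_tendsto_0[of "[:0, 1:] * p"]])
      show "\<forall>\<^sub>F z in at_top. poly ([:0, 1:] * p) z * exp (- z) = flat p (inverse z) / inverse z"
        using eventually_gt_at_top[of 0] by eventually_elim (simp add: flat_def field_simps)
    qed
    ultimately have "((\<lambda>h. flat p h / h) \<longlongrightarrow> 0) (at 0)"
      by (simp add: filterlim_at_split)
    then show ?thesis
      using 3 by (simp add: has_field_derivative_iff flat_def)
  qed
qed

text \<open>An algebra of functions on the plane that is closed under partial derivatives; smoothness of its
members follows at once.\<close>

inductive flat_algebra :: "(real^2 \<Rightarrow> real) \<Rightarrow> bool" where
  flat: "flat_algebra (\<lambda>y. flat p (s * y $ i + r))"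
| const: "flat_algebra (\<lambda>_. r)"
| add: "flat_algebra u \<Longrightarrow> flat_algebra v \<Longrightarrow> flat_algebra (\<lambda>y. u y + v y)"
| mult: "flat_algebra u \<Longrightarrow> flat_algebra v \<Longrightarrow> flat_algebra (\<lambda>y. u y * v y)"

lemma flat_algebra_derivative:
  assumes "flat_algebra u"
  shows "(\<forall>y. u differentiable (at y)) \<and> (\<forall>j. flat_algebra (partial j u))"
  using assms
proof induction
  case (flat p s i r)
  let ?q = "[:0, 0, 1:] * (p - pderiv p)"
  have D: "((\<lambda>y. flat p (s * y $ i + r)) has_derivative
      (\<lambda>h. s * h $ i * flat ?q (s * y $ i + r))) (at y)" for y
    by (rule has_derivative_eq_rhs,
        rule has_derivative_compose[OF _ flat_has_derivative[unfolded has_field_derivative_def],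
          where f="\<lambda>y. s * y $ i + r"])
       (auto intro!: derivative_eq_intros bounded_linear_vec_nth bounded_linear_imp_has_derivative)
  have "partial j (\<lambda>y. flat p (s * y $ i + r)) =
      (\<lambda>y. (s * axis j 1 $ i) * flat ?q (s * y $ i + r))" for j
    using partialI[OF D] by auto
  then show ?case
    using D flat_algebra.intros by (auto simp: differentiable_def)
next
  case (const r)
  have "partial j (\<lambda>_. r) = (\<lambda>_. 0)" for j
    by (auto simp: partialI[OF has_derivative_const])
  then show ?case by (auto intro: flat_algebra.const)
next
  case (add u v)
  have "partial j (\<lambda>y. u y + v y) = (\<lambda>y. partial j u y + partial j v y)" for j
  proof
    fix y
    have "u differentiable (at y)" "v differentiable (at y)" using add by auto
    then show "partial j (\<lambda>y. u y + v y) y = partial j u y + partial j v y"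
      by (subst partialI[OF has_derivative_add[OF frechet_derivative_works[THEN iffD1] frechet_derivative_works[THEN iffD1]]])
         (auto simp: partial_def)
  qed
  then show ?case using add by (auto intro: flat_algebra.add)
next
  case (mult u v)
  have "partial j (\<lambda>y. u y * v y) = (\<lambda>y. u y * partial j v y + partial j u y * v y)" for j
  proof
    fix y
    have "u differentiable (at y)" "v differentiable (at y)" using mult by auto
    then show "partial j (\<lambda>y. u y * v y) y = u y * partial j v y + partial j u y * v y"
      by (subst partialI[OF has_derivative_mult[OF frechet_derivative_works[THEN iffD1] frechet_derivative_works[THEN iffD1]]])
         (auto simp: partial_def)
  qed
  then show ?case using mult by (simp add: flat_algebra.add flat_algebra.mult)
qed

lemma flat_algebra_Cinf: "flat_algebra u \<Longrightarrow> Cinf_on UNIV u"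
proof -
  assume u: "flat_algebra u"
  have "flat_algebra (partials \<alpha> u)" for \<alpha>
    by (induction \<alpha>) (use u flat_algebra_derivative in \<open>auto simp: partials_def\<close>)
  then show ?thesis using flat_algebra_derivative by (auto simp: Cinf_on_def)
qed

text \<open>As \<open>n\<close> grows, \<open>flat 1 (n * x)\<close> increases to the indicator of \<open>x > 0\<close>; the product over the faces
of a box therefore converges to the indicator of the open box, and its support stays inside the closed
box for every \<open>n\<close>.\<close>

definition box_bump :: "real^2 \<Rightarrow> real^2 \<Rightarrow> nat \<Rightarrow> real^2 \<Rightarrow> real" where
  "box_bump a b n y = (\<Prod>i\<in>UNIV. flat 1 (real n * (y $ i - a $ i)) * flat 1 (real n * (b $ i - y $ i)))"

lemma flat_1_bounds: "0 \<le> flat 1 x" "flat 1 x \<le> 1"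
  by (auto simp: flat_def)

lemma box_bump_outside:
  assumes "y \<notin> cbox a b"
  shows "box_bump a b n y = 0"
proof (rule ccontr)
  assume y: "box_bump a b n y \<noteq> 0"
  have "a $ i \<le> y $ i \<and> y $ i \<le> b $ i" for i
  proof -
    have "flat 1 (real n * (y $ i - a $ i)) * flat 1 (real n * (b $ i - y $ i)) \<noteq> 0"
      using y unfolding box_bump_def by auto
    then have "real n * (y $ i - a $ i) > 0" "real n * (b $ i - y $ i) > 0"
      by (auto simp: flat_def split: if_splits)
    then show ?thesis by (auto simp: zero_less_mult_iff)
  qed
  then show False using assms by (simp add: mem_box_cart)
qed

lemma test_function_box_bump:
  assumes "cbox a b \<subseteq> \<Omega>"
  shows "test_function \<Omega> (box_bump a b n)"
proof -
  have "flat_algebra (\<lambda>y. flat 1 (real n * (y $ i - a $ i)) * flat 1 (real n * (b $ i - y $ i)))" for i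
    using flat_algebra.mult[OF flat_algebra.flat[of 1 "real n" i "- real n * a $ i"]
        flat_algebra.flat[of 1 "- real n" i "real n * b $ i"]]
    by (simp add: algebra_simps)
  then have "flat_algebra (box_bump a b n)"
    unfolding box_bump_def[abs_def] prod_2 UNIV_2 by (auto intro: flat_algebra.mult)
  then have "Cinf_on UNIV (box_bump a b n)" by (rule flat_algebra_Cinf)
  moreover have "{y. box_bump a b n y \<noteq> 0} \<subseteq> cbox a b"
    using box_bump_outside by blast
  then have "closure {y. box_bump a b n y \<noteq> 0} \<subseteq> cbox a b"
    by (simp add: closure_minimal closed_cbox)
  ultimately show ?thesis
    using assms compact_cbox by (auto simp: test_function_def intro: compact_closure[THEN iffD2] bounded_subset[OF bounded_cbox closure_subset[THEN order_trans]])
qed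

lemma box_bump_bounds: "0 \<le> box_bump a b n y" "box_bump a b n y \<le> 1"
  unfolding box_bump_def
  by (auto intro!: prod_nonneg prod_le_1 mult_nonneg_nonneg mult_le_one flat_1_bounds)

lemma flat_1_tendsto: "(\<lambda>n. flat 1 (real n * x)) \<longlonglongrightarrow> (if x > 0 then 1 else 0)"
proof (cases "x > 0")
  case True
  have "(\<lambda>n. exp (- (1 / x * (1 / real n)))) \<longlonglongrightarrow> exp (- (1 / x * 0))"
    by (intro tendsto_intros lim_1_over_n)
  moreover have "\<forall>\<^sub>F n in sequentially. exp (- (1 / x * (1 / real n))) = flat 1 (real n * x)"
    using eventually_gt_at_top[of 0] by eventually_elim (use True in \<open>simp add: flat_def field_simps\<close>)
  ultimately show ?thesis using True by (auto intro: Lim_transform_eventually)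
next
  case False
  then have "flat 1 (real n * x) = 0" for n by (simp add: flat_def mult_le_0_iff not_less)
  then show ?thesis using False by simp
qed

lemma box_bump_tendsto: "(\<lambda>n. box_bump a b n y) \<longlonglongrightarrow> indicat_real (box a b) y"
proof -
  have "(\<lambda>n. box_bump a b n y) \<longlonglongrightarrow>
      (\<Prod>i\<in>UNIV. (if y $ i - a $ i > 0 then 1 else 0) * (if b $ i - y $ i > 0 then 1 else 0))"
    unfolding box_bump_def by (intro tendsto_prod tendsto_mult flat_1_tendsto)
  moreover have "(\<Prod>i\<in>UNIV. (if y $ i - a $ i > 0 then 1 else 0) * (if b $ i - y $ i > 0 then 1 else 0))
      = indicat_real (box a b) y"
    by (auto simp: UNIV_2 indicator_def mem_box_cart forall_2)
  ultimately show ?thesis by metis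
qed

section \<open>The fundamental lemma of the calculus of variations\<close>

lemma set_integrable_cutoff:
  fixes v :: "real^2 \<Rightarrow> 'b::euclidean_space"
  assumes "compact K" "K \<subseteq> \<Omega>" "continuous_on K \<phi>" and zero: "\<And>y. y \<in> \<Omega> - K \<Longrightarrow> \<phi> y = 0"
    and v: "set_integrable lborel K v"
  shows "set_integrable lborel \<Omega> (\<lambda>y. \<phi> y *\<^sub>R v y)"
proof -
  have "compact (\<phi> ` K)" using assms compact_continuous_image by blast
  then obtain M where M: "\<And>y. y \<in> K \<Longrightarrow> \<bar>\<phi> y\<bar> \<le> M"
    using compact_imp_bounded[of "\<phi> ` K"] by (auto simp: bounded_iff)
  have eq: "indicat_real \<Omega> y *\<^sub>R (\<phi> y *\<^sub>R v y) = (indicator K y *\<^sub>R \<phi> y) *\<^sub>R (indicator K y *\<^sub>R v y)" for y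
    using zero assms(2) by (cases "y \<in> \<Omega>"; cases "y \<in> K") auto
  have "integrable lborel (\<lambda>y. (indicator K y *\<^sub>R \<phi> y) *\<^sub>R (indicator K y *\<^sub>R v y))"
  proof (rule Bochner_Integration.integrable_bound)
    show "integrable lborel (\<lambda>y. M *\<^sub>R (indicator K y *\<^sub>R v y))"
      using v unfolding set_integrable_def by (rule integrable_scaleR_right)
    have "(\<lambda>y. indicator K y *\<^sub>R \<phi> y) \<in> borel_measurable lborel"
      using borel_measurable_continuous_on_indicator[OF borel_compact[OF assms(1)] assms(3)] by simp
    moreover have "(\<lambda>y. indicator K y *\<^sub>R v y) \<in> borel_measurable lborel"
      using v borel_measurable_integrable by (auto simp: set_integrable_def)
    ultimately show "(\<lambda>y. (indicator K y *\<^sub>R \<phi> y) *\<^sub>R (indicator K y *\<^sub>R v y)) \<in> borel_measurable lborel"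
      by (rule borel_measurable_scaleR)
    show "AE y in lborel. norm ((indicator K y *\<^sub>R \<phi> y) *\<^sub>R (indicator K y *\<^sub>R v y))
        \<le> norm (M *\<^sub>R (indicator K y *\<^sub>R v y))"
    proof (rule AE_I2)
      fix y
      show "norm ((indicator K y *\<^sub>R \<phi> y) *\<^sub>R (indicator K y *\<^sub>R v y))
        \<le> norm (M *\<^sub>R (indicator K y *\<^sub>R v y))"
        by (cases "y \<in> K") (auto intro!: mult_right_mono order_trans[OF M abs_ge_self])
    qed
  qed
  then show ?thesis unfolding set_integrable_def eq .
qed

text \<open>Local square integrability gives local integrability because \<open>x \<le> 1 + x\<^sup>2\<close> and compact sets have
finite measure.\<close>

lemma L2_loc_set_integrable:
  assumes v: "L2_loc \<Omega> v" and K: "compact K" "K \<subseteq> \<Omega>"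
  shows "set_integrable lborel K v"
proof (rule set_integrable_bound)
  show "set_integrable lborel K (\<lambda>y. 1 + (norm (v y))\<^sup>2)"
    using v K borel_integrable_compact[of K "\<lambda>_. 1::real"]
    by (intro set_integral_add) (auto simp: L2_loc_def set_integrable_def)
  have "(\<lambda>y. indicat_real K y *\<^sub>R (indicator \<Omega> y *\<^sub>R v y)) \<in> borel_measurable lborel"
  proof (rule borel_measurable_scaleR)
    show "(\<lambda>y. indicat_real K y) \<in> borel_measurable lborel"
      using borel_compact[OF K(1)] by simp
    show "(\<lambda>y. indicator \<Omega> y *\<^sub>R v y) \<in> borel_measurable lborel"
      using v by (simp add: L2_loc_def set_borel_measurable_def)
  qed
  also have "(\<lambda>y. indicat_real K y *\<^sub>R (indicator \<Omega> y *\<^sub>R v y)) = (\<lambda>y. indicat_real K y *\<^sub>R v y)"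
    using K by (auto simp: fun_eq_iff indicator_def)
  finally show "set_borel_measurable lborel K v" by (simp add: set_borel_measurable_def)
  have "x \<le> 1 + x\<^sup>2" for x :: real
    using zero_le_power2[of "x - 1/2"] by (simp add: power2_eq_square algebra_simps)
  then show "AE y in lborel. y \<in> K \<longrightarrow> norm (v y) \<le> norm (1 + (norm (v y))\<^sup>2)"
    by (simp add: abs_of_nonneg)
qed

lemma L2_loc_continuous:
  fixes v :: "real^2 \<Rightarrow> 'b::euclidean_space"
  assumes "open \<Omega>" "continuous_on \<Omega> v"
  shows "L2_loc \<Omega> v"
  unfolding L2_loc_def
proof (intro conjI allI impI)
  show "set_borel_measurable lborel \<Omega> v"
    using set_measurable_continuous_on[of \<Omega> v] assms by (simp add: set_borel_measurable_def)
  fix K assume K: "compact K \<and> K \<subseteq> \<Omega>"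
  then have "continuous_on K v" using assms continuous_on_subset by blast
  then show "set_integrable lborel K (\<lambda>y. (norm (v y))\<^sup>2)"
    unfolding set_integrable_def using K by (intro borel_integrable_compact continuous_intros) auto
qed

lemma norm_add_square_le: "(norm (a + b))\<^sup>2 \<le> 2 * (norm a)\<^sup>2 + 2 * (norm (b::'a::real_inner))\<^sup>2"
  using zero_le_power2[of "norm (a - b)"] by (simp add: power2_norm_eq_inner algebra_simps inner_commute)

lemma L2_loc_add:
  assumes "L2_loc \<Omega> v" "L2_loc \<Omega> w"
  shows "L2_loc \<Omega> (\<lambda>y. v y + w y)"
  unfolding L2_loc_def
proof (intro conjI allI impI)
  have "(\<lambda>y. indicat_real \<Omega> y *\<^sub>R v y + indicat_real \<Omega> y *\<^sub>R w y) \<in> borel_measurable lborel"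
    using assms by (intro borel_measurable_add) (auto simp: L2_loc_def set_borel_measurable_def)
  then show m: "set_borel_measurable lborel \<Omega> (\<lambda>y. v y + w y)"
    by (simp add: set_borel_measurable_def scaleR_add_right)
  fix K assume K: "compact K \<and> K \<subseteq> \<Omega>"
  show "set_integrable lborel K (\<lambda>y. (norm (v y + w y))\<^sup>2)"
  proof (rule set_integrable_bound)
    show "set_integrable lborel K (\<lambda>y. 2 * (norm (v y))\<^sup>2 + 2 * (norm (w y))\<^sup>2)"
      using assms K by (intro set_integral_add set_integrable_mult_right) (auto simp: L2_loc_def)
    have "set_integrable lborel K (\<lambda>y. v y + w y)"
      using assms K by (intro set_integral_add L2_loc_set_integrable) auto
    then have "(\<lambda>y. (norm (indicat_real K y *\<^sub>R (v y + w y)))\<^sup>2) \<in> borel_measurable lborel"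
      unfolding set_integrable_def
      using borel_measurable_power[OF measurable_compose[OF borel_measurable_integrable borel_measurable_norm]] by blast
    also have "(\<lambda>y. (norm (indicat_real K y *\<^sub>R (v y + w y)))\<^sup>2)
        = (\<lambda>y. indicat_real K y *\<^sub>R (norm (v y + w y))\<^sup>2)"
      by (auto simp: indicator_def)
    finally show "set_borel_measurable lborel K (\<lambda>y. (norm (v y + w y))\<^sup>2)"
      by (simp add: set_borel_measurable_def)
    show "AE y in lborel. y \<in> K \<longrightarrow>
        norm ((norm (v y + w y))\<^sup>2) \<le> norm (2 * (norm (v y))\<^sup>2 + 2 * (norm (w y))\<^sup>2)"
      using norm_add_square_le by (auto simp: abs_of_nonneg)
  qed
qed

lemma L2_loc_scaleR:
  assumes "L2_loc \<Omega> v"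
  shows "L2_loc \<Omega> (\<lambda>y. r *\<^sub>R v y)"
proof -
  have "(\<lambda>y. r *\<^sub>R (indicat_real \<Omega> y *\<^sub>R v y)) \<in> borel_measurable lborel"
    using assms by (intro borel_measurable_scaleR[OF borel_measurable_const])
      (simp add: L2_loc_def set_borel_measurable_def)
  then show ?thesis
    using assms unfolding L2_loc_def set_borel_measurable_def
    by (auto simp: power_mult_distrib mult.commute)
qed

lemma test_function_partials:
  assumes "test_function \<Omega> \<psi>"
  obtains K where "compact K" "K \<subseteq> \<Omega>" "\<And>\<alpha> y. y \<notin> K \<Longrightarrow> partials \<alpha> \<psi> y = 0"
    "\<And>\<alpha> y. partials \<alpha> \<psi> differentiable (at y)"
proof
  let ?K = "closure {y. \<psi> y \<noteq> 0}"
  show "compact ?K" "?K \<subseteq> \<Omega>" "\<And>\<alpha> y. partials \<alpha> \<psi> differentiable (at y)"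
    using assms by (auto simp: test_function_def Cinf_on_def)
  fix \<alpha> y assume "y \<notin> ?K"
  then show "partials \<alpha> \<psi> y = 0"
  proof (induction \<alpha> arbitrary: y)
    case Nil
    then show ?case using closure_subset[of "{y. \<psi> y \<noteq> 0}"] by (auto simp: partials_def)
  next
    case (Cons i \<alpha>)
    have "((\<lambda>_. 0) has_derivative (\<lambda>_. 0)) (at y)" by simp
    then have "(partials \<alpha> \<psi> has_derivative (\<lambda>_. 0)) (at y)"
      by (rule has_derivative_transform_within_open[where s="- ?K"]) (use Cons in auto)
    then show ?case by (simp add: partials_def partialI)
  qed
qed

lemma set_integrable_test_function:
  assumes "test_function \<Omega> \<psi>" and v: "\<And>K. compact K \<Longrightarrow> K \<subseteq> \<Omega> \<Longrightarrow> set_integrable lborel K v"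
  shows "set_integrable lborel \<Omega> (\<lambda>y. partials \<alpha> \<psi> y *\<^sub>R (v y :: 'b::euclidean_space))"
proof -
  obtain K where K: "compact K" "K \<subseteq> \<Omega>" "\<And>\<alpha> y. y \<notin> K \<Longrightarrow> partials \<alpha> \<psi> y = 0"
      "\<And>\<alpha> y. partials \<alpha> \<psi> differentiable (at y)"
    using test_function_partials assms(1) by metis
  have "continuous_on K (partials \<alpha> \<psi>)"
    by (intro continuous_at_imp_continuous_on ballI differentiable_imp_continuous_within K)
  then show ?thesis using K v by (intro set_integrable_cutoff) auto
qed

text \<open>Dominated convergence along the test functions \<open>box_bump a b n\<close>, which are bounded by the indicator
of \<open>cbox a b\<close>.\<close>

lemma fundamental_lemma_box:
  fixes v :: "real^2 \<Rightarrow> 'b::euclidean_space"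
  assumes v: "\<And>K. compact K \<Longrightarrow> K \<subseteq> \<Omega> \<Longrightarrow> set_integrable lborel K v"
    and test: "\<And>\<psi>. test_function \<Omega> \<psi> \<Longrightarrow> (LINT y:\<Omega>|lborel. \<psi> y *\<^sub>R v y) = 0"
    and sub: "cbox a b \<subseteq> \<Omega>"
  shows "(LINT y:box a b|lborel. v y) = 0"
proof -
  let ?s = "\<lambda>n y. indicat_real \<Omega> y *\<^sub>R (box_bump a b n y *\<^sub>R v y)"
  have int: "integrable lborel (\<lambda>y. indicat_real (cbox a b) y *\<^sub>R v y)"
    using v[OF compact_cbox sub] by (simp add: set_integrable_def)
  have "(\<lambda>n. integral\<^sup>L lborel (?s n)) \<longlonglongrightarrow> integral\<^sup>L lborel (\<lambda>y. indicator (box a b) y *\<^sub>R v y)"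
  proof (rule integral_dominated_convergence)
    show "integrable lborel (\<lambda>y. norm (indicat_real (cbox a b) y *\<^sub>R v y))"
      using int by (rule integrable_norm)
    have "(\<lambda>y. indicat_real (box a b) y *\<^sub>R (indicat_real (cbox a b) y *\<^sub>R v y)) \<in> borel_measurable lborel"
    proof (rule borel_measurable_scaleR)
      show "(\<lambda>y. indicat_real (box a b) y) \<in> borel_measurable lborel" by simp
    qed (rule borel_measurable_integrable[OF int])
    also have "(\<lambda>y. indicat_real (box a b) y *\<^sub>R (indicat_real (cbox a b) y *\<^sub>R v y))
        = (\<lambda>y. indicat_real (box a b) y *\<^sub>R v y)"
      using box_subset_cbox[of a b] by (auto simp: fun_eq_iff indicator_def)
    finally show "(\<lambda>y. indicat_real (box a b) y *\<^sub>R v y) \<in> borel_measurable lborel" .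
    fix n
    \<comment> \<open>the empty multi-index stands for the function itself\<close>
    have "set_integrable lborel \<Omega> (\<lambda>y. partials [] (box_bump a b n) y *\<^sub>R v y)"
      by (rule set_integrable_test_function[OF test_function_box_bump[OF sub] v])
    then show "?s n \<in> borel_measurable lborel"
      by (simp add: set_integrable_def partials_def)
    show "AE y in lborel. norm (?s n y) \<le> norm (indicat_real (cbox a b) y *\<^sub>R v y)"
    proof (rule AE_I2)
      fix y show "norm (?s n y) \<le> norm (indicat_real (cbox a b) y *\<^sub>R v y)"
        using box_bump_outside[of y a b n] box_bump_bounds[of a b n y] mult_right_mono[of "box_bump a b n y" 1 "norm (v y)"]
        by (cases "y \<in> cbox a b") (auto simp: indicator_def)
    qed
  next
    show "AE y in lborel. (\<lambda>n. ?s n y) \<longlonglongrightarrow> indicat_real (box a b) y *\<^sub>R v y"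
    proof (rule AE_I2)
      fix y show "(\<lambda>n. ?s n y) \<longlonglongrightarrow> indicat_real (box a b) y *\<^sub>R v y"
      proof (cases "y \<in> \<Omega>")
        case True
        then show ?thesis using tendsto_scaleR[OF box_bump_tendsto tendsto_const] by simp
      next
        case False
        then have "y \<notin> box a b" using sub box_subset_cbox by blast
        then show ?thesis using False by simp
      qed
    qed
  qed
  moreover have "integral\<^sup>L lborel (?s n) = 0" for n
    using test[OF test_function_box_bump[OF sub]] by (simp add: set_lebesgue_integral_def)
  ultimately show ?thesis
    using LIMSEQ_unique[OF _ tendsto_const] by (force simp: set_lebesgue_integral_def)
qed

text \<open>Open boxes form an intersection-stable generator of the Borel sets, and the sets \<open>S\<close> over which the
integral vanishes are closed under complements and disjoint countable unions.\<close>

lemma fundamental_lemma_borel: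
  fixes v :: "real^2 \<Rightarrow> 'b::euclidean_space"
  assumes v: "set_integrable lborel (cbox a b) v"
    and box: "\<And>c d. cbox c d \<subseteq> cbox a b \<Longrightarrow> (LINT y:box c d|lborel. v y) = 0"
    and "S \<in> sets borel"
  shows "(LINT y:S \<inter> box a b|lborel. v y) = 0"
proof -
  have vB: "set_integrable lborel (T \<inter> box a b) v" if "T \<in> sets borel" for T
    using set_integrable_subset[OF v, of "T \<inter> box a b"] that box_subset_cbox by auto
  have 1: "Int_stable (range (\<lambda>(c, d). box c d :: (real^2) set))"
    unfolding Int_stable_def by (auto simp: box_Int_box)
  have 2: "range (\<lambda>(c, d). box c d :: (real^2) set) \<subseteq> Pow UNIV" by simp
  have 3: "S \<in> sigma_sets UNIV (range (\<lambda>(c, d). box c d :: (real^2) set))"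
    using assms(3) unfolding borel_eq_box by simp
  from 1 2 3 show ?thesis
  proof (induction S rule: sigma_sets_induct_disjoint)
    case (basic T)
    then obtain c d where "T = box c d" by auto
    then obtain e f where ef: "T \<inter> box a b = box e f" by (auto simp: box_Int_box)
    show ?case
    proof (cases "box e f = {}")
      case False
      then have "cbox e f \<subseteq> cbox a b"
        \<comment> \<open>a nonempty intersection of open boxes is an open box whose closure is the closed box\<close>
        using closure_mono[of "box e f" "box a b"] ef
        by (metis box_eq_empty(1) closure_box inf.cobounded2 subset_empty box_ne_empty(1) box_subset_cbox)
      then show ?thesis using box ef by simp
    qed (simp add: ef set_lebesgue_integral_def)
  next
    case (compl T)
    then have T: "T \<in> sets borel" by (simp add: borel_eq_box)
    have "(LINT y:(UNIV - T) \<inter> box a b \<union> T \<inter> box a b|lborel. v y)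
        = (LINT y:(UNIV - T) \<inter> box a b|lborel. v y) + (LINT y:T \<inter> box a b|lborel. v y)"
      using T by (intro set_integral_Un vB) auto
    moreover have "(UNIV - T) \<inter> box a b \<union> T \<inter> box a b = box a b" by auto
    ultimately show ?case using compl box[of a b] by simp
  next
    case (union T)
    then have T: "T i \<in> sets borel" for i by (auto simp: borel_eq_box)
    have "(LINT y:(\<Union>i. T i \<inter> box a b)|lborel. v y) = (\<Sum>i. LINT y:T i \<inter> box a b|lborel. v y)"
    proof (rule lebesgue_integral_countable_add)
      show "set_integrable lborel (\<Union>i. T i \<inter> box a b) v"
        using vB[of "\<Union>i. T i"] T by (simp add: UN_extend_simps del: UN_simps)
    qed (use T union in \<open>auto simp: disjoint_family_on_def\<close>)
    then show ?case using union by simp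
  qed (simp add: set_lebesgue_integral_def)
qed

text \<open>Integrating over the set where a component \<open>v \<bullet> e\<close> is positive shows that this set is null inside every
box with closure in \<open>\<Omega>\<close>; replacing \<open>e\<close> by \<open>- e\<close> gives the other sign. Countably many such boxes
cover \<open>\<Omega>\<close>.\<close>

lemma fundamental_lemma:
  fixes v :: "real^2 \<Rightarrow> 'b::euclidean_space"
  assumes "open \<Omega>" and v: "\<And>K. compact K \<Longrightarrow> K \<subseteq> \<Omega> \<Longrightarrow> set_integrable lborel K v"
    and test: "\<And>\<psi>. test_function \<Omega> \<psi> \<Longrightarrow> (LINT y:\<Omega>|lborel. \<psi> y *\<^sub>R v y) = 0"
  shows "AE y in lborel. y \<in> \<Omega> \<longrightarrow> v y = 0"
proof -
  have half: "AE y in lborel. y \<in> box a b \<longrightarrow> v y \<bullet> e \<le> 0" if sub: "cbox a b \<subseteq> \<Omega>" for a b e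
  proof -
    have int: "set_integrable lborel (cbox a b) v" using v sub by simp
    then have "set_integrable lborel (box a b) v"
      by (rule set_integrable_subset) (auto simp: box_subset_cbox)
    then have meas: "(\<lambda>y. indicat_real (box a b) y *\<^sub>R v y) \<in> borel_measurable borel"
      by (simp add: set_integrable_def borel_measurable_integrable)
    define S where "S = {y. 0 < (indicat_real (box a b) y *\<^sub>R v y) \<bullet> e}"
    have S: "S \<in> sets borel"
      unfolding S_def using borel_measurable_inner[OF meas borel_measurable_const] by simp
    have "(LINT y:S \<inter> box a b|lborel. v y) = 0"
      using S sub by (intro fundamental_lemma_borel[OF int] fundamental_lemma_box[OF v test]) auto
    moreover have intS: "integrable lborel (\<lambda>y. indicat_real (S \<inter> box a b) y *\<^sub>R v y)"
      using set_integrable_subset[OF int, of "S \<inter> box a b"] S box_subset_cbox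
      by (auto simp: set_integrable_def)
    ultimately have "(LINT y|lborel. (indicat_real (S \<inter> box a b) y *\<^sub>R v y) \<bullet> e) = 0"
      by (subst integral_inner_left) (auto simp: set_lebesgue_integral_def)
    moreover have "integrable lborel (\<lambda>y. (indicat_real (S \<inter> box a b) y *\<^sub>R v y) \<bullet> e)"
      using intS by (rule integrable_inner_left)
    moreover have "AE y in lborel. 0 \<le> (indicat_real (S \<inter> box a b) y *\<^sub>R v y) \<bullet> e"
      by (auto simp: S_def indicator_def split: if_splits)
    ultimately have "AE y in lborel. (indicat_real (S \<inter> box a b) y *\<^sub>R v y) \<bullet> e = 0"
      using integral_nonneg_eq_0_iff_AE by blast
    then show ?thesis
      by eventually_elim (auto simp: S_def indicator_def split: if_splits)
  qed
  have null: "AE y in lborel. y \<in> box a b \<longrightarrow> v y = 0" if sub: "cbox a b \<subseteq> \<Omega>" for a b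
  proof -
    have "AE y in lborel. \<forall>e\<in>Basis. y \<in> box a b \<longrightarrow> v y \<bullet> e \<le> 0 \<and> v y \<bullet> - e \<le> 0"
    proof (intro AE_finite_allI finite_Basis)
      fix e :: 'b
      show "AE y in lborel. y \<in> box a b \<longrightarrow> v y \<bullet> e \<le> 0 \<and> v y \<bullet> - e \<le> 0"
        using half[OF sub, of e] half[OF sub, of "- e"] by eventually_elim blast
    qed
    then show ?thesis
    proof eventually_elim
      case (elim y)
      show ?case
      proof
        assume y: "y \<in> box a b"
        show "v y = 0"
        proof (rule euclidean_eqI)
          fix e :: 'b assume "e \<in> Basis"
          then show "v y \<bullet> e = 0 \<bullet> e" using elim y by fastforce
        qed
      qed
    qed
  qed
  define F where "F = {box a b |a b. cbox a b \<subseteq> \<Omega>}"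
  obtain F' where F': "F' \<subseteq> F" "countable F'" "\<Union>F' = \<Union>F"
    using Lindelof[of F] by (auto simp: F_def open_box)
  have "\<Omega> \<subseteq> \<Union>F"
  proof
    fix x assume "x \<in> \<Omega>"
    then obtain a b where "cbox a b \<subseteq> \<Omega>" "x \<in> box a b"
      using open_contains_cbox[OF assms(1)] by metis
    then show "x \<in> \<Union>F" by (auto simp: F_def)
  qed
  moreover have "AE y in lborel. \<forall>X\<in>F'. y \<in> X \<longrightarrow> v y = 0"
    using F' null by (subst AE_ball_countable) (auto simp: F_def)
  ultimately show ?thesis
    using F' by (auto elim!: eventually_mono)
qed

lemma is_weak_partial_unique:
  fixes v w :: "real^2 \<Rightarrow> 'b::euclidean_space"
  assumes "open \<Omega>" "L2_loc \<Omega> v" "L2_loc \<Omega> w" "is_weak_partial \<Omega> \<alpha> u v" "is_weak_partial \<Omega> \<alpha> u w"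
  shows "AE y in lborel. y \<in> \<Omega> \<longrightarrow> v y = w y"
proof -
  have "AE y in lborel. y \<in> \<Omega> \<longrightarrow> v y - w y = 0"
  proof (rule fundamental_lemma[OF assms(1)])
    show "set_integrable lborel K (\<lambda>y. v y - w y)" if "compact K" "K \<subseteq> \<Omega>" for K
      using that assms by (intro set_integral_diff L2_loc_set_integrable) auto
    fix \<psi> assume t: "test_function \<Omega> \<psi>"
    have "set_integrable lborel \<Omega> (\<lambda>y. partials [] \<psi> y *\<^sub>R v y)"
         "set_integrable lborel \<Omega> (\<lambda>y. partials [] \<psi> y *\<^sub>R w y)"
      using t assms by (auto intro: set_integrable_test_function L2_loc_set_integrable)
    then have "(LINT y:\<Omega>|lborel. \<psi> y *\<^sub>R (v y - w y))
        = (LINT y:\<Omega>|lborel. \<psi> y *\<^sub>R v y) - (LINT y:\<Omega>|lborel. \<psi> y *\<^sub>R w y)"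
      by (simp add: partials_def scaleR_diff_right set_integral_diff)
    also have "(LINT y:\<Omega>|lborel. \<psi> y *\<^sub>R v y) = (LINT y:\<Omega>|lborel. \<psi> y *\<^sub>R w y)"
    proof -
      have "(- 1 :: real) ^ length \<alpha> *\<^sub>R (LINT y:\<Omega>|lborel. \<psi> y *\<^sub>R v y)
          = (- 1) ^ length \<alpha> *\<^sub>R (LINT y:\<Omega>|lborel. \<psi> y *\<^sub>R w y)"
        using assms(4,5) t by (simp add: is_weak_partial_def)
      then show ?thesis by (simp del: scaleR_scaleR)
    qed
    also have "(LINT y:\<Omega>|lborel. \<psi> y *\<^sub>R w y) - (LINT y:\<Omega>|lborel. \<psi> y *\<^sub>R w y) = 0" by simp
    finally show "(LINT y:\<Omega>|lborel. \<psi> y *\<^sub>R (v y - w y)) = 0" .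
  qed
  then show ?thesis by simp
qed

section \<open>Classical derivatives as weak derivatives\<close>

lemma partial_line_derivative:
  assumes "u differentiable (at (y + s *\<^sub>R axis i 1))"
  shows "((\<lambda>s. u (y + s *\<^sub>R axis i 1)) has_vector_derivative partial i u (y + s *\<^sub>R axis i 1)) (at s)"
proof -
  let ?D = "frechet_derivative u (at (y + s *\<^sub>R axis i 1))"
  have D: "(u has_derivative ?D) (at (y + s *\<^sub>R axis i 1))"
    using assms frechet_derivative_works by blast
  have "((\<lambda>s. y + s *\<^sub>R axis i 1) has_derivative (\<lambda>h. h *\<^sub>R axis i 1)) (at s)"
    by (auto intro!: derivative_eq_intros)
  then have "((\<lambda>s. u (y + s *\<^sub>R axis i 1)) has_derivative (\<lambda>h. ?D (h *\<^sub>R axis i 1))) (at s)"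
    using D by (rule has_derivative_compose)
  then show ?thesis
    using linear_scale[OF has_derivative_linear[OF D]]
    by (simp add: has_vector_derivative_def partial_def)
qed

lemma integral_translation:
  fixes f :: "'a::euclidean_space \<Rightarrow> 'b::euclidean_space"
  assumes "f \<in> borel_measurable borel"
  shows "(LINT y|lborel. f (y + c)) = (LINT y|lborel. f y)"
  using integral_distr[of "(+) c" lborel borel f] assms by (simp add: lborel_distr_plus add.commute)

text \<open>By translation invariance of Lebesgue measure the difference quotients of \<open>w\<close> in direction \<open>i\<close> have
integral \<open>0\<close>. They are dominated by a constant on a fixed ball, by the mean value inequality, and
converge to the partial derivative.\<close>

lemma integral_partial_compact_support:
  fixes w :: "real^2 \<Rightarrow> 'b::euclidean_space"
  assumes diff: "\<And>y. w differentiable (at y)" and cont: "continuous_on UNIV (partial i w)"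
    and K: "compact K" "\<And>y. y \<notin> K \<Longrightarrow> w y = 0" "\<And>y. y \<notin> K \<Longrightarrow> partial i w y = 0"
  shows "(LINT y|lborel. partial i w y) = 0"
proof -
  define e :: "real^2" where "e = axis i 1"
  have e: "norm e = 1" by (simp add: e_def)
  obtain R where R: "\<And>y. y \<in> K \<Longrightarrow> norm y \<le> R"
    using compact_imp_bounded[OF K(1)] by (auto simp: bounded_iff)
  \<comment> \<open>contains the supports of all difference quotients with step at most 1\<close>
  define B where "B = cball (0::real^2) (R + 1)"
  have "compact (partial i w ` K)"
    using K(1) cont continuous_on_subset compact_continuous_image by blast
  then obtain M0 where M0: "\<And>y. y \<in> K \<Longrightarrow> norm (partial i w y) \<le> M0"
    using compact_imp_bounded[of "partial i w ` K"] by (auto simp: bounded_iff)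
  define M where "M = max M0 0"
  have M: "norm (partial i w y) \<le> M" for y
    using M0[of y] K(3)[of y] by (cases "y \<in> K") (auto simp: M_def)
  have wcont: "continuous_on UNIV w"
    using diff by (simp add: continuous_at_imp_continuous_on differentiable_imp_continuous_within)
  then have wmeas: "w \<in> borel_measurable borel" by (rule borel_measurable_continuous_onI)
  have quot: "norm (w (y + h *\<^sub>R e) - w y) \<le> M * h" if "h > 0" for y h
  proof -
    have D: "((\<lambda>s. w (y + s *\<^sub>R e)) has_vector_derivative partial i w (y + s *\<^sub>R e)) (at s)" for s
      unfolding e_def by (rule partial_line_derivative[OF diff])
    have "norm (w (y + h *\<^sub>R e) - w (y + 0 *\<^sub>R e)) \<le> M * h - M * 0"
    proof (rule differentiable_bound_general[OF that])
      show "continuous_on {0..h} (\<lambda>s. w (y + s *\<^sub>R e))"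
        using D by (intro continuous_at_imp_continuous_on ballI has_vector_derivative_continuous) auto
      show "continuous_on {0..h} ((*) M)" by (intro continuous_intros)
      show "((*) M has_vector_derivative M) (at s)" for s
        by (auto intro!: derivative_eq_intros simp: has_real_derivative_iff_has_vector_derivative[symmetric])
    qed (use D M in auto)
    then show ?thesis by simp
  qed
  define h where "h n = 1 / real (Suc n)" for n
  have h: "h n > 0" "h n \<le> 1" for n by (auto simp: h_def)
  have h0: "h \<longlonglongrightarrow> 0" unfolding h_def by (rule LIMSEQ_Suc[OF lim_1_over_n])
  define s where "s n y = (1 / h n) *\<^sub>R (w (y + h n *\<^sub>R e) - w y)" for n y
  have wint: "integrable lborel w"
  proof -
    have "(\<lambda>y. indicat_real K y *\<^sub>R w y) = w" using K(2) by (auto simp: fun_eq_iff indicator_def)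
    then show ?thesis using borel_integrable_compact[OF K(1) continuous_on_subset[OF wcont]] by simp
  qed
  have sint: "(LINT y|lborel. s n y) = 0" for n
  proof -
    have "integrable lborel (\<lambda>y. w (y + h n *\<^sub>R e))"
      using integrable_distr[of "(+) (h n *\<^sub>R e)" lborel borel w] wint
      by (simp add: lborel_distr_plus add.commute)
    then show ?thesis
      unfolding s_def using wint by (simp add: integral_translation[OF wmeas])
  qed
  have "(\<lambda>n. LINT y|lborel. s n y) \<longlonglongrightarrow> (LINT y|lborel. partial i w y)"
  proof (rule integral_dominated_convergence)
    show "integrable lborel (\<lambda>y. indicator B y *\<^sub>R M)"
      by (rule borel_integrable_compact) (auto simp: B_def)
    show "partial i w \<in> borel_measurable lborel"
      using borel_measurable_continuous_onI[OF cont] by simp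
    show "s n \<in> borel_measurable lborel" for n
    proof -
      have "continuous_on UNIV (s n)"
        unfolding s_def by (intro continuous_intros continuous_on_compose2[OF wcont]) auto
      then show ?thesis using borel_measurable_continuous_onI by auto
    qed
    show "AE y in lborel. norm (s n y) \<le> indicator B y *\<^sub>R M" for n
    proof (rule AE_I2)
      fix y
      show "norm (s n y) \<le> indicator B y *\<^sub>R M"
      proof (cases "y \<in> B")
        case True
        have "norm (s n y) \<le> (1 / h n) * (M * h n)"
          unfolding s_def norm_scaleR using h[of n] by (intro mult_mono quot) auto
        then show ?thesis using True h[of n] by simp
      next
        case False
        then have y: "norm y > R + 1" by (simp add: B_def)
        have "norm (y + h n *\<^sub>R e) \<ge> norm y - norm (h n *\<^sub>R e)"
          using norm_triangle_ineq4[of "y + h n *\<^sub>R e" "h n *\<^sub>R e"] by simp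
        then have "norm (y + h n *\<^sub>R e) > R" using y h[of n] e by simp
        then have "y \<notin> K" "y + h n *\<^sub>R e \<notin> K" using R y by (auto simp: not_le[symmetric] dest: R)
        then show ?thesis using K(2) by (simp add: s_def False)
      qed
    qed
    show "AE y in lborel. (\<lambda>n. s n y) \<longlonglongrightarrow> partial i w y"
    proof (rule AE_I2)
      fix y
      have "((\<lambda>s. w (y + s *\<^sub>R e)) has_vector_derivative partial i w y) (at 0)"
        using partial_line_derivative[of w y 0 i] diff by (simp add: e_def)
      then have "(\<lambda>h. norm (w (y + (0 + h) *\<^sub>R e) - w (y + 0 *\<^sub>R e) - h *\<^sub>R partial i w y) / norm h) \<midarrow>0\<rightarrow> 0"
        unfolding has_vector_derivative_def has_derivative_at by blast
      moreover have "filterlim h (at 0) sequentially"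
        using h0 h(1) by (intro filterlim_atI) (auto intro!: always_eventually simp: less_imp_neq[symmetric])
      ultimately have "(\<lambda>n. norm (w (y + (0 + h n) *\<^sub>R e) - w (y + 0 *\<^sub>R e) - h n *\<^sub>R partial i w y) / norm (h n)) \<longlonglongrightarrow> 0"
        by (rule filterlim_compose)
      moreover have "norm (w (y + (0 + h n) *\<^sub>R e) - w (y + 0 *\<^sub>R e) - h n *\<^sub>R partial i w y) / norm (h n)
          = norm (s n y - partial i w y)" for n
      proof -
        have "s n y - partial i w y = (1 / h n) *\<^sub>R (w (y + h n *\<^sub>R e) - w y - h n *\<^sub>R partial i w y)"
          using h(1)[of n] by (simp add: s_def scaleR_diff_right)
        then show ?thesis using h(1)[of n] by simp
      qed
      ultimately have "(\<lambda>n. s n y - partial i w y) \<longlonglongrightarrow> 0"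
        using tendsto_norm_zero_iff by auto
      then show "(\<lambda>n. s n y) \<longlonglongrightarrow> partial i w y" by (simp add: LIM_zero_iff)
    qed
  qed
  then show ?thesis by (simp add: sint LIMSEQ_const_iff)
qed

lemma C1_on_imp_continuous_on: "C1_on \<Omega> u \<Longrightarrow> continuous_on \<Omega> u"
  by (auto simp: C1_on_def intro!: continuous_at_imp_continuous_on differentiable_imp_continuous_within)

lemma partial_scaleR:
  assumes "\<psi> differentiable (at y)" "u differentiable (at y)"
  shows "partial i (\<lambda>y. \<psi> y *\<^sub>R u y) y = \<psi> y *\<^sub>R partial i u y + partial i \<psi> y *\<^sub>R u y"
  using partialI[OF has_derivative_scaleR[OF frechet_derivative_works[THEN iffD1, OF assms(1)]
      frechet_derivative_works[THEN iffD1, OF assms(2)]]]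
  by (simp add: partial_def)

lemma partial_cong_open:
  assumes "open S" "y \<in> S" "\<And>z. z \<in> S \<Longrightarrow> u z = w z" "u differentiable (at y)"
  shows "w differentiable (at y)" "partial i w y = partial i u y"
proof -
  have "(w has_derivative frechet_derivative u (at y)) (at y)"
    by (rule has_derivative_transform_within_open[OF frechet_derivative_works[THEN iffD1, OF assms(4)] assms(1,2,3)])
  then show "w differentiable (at y)" "partial i w y = partial i u y"
    using partialI[of w] by (auto simp: differentiable_def partial_def)
qed

text \<open>Integration by parts: the product \<open>\<psi> u\<close>, extended by \<open>0\<close> outside \<open>\<Omega>\<close>, is continuously
differentiable with compact support, so its partial derivative has integral \<open>0\<close>.\<close>

lemma C1_on_is_weak_partial:
  fixes u :: "real^2 \<Rightarrow> 'b::euclidean_space"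
  assumes "open \<Omega>" and u: "C1_on \<Omega> u"
  shows "is_weak_partial \<Omega> [i] u (partial i u)"
  unfolding is_weak_partial_def
proof (intro allI impI)
  fix \<psi> assume t: "test_function \<Omega> \<psi>"
  obtain K where K: "compact K" "K \<subseteq> \<Omega>" "\<And>\<alpha> y. y \<notin> K \<Longrightarrow> partials \<alpha> \<psi> y = 0"
      "\<And>\<alpha> y. partials \<alpha> \<psi> differentiable (at y)"
    using test_function_partials t by metis
  have \<psi>: "\<psi> y = 0" "partial i \<psi> y = 0" if "y \<notin> K" for y
    using K(3)[OF that, of "[]"] K(3)[OF that, of "[i]"] by (auto simp: partials_def)
  have d\<psi>: "\<psi> differentiable (at y)" "partial i \<psi> differentiable (at y)" for y
    using K(4)[of "[]"] K(4)[of "[i]"] by (auto simp: partials_def)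
  have du: "u differentiable (at y)" if "y \<in> \<Omega>" for y using u that by (simp add: C1_on_def)
  have cu: "continuous_on \<Omega> (partial i u)" using u by (simp add: C1_on_def)
  have oK: "open (- K)" using K(1) compact_imp_closed by blast
  define w where "w y = (if y \<in> \<Omega> then \<psi> y *\<^sub>R u y else 0)" for y
  have wK: "w y = 0" if "y \<notin> K" for y using that \<psi> by (simp add: w_def)
  have in\<Omega>: "w differentiable (at y) \<and> partial i w y = \<psi> y *\<^sub>R partial i u y + partial i \<psi> y *\<^sub>R u y"
    if "y \<in> \<Omega>" for y
  proof -
    have "(\<lambda>y. \<psi> y *\<^sub>R u y) differentiable (at y)"
      using differentiable_scaleR[OF d\<psi>(1) du] that by simp
    then show ?thesis
      using partial_cong_open[OF assms(1) that, of "\<lambda>y. \<psi> y *\<^sub>R u y" w] partial_scaleR[OF d\<psi>(1) du] that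
      by (simp add: w_def)
  qed
  have outK: "w differentiable (at y) \<and> partial i w y = 0" if "y \<notin> K" for y
    using partial_cong_open[OF oK, of y "\<lambda>_. 0" w] that wK
    by (auto simp: partialI[OF has_derivative_const])
  have cov: "\<Omega> \<union> - K = UNIV" using K(2) by auto
  have cont: "continuous_on UNIV (partial i w)"
    unfolding cov[symmetric]
  proof (rule continuous_on_open_Un[OF assms(1) oK])
    have "continuous_on \<Omega> (\<lambda>y. \<psi> y *\<^sub>R partial i u y + partial i \<psi> y *\<^sub>R u y)"
      using d\<psi> by (intro continuous_intros cu C1_on_imp_continuous_on[OF u])
        (auto intro!: continuous_at_imp_continuous_on differentiable_imp_continuous_within)
    then show "continuous_on \<Omega> (partial i w)"
      by (rule continuous_on_eq) (use in\<Omega> in auto)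
    show "continuous_on (- K) (partial i w)"
      by (rule continuous_on_eq[of _ "\<lambda>_. 0"]) (use outK in auto)
  qed
  have "(LINT y|lborel. partial i w y) = 0"
    by (rule integral_partial_compact_support[OF _ cont K(1) wK]) (use in\<Omega> outK K(2) in blast)+
  moreover have "partial i w y = indicator \<Omega> y *\<^sub>R (\<psi> y *\<^sub>R partial i u y + partial i \<psi> y *\<^sub>R u y)" for y
    using in\<Omega>[of y] outK[of y] K(2) by (cases "y \<in> \<Omega>") auto
  ultimately have "(LINT y:\<Omega>|lborel. \<psi> y *\<^sub>R partial i u y + partial i \<psi> y *\<^sub>R u y) = 0"
    by (simp add: set_lebesgue_integral_def)
  moreover have "set_integrable lborel \<Omega> (\<lambda>y. partials [] \<psi> y *\<^sub>R partial i u y)"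
    "set_integrable lborel \<Omega> (\<lambda>y. partials [i] \<psi> y *\<^sub>R u y)"
    using t cu C1_on_imp_continuous_on[OF u] assms(1)
    by (auto intro!: set_integrable_test_function L2_loc_set_integrable L2_loc_continuous)
  ultimately have "(LINT y:\<Omega>|lborel. \<psi> y *\<^sub>R partial i u y) + (LINT y:\<Omega>|lborel. partial i \<psi> y *\<^sub>R u y) = 0"
    by (simp add: partials_def set_integral_add)
  then show "(LINT y:\<Omega>|lborel. partials [i] \<psi> y *\<^sub>R u y)
      = (- 1) ^ length [i] *\<^sub>R (LINT y:\<Omega>|lborel. \<psi> y *\<^sub>R partial i u y)"
    by (simp add: partials_def add_eq_0_iff)
qed

lemma weak_partial:
  assumes "L2_loc \<Omega> v" "is_weak_partial \<Omega> \<alpha> u v"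
  shows "L2_loc \<Omega> (weak_partial \<Omega> \<alpha> u)" "is_weak_partial \<Omega> \<alpha> u (weak_partial \<Omega> \<alpha> u)"
  using someI[of "\<lambda>v. L2_loc \<Omega> v \<and> is_weak_partial \<Omega> \<alpha> u v" v] assms
  unfolding weak_partial_def by auto

text \<open>The arbitrary choice in \<open>weak_partial\<close> is harmless: under integrals it may be replaced by any weak
derivative that happens to be known.\<close>

lemma weak_partial_AE_eq:
  fixes u :: "real^2 \<Rightarrow> 'b::euclidean_space"
  assumes "open \<Omega>" "L2_loc \<Omega> v" "is_weak_partial \<Omega> \<alpha> u v"
  shows "AE y in lborel. y \<in> \<Omega> \<longrightarrow> weak_partial \<Omega> \<alpha> u y = v y"
  using is_weak_partial_unique[OF assms(1) weak_partial(1)[OF assms(2,3)] assms(2) weak_partial(2)[OF assms(2,3)] assms(3)] .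

lemma weak_partial_C1_on:
  fixes u :: "real^2 \<Rightarrow> 'b::euclidean_space"
  assumes "open \<Omega>" "C1_on \<Omega> u"
  shows "AE y in lborel. y \<in> \<Omega> \<longrightarrow> weak_partial \<Omega> [i] u y = partial i u y"
  using assms by (intro weak_partial_AE_eq L2_loc_continuous C1_on_is_weak_partial) (auto simp: C1_on_def)

lemma is_weak_partial_add:
  fixes u1 u2 :: "real^2 \<Rightarrow> 'b::euclidean_space"
  assumes "open \<Omega>" "continuous_on \<Omega> u1" "continuous_on \<Omega> u2" "L2_loc \<Omega> v1" "L2_loc \<Omega> v2"
    "is_weak_partial \<Omega> \<alpha> u1 v1" "is_weak_partial \<Omega> \<alpha> u2 v2"
  shows "is_weak_partial \<Omega> \<alpha> (\<lambda>y. u1 y + u2 y) (\<lambda>y. v1 y + v2 y)"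
  unfolding is_weak_partial_def
proof (intro allI impI)
  fix \<psi> assume t: "test_function \<Omega> \<psi>"
  have "set_integrable lborel \<Omega> (\<lambda>y. partials \<alpha> \<psi> y *\<^sub>R u1 y)" "set_integrable lborel \<Omega> (\<lambda>y. partials \<alpha> \<psi> y *\<^sub>R u2 y)"
    "set_integrable lborel \<Omega> (\<lambda>y. partials [] \<psi> y *\<^sub>R v1 y)" "set_integrable lborel \<Omega> (\<lambda>y. partials [] \<psi> y *\<^sub>R v2 y)"
    using t assms by (auto intro!: set_integrable_test_function L2_loc_set_integrable[of \<Omega>] L2_loc_continuous)
  then show "(LINT y:\<Omega>|lborel. partials \<alpha> \<psi> y *\<^sub>R (u1 y + u2 y))
       = (- 1) ^ length \<alpha> *\<^sub>R (LINT y:\<Omega>|lborel. \<psi> y *\<^sub>R (v1 y + v2 y))"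
    using assms(6,7) t by (simp add: scaleR_add_right set_integral_add is_weak_partial_def partials_def)
qed

lemma is_weak_partial_scaleR:
  fixes u :: "real^2 \<Rightarrow> 'b::euclidean_space"
  assumes "is_weak_partial \<Omega> \<alpha> u v"
  shows "is_weak_partial \<Omega> \<alpha> (\<lambda>y. r *\<^sub>R u y) (\<lambda>y. r *\<^sub>R v y)"
  unfolding is_weak_partial_def
proof (intro allI impI)
  fix \<psi> assume "test_function \<Omega> \<psi>"
  then have "r *\<^sub>R (LINT y:\<Omega>|lborel. partials \<alpha> \<psi> y *\<^sub>R u y)
      = r *\<^sub>R ((- 1) ^ length \<alpha> *\<^sub>R (LINT y:\<Omega>|lborel. \<psi> y *\<^sub>R v y))"
    using assms by (simp add: is_weak_partial_def)
  then show "(LINT y:\<Omega>|lborel. partials \<alpha> \<psi> y *\<^sub>R (r *\<^sub>R u y))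
      = (- 1) ^ length \<alpha> *\<^sub>R (LINT y:\<Omega>|lborel. \<psi> y *\<^sub>R (r *\<^sub>R v y))"
    by (simp only: scaleR_left_commute[of _ r] set_integral_scaleR_right)
qed

section \<open>The Sobolev space and its norm\<close>

text \<open>A member of a partition of unity seen in its chart: a nonnegative continuous weight supported in a
compact part of the chart image. Such a weight makes every locally integrable integrand integrable over
the whole chart image, whatever its behaviour near the boundary.\<close>

definition cutoff :: "(real^2) set \<Rightarrow> (real^2 \<Rightarrow> real) \<Rightarrow> bool" where
  "cutoff \<Omega> \<rho> \<longleftrightarrow> open \<Omega> \<and> continuous_on \<Omega> \<rho> \<and> (\<forall>y\<in>\<Omega>. 0 \<le> \<rho> y) \<and>
     (\<exists>K. compact K \<and> K \<subseteq> \<Omega> \<and> (\<forall>y\<in>\<Omega> - K. \<rho> y = 0))"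

lemma cutoffD: "cutoff \<Omega> \<rho> \<Longrightarrow> open \<Omega>" "cutoff \<Omega> \<rho> \<Longrightarrow> y \<in> \<Omega> \<Longrightarrow> 0 \<le> \<rho> y"
  by (auto simp: cutoff_def)

lemma cutoff_integrable:
  fixes F :: "real^2 \<Rightarrow> real"
  assumes "cutoff \<Omega> \<rho>" "\<And>K. compact K \<Longrightarrow> K \<subseteq> \<Omega> \<Longrightarrow> set_integrable lborel K F"
  shows "set_integrable lborel \<Omega> (\<lambda>y. \<rho> y * F y)"
proof -
  obtain K where "compact K" "K \<subseteq> \<Omega>" "\<forall>y\<in>\<Omega> - K. \<rho> y = 0" "continuous_on K \<rho>"
    using assms(1) continuous_on_subset by (auto simp: cutoff_def)
  then show ?thesis
    using set_integrable_cutoff[of K \<Omega> \<rho> F] assms(2) by auto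
qed

lemma cutoff_integrable_continuous:
  fixes F :: "real^2 \<Rightarrow> real"
  assumes "cutoff \<Omega> \<rho>" "continuous_on \<Omega> F"
  shows "set_integrable lborel \<Omega> (\<lambda>y. \<rho> y * F y)"
proof (rule cutoff_integrable[OF assms(1)])
  fix K assume "compact K" "K \<subseteq> \<Omega>"
  then show "set_integrable lborel K F"
    unfolding set_integrable_def
    by (intro borel_integrable_compact continuous_on_subset[OF assms(2)])
qed

lemma cutoff_integrable_L2:
  "cutoff \<Omega> \<rho> \<Longrightarrow> L2_loc \<Omega> v \<Longrightarrow> set_integrable lborel \<Omega> (\<lambda>y. \<rho> y * (norm (v y))\<^sup>2)"
  by (rule cutoff_integrable) (auto simp: L2_loc_def)

lemma cutoff_integral_nonneg:
  assumes "cutoff \<Omega> \<rho>" "\<And>y. y \<in> \<Omega> \<Longrightarrow> 0 \<le> F y"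
  shows "0 \<le> (LINT y:\<Omega>|lborel. \<rho> y * F y :: real)"
  unfolding set_lebesgue_integral_def
  using assms cutoffD(2)[OF assms(1)]
  by (intro Bochner_Integration.integral_nonneg) (auto simp: indicator_def)

lemma cutoff_L2_cong_AE:
  assumes "cutoff \<Omega> \<rho>" "L2_loc \<Omega> v" "L2_loc \<Omega> w" "AE y in lborel. y \<in> \<Omega> \<longrightarrow> v y = w y"
  shows "(LINT y:\<Omega>|lborel. \<rho> y * (norm (v y))\<^sup>2) = (LINT y:\<Omega>|lborel. \<rho> y * (norm (w y))\<^sup>2)"
  unfolding set_lebesgue_integral_def
proof (rule integral_cong_AE)
  show "(\<lambda>y. indicat_real \<Omega> y *\<^sub>R (\<rho> y * (norm (v y))\<^sup>2)) \<in> borel_measurable lborel"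
    "(\<lambda>y. indicat_real \<Omega> y *\<^sub>R (\<rho> y * (norm (w y))\<^sup>2)) \<in> borel_measurable lborel"
    by (rule borel_measurable_integrable[OF cutoff_integrable_L2[OF assms(1,2), unfolded set_integrable_def]])
       (rule borel_measurable_integrable[OF cutoff_integrable_L2[OF assms(1,3), unfolded set_integrable_def]])
  show "AE y in lborel. indicat_real \<Omega> y *\<^sub>R (\<rho> y * (norm (v y))\<^sup>2) = indicat_real \<Omega> y *\<^sub>R (\<rho> y * (norm (w y))\<^sup>2)"
    using assms(4) by eventually_elim (auto simp: indicator_def)
qed

lemma local_rep_add: "local_rep c (f + g) = (\<lambda>y. local_rep c f y + local_rep c g y)"
  and local_rep_scaleR: "local_rep c (r *\<^sub>R f) = (\<lambda>y. r *\<^sub>R local_rep c f y)"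
  and local_rep_diff: "local_rep c (f - g) = (\<lambda>y. local_rep c f y - local_rep c g y)"
  by (auto simp: local_rep_def fun_eq_iff scaleR_fun_def)

lemma partial_add:
  assumes "u differentiable (at y)" "v differentiable (at y)"
  shows "partial i (\<lambda>y. u y + v y) y = partial i u y + partial i v y"
  using partialI[OF has_derivative_add[OF frechet_derivative_works[THEN iffD1, OF assms(1)]
      frechet_derivative_works[THEN iffD1, OF assms(2)]]]
  by (simp add: partial_def)

lemma partial_scaleR_const:
  assumes "u differentiable (at y)"
  shows "partial i (\<lambda>y. r *\<^sub>R u y) y = r *\<^sub>R partial i u y"
  using partialI[OF has_derivative_scaleR_right[OF frechet_derivative_works[THEN iffD1, OF assms]]]
  by (simp add: partial_def)

lemma C1_on_add:
  assumes "C1_on \<Omega> u" "C1_on \<Omega> v"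
  shows "C1_on \<Omega> (\<lambda>y. u y + v y)"
proof -
  have "continuous_on \<Omega> (partial i (\<lambda>y. u y + v y))" for i
    by (rule continuous_on_eq[of _ "\<lambda>y. partial i u y + partial i v y"])
       (use assms in \<open>auto simp: C1_on_def partial_add intro!: continuous_intros\<close>)
  then show ?thesis using assms by (simp add: C1_on_def)
qed

lemma C1_on_scaleR:
  assumes "C1_on \<Omega> u"
  shows "C1_on \<Omega> (\<lambda>y. r *\<^sub>R u y)"
proof -
  have "continuous_on \<Omega> (partial i (\<lambda>y. r *\<^sub>R u y))" for i
    by (rule continuous_on_eq[of _ "\<lambda>y. r *\<^sub>R partial i u y"])
       (use assms in \<open>auto simp: C1_on_def partial_scaleR_const intro!: continuous_intros\<close>)
  then show ?thesis using assms by (simp add: C1_on_def)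
qed

locale partitioned_surface =
  fixes A :: "'m::t2_space chart set" and P :: "('m chart \<times> ('m \<Rightarrow> real)) set"
  assumes surface: "closed_oriented_surface A" and partition: "partition_of_unity A P"
begin

lemma finite_P: "finite P"
  using partition by (simp add: partition_of_unity_def)

lemma open_chart_image: "c \<in> A \<Longrightarrow> open (chart_image c)"
  using surface by (auto simp: closed_oriented_surface_def is_chart_def)

lemma chart_in_atlas: "(c, \<rho>) \<in> P \<Longrightarrow> c \<in> A"
  using partition by (auto simp: partition_of_unity_def)

lemma cutoff_partition:
  assumes "(c, \<rho>) \<in> P"
  shows "cutoff (chart_image c) (local_rep c \<rho>)"
proof -
  have c: "c \<in> A" by (rule chart_in_atlas[OF assms])
  have P: "closure {x. \<rho> x \<noteq> 0} \<subseteq> fst c" "\<And>x. 0 \<le> \<rho> x" "Cinf_on (chart_image c) (local_rep c \<rho>)"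
    using partition assms c unfolding partition_of_unity_def by fast+
  have hom: "homeomorphism (fst c) (chart_image c) (snd c) (inv_into (fst c) (snd c))"
    using surface c by (auto simp: closed_oriented_surface_def is_chart_def)
  let ?K = "snd c ` closure {x. \<rho> x \<noteq> 0}"
  have "compact (closure {x. \<rho> x \<noteq> 0})"
    using surface closed_Int_compact[of "closure {x. \<rho> x \<noteq> 0}" UNIV]
    by (simp add: closed_oriented_surface_def)
  then have "compact ?K"
    using hom P(1) by (intro compact_continuous_image) (auto simp: homeomorphism_def intro: continuous_on_subset)
  moreover have "?K \<subseteq> chart_image c" using P(1) by (auto simp: chart_image_def)
  moreover have "local_rep c \<rho> y = 0" if "y \<in> chart_image c - ?K" for y
  proof (rule ccontr)
    assume "local_rep c \<rho> y \<noteq> 0"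
    then have "inv_into (fst c) (snd c) y \<in> closure {x. \<rho> x \<noteq> 0}"
      using closure_subset by (fastforce simp: local_rep_def)
    then have "snd c (inv_into (fst c) (snd c) y) \<in> ?K" by blast
    moreover have "snd c (inv_into (fst c) (snd c) y) = y"
      using that hom by (simp add: homeomorphism_def)
    ultimately show False using that by simp
  qed
  moreover have "continuous_on (chart_image c) (local_rep c \<rho>)"
    using P(3) unfolding Cinf_on_def
    by (auto dest!: spec[of _ "[]"] simp: partials_def
        intro!: continuous_at_imp_continuous_on differentiable_imp_continuous_within)
  ultimately show ?thesis
    using open_chart_image[OF c] P(2) unfolding cutoff_def by (auto simp: local_rep_def)
qed

lemma sobolev_space_add:
  assumes "f \<in> sobolev_space A l" "g \<in> sobolev_space A l"
  shows "f + g \<in> sobolev_space A l"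
  unfolding sobolev_space_def mem_Collect_eq local_rep_add
proof (intro ballI conjI allI impI)
  fix c assume c: "c \<in> A"
  have fg: "C1_on (chart_image c) (local_rep c f)" "C1_on (chart_image c) (local_rep c g)"
    using assms c by (auto simp: sobolev_space_def)
  then show "C1_on (chart_image c) (\<lambda>y. local_rep c f y + local_rep c g y)" by (rule C1_on_add)
  fix \<alpha> :: "2 list" assume "length \<alpha> \<le> l"
  then obtain v w where "L2_loc (chart_image c) v" "is_weak_partial (chart_image c) \<alpha> (local_rep c f) v"
    "L2_loc (chart_image c) w" "is_weak_partial (chart_image c) \<alpha> (local_rep c g) w"
    using assms c unfolding sobolev_space_def by blast
  then have "L2_loc (chart_image c) (\<lambda>y. v y + w y)"
    "is_weak_partial (chart_image c) \<alpha> (\<lambda>y. local_rep c f y + local_rep c g y) (\<lambda>y. v y + w y)"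
    by (auto intro!: is_weak_partial_add[OF open_chart_image[OF c]] C1_on_imp_continuous_on fg L2_loc_add)
  then show "\<exists>v. L2_loc (chart_image c) v \<and>
      is_weak_partial (chart_image c) \<alpha> (\<lambda>y. local_rep c f y + local_rep c g y) v"
    by (intro exI conjI)
qed

lemma sobolev_space_scaleR:
  assumes "f \<in> sobolev_space A l"
  shows "r *\<^sub>R f \<in> sobolev_space A l"
  unfolding sobolev_space_def mem_Collect_eq local_rep_scaleR
proof (intro ballI conjI allI impI)
  fix c assume c: "c \<in> A"
  show "C1_on (chart_image c) (\<lambda>y. r *\<^sub>R local_rep c f y)"
    using assms c by (auto simp: sobolev_space_def intro: C1_on_scaleR)
  fix \<alpha> :: "2 list" assume "length \<alpha> \<le> l"
  then obtain v where "L2_loc (chart_image c) v" "is_weak_partial (chart_image c) \<alpha> (local_rep c f) v"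
    using assms c unfolding sobolev_space_def by blast
  then show "\<exists>v. L2_loc (chart_image c) v \<and>
      is_weak_partial (chart_image c) \<alpha> (\<lambda>y. r *\<^sub>R local_rep c f y) v"
    by (intro exI conjI) (rule L2_loc_scaleR is_weak_partial_scaleR, assumption)+
qed

lemma sobolev_space_diff:
  assumes "f \<in> sobolev_space A l" "g \<in> sobolev_space A l"
  shows "f - g \<in> sobolev_space A l"
  using sobolev_space_add[OF assms(1) sobolev_space_scaleR[OF assms(2), of "-1"]] by simp

definition sobolev_term :: "2 list \<Rightarrow> ('m chart \<times> ('m \<Rightarrow> real)) \<Rightarrow> ('m \<Rightarrow> real^'d) \<Rightarrow> real" where
  "sobolev_term \<alpha> p f = (LINT y:chart_image (fst p)|lborel.
     local_rep (fst p) (snd p) y * (norm (weak_partial (chart_image (fst p)) \<alpha> (local_rep (fst p) f) y))\<^sup>2)"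

lemma finite_multi_indices: "finite {\<alpha> :: 2 list. length \<alpha> \<le> l}"
  using finite_lists_length_le[of "UNIV :: 2 set" l] by simp

lemma sobolev_term_nonneg: "p \<in> P \<Longrightarrow> 0 \<le> sobolev_term \<alpha> p f"
  unfolding sobolev_term_def by (rule cutoff_integral_nonneg[OF cutoff_partition]) auto

lemma sobolev_norm_eq:
  "sobolev_norm P l f = sqrt (\<Sum>\<alpha> | length \<alpha> \<le> l. \<Sum>p\<in>P. sobolev_term \<alpha> p f)"
  by (simp add: sobolev_norm_def surface_integral_def case_prod_unfold sobolev_term_def)

lemma sobolev_norm_square:
  "(sobolev_norm P l f)\<^sup>2 = (\<Sum>\<alpha> | length \<alpha> \<le> l. \<Sum>p\<in>P. sobolev_term \<alpha> p f)"
  unfolding sobolev_norm_eq by (intro real_sqrt_pow2 sum_nonneg sobolev_term_nonneg)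

lemma sobolev_norm_nonneg: "0 \<le> sobolev_norm P l f"
  unfolding sobolev_norm_eq by (intro real_sqrt_ge_zero sum_nonneg sobolev_term_nonneg)

lemma sobolev_spaceD:
  assumes "f \<in> sobolev_space A l" "c \<in> A"
  shows "C1_on (chart_image c) (local_rep c f)"
    and "length \<alpha> \<le> l \<Longrightarrow> L2_loc (chart_image c) (weak_partial (chart_image c) \<alpha> (local_rep c f))"
    and "length \<alpha> \<le> l \<Longrightarrow>
      is_weak_partial (chart_image c) \<alpha> (local_rep c f) (weak_partial (chart_image c) \<alpha> (local_rep c f))"
proof -
  show "C1_on (chart_image c) (local_rep c f)"
    using assms by (simp add: sobolev_space_def)
  assume "length \<alpha> \<le> l"
  then obtain v where "L2_loc (chart_image c) v" "is_weak_partial (chart_image c) \<alpha> (local_rep c f) v"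
    using assms unfolding sobolev_space_def by blast
  then show "L2_loc (chart_image c) (weak_partial (chart_image c) \<alpha> (local_rep c f))"
    "is_weak_partial (chart_image c) \<alpha> (local_rep c f) (weak_partial (chart_image c) \<alpha> (local_rep c f))"
    by (rule weak_partial)+
qed

lemma sobolev_term_add:
  assumes "p \<in> P" "f \<in> sobolev_space A l" "g \<in> sobolev_space A l" "length \<alpha> \<le> l"
  shows "sobolev_term \<alpha> p (f + g) \<le> 2 * sobolev_term \<alpha> p f + 2 * sobolev_term \<alpha> p g"
proof -
  obtain c \<rho> where p: "p = (c, \<rho>)" by fastforce
  have c: "c \<in> A" and cut: "cutoff (chart_image c) (local_rep c \<rho>)"
    using assms(1) chart_in_atlas cutoff_partition by (auto simp: p)
  let ?\<Omega> = "chart_image c" and ?\<rho> = "local_rep c \<rho>"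
  let ?v = "weak_partial ?\<Omega> \<alpha> (local_rep c f)" and ?w = "weak_partial ?\<Omega> \<alpha> (local_rep c g)"
  note F = sobolev_spaceD[OF assms(2) c] sobolev_spaceD(2,3)[OF assms(2) c assms(4)]
  note G = sobolev_spaceD[OF assms(3) c] sobolev_spaceD(2,3)[OF assms(3) c assms(4)]
  have L: "L2_loc ?\<Omega> (\<lambda>y. ?v y + ?w y)" by (rule L2_loc_add[OF F(4) G(4)])
  have W: "is_weak_partial ?\<Omega> \<alpha> (local_rep c (f + g)) (\<lambda>y. ?v y + ?w y)"
    unfolding local_rep_add using F G
    by (intro is_weak_partial_add[OF open_chart_image[OF c]] C1_on_imp_continuous_on) auto
  have "sobolev_term \<alpha> p (f + g) = (LINT y:?\<Omega>|lborel. ?\<rho> y * (norm (?v y + ?w y))\<^sup>2)"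
    unfolding sobolev_term_def p fst_conv snd_conv
    by (rule cutoff_L2_cong_AE[OF cut weak_partial(1)[OF L W] L weak_partial_AE_eq[OF open_chart_image[OF c] L W]])
  also have "\<dots> \<le> (LINT y:?\<Omega>|lborel. 2 * (?\<rho> y * (norm (?v y))\<^sup>2) + 2 * (?\<rho> y * (norm (?w y))\<^sup>2))"
  proof (rule set_integral_mono)
    show "set_integrable lborel ?\<Omega> (\<lambda>y. ?\<rho> y * (norm (?v y + ?w y))\<^sup>2)"
      by (rule cutoff_integrable_L2[OF cut L])
    show "set_integrable lborel ?\<Omega> (\<lambda>y. 2 * (?\<rho> y * (norm (?v y))\<^sup>2) + 2 * (?\<rho> y * (norm (?w y))\<^sup>2))"
      by (intro set_integral_add set_integrable_mult_right cutoff_integrable_L2[OF cut] F G)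
    fix y assume "y \<in> ?\<Omega>"
    then show "?\<rho> y * (norm (?v y + ?w y))\<^sup>2 \<le> 2 * (?\<rho> y * (norm (?v y))\<^sup>2) + 2 * (?\<rho> y * (norm (?w y))\<^sup>2)"
      using mult_left_mono[OF norm_add_square_le[of "?v y" "?w y"] cutoffD(2)[OF cut]]
      by (simp add: algebra_simps)
  qed
  also have "\<dots> = 2 * sobolev_term \<alpha> p f + 2 * sobolev_term \<alpha> p g"
    unfolding sobolev_term_def p fst_conv snd_conv
    by (subst set_integral_add(2))
       (auto intro!: set_integrable_mult_right cutoff_integrable_L2[OF cut] F G)
  finally show ?thesis .
qed

lemma sobolev_term_scaleR:
  assumes "p \<in> P" "f \<in> sobolev_space A l" "length \<alpha> \<le> l"
  shows "sobolev_term \<alpha> p (r *\<^sub>R f) = r\<^sup>2 * sobolev_term \<alpha> p f"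
proof -
  obtain c \<rho> where p: "p = (c, \<rho>)" by fastforce
  have c: "c \<in> A" and cut: "cutoff (chart_image c) (local_rep c \<rho>)"
    using assms(1) chart_in_atlas cutoff_partition by (auto simp: p)
  let ?\<Omega> = "chart_image c" and ?\<rho> = "local_rep c \<rho>"
  let ?v = "weak_partial ?\<Omega> \<alpha> (local_rep c f)"
  note F = sobolev_spaceD(2,3)[OF assms(2) c assms(3)]
  have L: "L2_loc ?\<Omega> (\<lambda>y. r *\<^sub>R ?v y)" by (rule L2_loc_scaleR[OF F(1)])
  have W: "is_weak_partial ?\<Omega> \<alpha> (local_rep c (r *\<^sub>R f)) (\<lambda>y. r *\<^sub>R ?v y)"
    unfolding local_rep_scaleR by (rule is_weak_partial_scaleR[OF F(2)])
  have "sobolev_term \<alpha> p (r *\<^sub>R f) = (LINT y:?\<Omega>|lborel. ?\<rho> y * (norm (r *\<^sub>R ?v y))\<^sup>2)"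
    unfolding sobolev_term_def p fst_conv snd_conv
    by (rule cutoff_L2_cong_AE[OF cut weak_partial(1)[OF L W] L weak_partial_AE_eq[OF open_chart_image[OF c] L W]])
  also have "\<dots> = (LINT y:?\<Omega>|lborel. r\<^sup>2 * (?\<rho> y * (norm (?v y))\<^sup>2))"
    by (simp add: power_mult_distrib mult.left_commute)
  finally show ?thesis by (simp add: sobolev_term_def p)
qed

lemma sobolev_norm_add_square:
  assumes "f \<in> sobolev_space A l" "g \<in> sobolev_space A l"
  shows "(sobolev_norm P l (f + g))\<^sup>2 \<le> 2 * (sobolev_norm P l f)\<^sup>2 + 2 * (sobolev_norm P l g)\<^sup>2"
  unfolding sobolev_norm_square sum_distrib_left sum.distrib[symmetric]
  using assms by (intro sum_mono sobolev_term_add) auto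

text \<open>The constant \<open>2\<close> comes from the pointwise estimate \<open>|v + w|\<^sup>2 \<le> 2 |v|\<^sup>2 + 2 |w|\<^sup>2\<close>, integrated and summed
over all terms of the norm. For continuity arguments the constant is immaterial.\<close>

lemma sobolev_norm_add:
  assumes "f \<in> sobolev_space A l" "g \<in> sobolev_space A l"
  shows "sobolev_norm P l (f + g) \<le> 2 * (sobolev_norm P l f + sobolev_norm P l g)"
proof (rule power2_le_imp_le)
  let ?a = "sobolev_norm P l f" and ?b = "sobolev_norm P l g"
  have "0 \<le> ?a * ?b" by (simp add: sobolev_norm_nonneg)
  then have "2 * ?a\<^sup>2 + 2 * ?b\<^sup>2 \<le> (2 * (?a + ?b))\<^sup>2"
    by (simp add: power2_eq_square algebra_simps)
  then show "(sobolev_norm P l (f + g))\<^sup>2 \<le> (2 * (?a + ?b))\<^sup>2"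
    using sobolev_norm_add_square[OF assms] by linarith
qed (simp add: sobolev_norm_nonneg)

lemma sobolev_norm_scaleR:
  assumes "f \<in> sobolev_space A l"
  shows "sobolev_norm P l (r *\<^sub>R f) = \<bar>r\<bar> * sobolev_norm P l f"
proof (rule power2_eq_imp_eq)
  show "(sobolev_norm P l (r *\<^sub>R f))\<^sup>2 = (\<bar>r\<bar> * sobolev_norm P l f)\<^sup>2"
    unfolding power_mult_distrib sobolev_norm_square sum_distrib_left
    using assms by (intro sum.cong refl) (auto simp: sobolev_term_scaleR)
qed (simp_all add: sobolev_norm_nonneg)

text \<open>This is how the Sobolev norm enters the volume estimate. It controls the classical gradient in
\<open>L\<^sup>2\<close>, as the classical and the weak first derivatives of a \<open>C\<^sup>1\<close> function
agree almost everywhere.\<close>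

lemma gradient_le_sobolev_norm:
  assumes f: "f \<in> sobolev_space A l" and "1 \<le> l" "(c, \<rho>) \<in> P"
  shows "(LINT y:chart_image c|lborel. local_rep c \<rho> y * (norm (partial i (local_rep c f) y))\<^sup>2)
    \<le> (sobolev_norm P l f)\<^sup>2"
proof -
  have c: "c \<in> A" and cut: "cutoff (chart_image c) (local_rep c \<rho>)"
    using assms(3) chart_in_atlas cutoff_partition by auto
  have C1: "C1_on (chart_image c) (local_rep c f)" by (rule sobolev_spaceD(1)[OF f c])
  have "(LINT y:chart_image c|lborel. local_rep c \<rho> y * (norm (partial i (local_rep c f) y))\<^sup>2)
      = sobolev_term [i] (c, \<rho>) f"
    unfolding sobolev_term_def fst_conv snd_conv
  proof (rule cutoff_L2_cong_AE[OF cut])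
    show "L2_loc (chart_image c) (partial i (local_rep c f))"
      using C1 by (intro L2_loc_continuous open_chart_image c) (simp add: C1_on_def)
    show "L2_loc (chart_image c) (weak_partial (chart_image c) [i] (local_rep c f))"
      using assms(2) by (intro sobolev_spaceD(2)[OF f c]) simp
    show "AE y in lborel. y \<in> chart_image c \<longrightarrow>
        partial i (local_rep c f) y = weak_partial (chart_image c) [i] (local_rep c f) y"
      using weak_partial_C1_on[OF open_chart_image[OF c] C1, of i] by eventually_elim auto
  qed
  also have "\<dots> \<le> (\<Sum>p\<in>P. sobolev_term [i] p f)"
    using assms(3) finite_P by (intro member_le_sum) (simp_all add: sobolev_term_nonneg)
  also have "\<dots> \<le> (sobolev_norm P l f)\<^sup>2"
    unfolding sobolev_norm_square
    using assms(2) finite_multi_indices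
    by (intro member_le_sum[of "[i]" _ "\<lambda>\<alpha>. \<Sum>p\<in>P. sobolev_term \<alpha> p f"])
       (simp_all add: sobolev_term_nonneg sum_nonneg)
  finally show ?thesis .
qed

end

section \<open>The speed of curves\<close>

text \<open>An abstract stand-in for the Sobolev space and its norm, in which curves and metrics are treated
without reference to the surface.\<close>

locale quasi_normed_subspace =
  fixes E :: "'v::real_vector set" and N :: "'v \<Rightarrow> real"
  assumes add_mem: "u \<in> E \<Longrightarrow> v \<in> E \<Longrightarrow> u + v \<in> E"
    and scale_mem: "u \<in> E \<Longrightarrow> r *\<^sub>R u \<in> E"
    and nonneg: "0 \<le> N u"
    and quasi_triangle: "u \<in> E \<Longrightarrow> v \<in> E \<Longrightarrow> N (u + v) \<le> 2 * (N u + N v)"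
    and homogeneous: "u \<in> E \<Longrightarrow> N (r *\<^sub>R u) = \<bar>r\<bar> * N u"
begin

lemma diff_mem: "u \<in> E \<Longrightarrow> v \<in> E \<Longrightarrow> u - v \<in> E"
  using add_mem[of u "(-1) *\<^sub>R v"] scale_mem[of v "-1"] by simp

lemma C1_curve_velocity_tendsto:
  assumes "C1_curve E N U a b \<gamma> \<gamma>'" "t \<in> {a..b}"
  shows "((\<lambda>s. N (\<gamma>' s - \<gamma>' t)) \<longlongrightarrow> 0) (at t within {a..b})"
proof (rule tendstoI)
  fix e :: real assume "e > 0"
  then obtain d where "d > 0" "\<forall>s\<in>{a..b}. \<bar>s - t\<bar> < d \<longrightarrow> N (\<gamma>' s - \<gamma>' t) < e"
    using assms unfolding C1_curve_def by metis
  then show "\<forall>\<^sub>F s in at t within {a..b}. dist (N (\<gamma>' s - \<gamma>' t)) 0 < e"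
    unfolding eventually_at by (intro exI[of _ d]) (auto simp: dist_real_def nonneg)
qed

lemma C1_curve_tendsto:
  assumes "C1_curve E N U a b \<gamma> \<gamma>'" "t \<in> {a..b}" "U \<subseteq> E"
  shows "((\<lambda>s. N (\<gamma> s - \<gamma> t)) \<longlongrightarrow> 0) (at t within {a..b})"
proof (rule tendsto_sandwich[where f="\<lambda>_. 0" and h="\<lambda>s. 2 * (\<bar>s - t\<bar> + \<bar>s - t\<bar> * N (\<gamma>' t))"])
  obtain d where d: "d > 0"
      "\<forall>s\<in>{a..b}. \<bar>s - t\<bar> < d \<longrightarrow> N (\<gamma> s - \<gamma> t - (s - t) *\<^sub>R \<gamma>' t) \<le> 1 * \<bar>s - t\<bar>"
    using assms zero_less_one unfolding C1_curve_def by metis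
  have mem: "\<gamma> s \<in> E" "\<gamma>' s \<in> E" if "s \<in> {a..b}" for s
    using assms that by (auto simp: C1_curve_def)
  have "N (\<gamma> s - \<gamma> t) \<le> 2 * (\<bar>s - t\<bar> + \<bar>s - t\<bar> * N (\<gamma>' t))" if "s \<in> {a..b}" "\<bar>s - t\<bar> < d" for s
  proof -
    have "N ((\<gamma> s - \<gamma> t - (s - t) *\<^sub>R \<gamma>' t) + (s - t) *\<^sub>R \<gamma>' t)
        \<le> 2 * (N (\<gamma> s - \<gamma> t - (s - t) *\<^sub>R \<gamma>' t) + N ((s - t) *\<^sub>R \<gamma>' t))"
      using mem that assms(2) by (intro quasi_triangle diff_mem scale_mem) auto
    then show ?thesis using d that homogeneous[OF mem(2)[OF assms(2)], of "s - t"] by force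
  qed
  then show "\<forall>\<^sub>F s in at t within {a..b}. N (\<gamma> s - \<gamma> t) \<le> 2 * (\<bar>s - t\<bar> + \<bar>s - t\<bar> * N (\<gamma>' t))"
    using d(1) unfolding eventually_at by (intro exI[of _ d]) (auto simp: dist_real_def)
  have "((\<lambda>s. 2 * (\<bar>s - t\<bar> + \<bar>s - t\<bar> * N (\<gamma>' t))) \<longlongrightarrow> 2 * (\<bar>t - t\<bar> + \<bar>t - t\<bar> * N (\<gamma>' t)))
      (at t within {a..b})"
    by (intro tendsto_intros)
  then show "((\<lambda>s. 2 * (\<bar>s - t\<bar> + \<bar>s - t\<bar> * N (\<gamma>' t))) \<longlongrightarrow> 0) (at t within {a..b})" by simp
qed (auto simp: nonneg)

text \<open>Differentiability of \<open>G\<close> at \<open>\<gamma> t\<close> bounds the change of the bilinear form by a multiple of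
\<open>N (\<gamma> s - \<gamma> t)\<close>, and boundedness of \<open>G (\<gamma> t)\<close> handles the change of the velocity. Continuity is what
makes the length of a curve a genuine integral, whose derivative is the speed.\<close>

lemma continuous_on_speed_square:
  assumes G: "smooth_bilinear_field E N U G" and \<gamma>: "C1_curve E N U a b \<gamma> \<gamma>'" and U: "U \<subseteq> E"
  shows "continuous_on {a..b} (\<lambda>t. G (\<gamma> t) (\<gamma>' t) (\<gamma>' t))"
  unfolding continuous_on_def
proof
  fix t assume t: "t \<in> {a..b}"
  from G obtain D where D0: "\<forall>f\<in>U. (\<forall>h\<in>E. \<forall>k\<in>E. D f [h, k] = G f h k) \<and>
     (\<forall>n\<ge>2. bounded_multilinear_form E N n (D f)) \<and>
     (\<forall>n\<ge>2. \<forall>\<epsilon>>0. \<exists>\<delta>>0. \<forall>v\<in>E. N v < \<delta> \<and> f + v \<in> U \<longrightarrow>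
        (\<forall>vs. set vs \<subseteq> E \<and> length vs = n \<longrightarrow>
           \<bar>D (f + v) vs - D f vs - D f (v # vs)\<bar> \<le> \<epsilon> * N v * prod_list (map N vs)))"
    unfolding smooth_bilinear_field_def by (elim exE)
  have D: "\<And>f h k. f \<in> U \<Longrightarrow> h \<in> E \<Longrightarrow> k \<in> E \<Longrightarrow> D f [h, k] = G f h k"
    "\<And>f n. f \<in> U \<Longrightarrow> n \<ge> 2 \<Longrightarrow> bounded_multilinear_form E N n (D f)"
    using D0 by simp_all
  have mem: "\<gamma> s \<in> U" "\<gamma> s \<in> E" "\<gamma>' s \<in> E" if "s \<in> {a..b}" for s
    using \<gamma> U that by (auto simp: C1_curve_def)
  let ?f = "\<gamma> t" and ?h = "\<gamma>' t"
  note f = mem(1)[OF t] and h = mem(3)[OF t]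
  obtain B2 where B2: "\<And>vs. set vs \<subseteq> E \<and> length vs = 2 \<Longrightarrow> \<bar>D ?f vs\<bar> \<le> B2 * prod_list (map N vs)"
    using D(2)[OF f, of 2] unfolding bounded_multilinear_form_def by auto
  obtain B3 where B3: "\<And>vs. set vs \<subseteq> E \<and> length vs = 3 \<Longrightarrow> \<bar>D ?f vs\<bar> \<le> B3 * prod_list (map N vs)"
    using D(2)[OF f, of 3] unfolding bounded_multilinear_form_def by auto
  have lin: "D ?f (us @ (r *\<^sub>R v + w) # vs) = r * D ?f (us @ v # vs) + D ?f (us @ w # vs)"
    if "set us \<subseteq> E" "set vs \<subseteq> E" "v \<in> E" "w \<in> E" "length us + 1 + length vs = 2" for us vs v w r
    using D(2)[OF f, of 2] that unfolding bounded_multilinear_form_def by blast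
  obtain \<delta> where \<delta>: "\<delta> > 0" "\<And>v vs. v \<in> E \<Longrightarrow> N v < \<delta> \<Longrightarrow> ?f + v \<in> U \<Longrightarrow> set vs \<subseteq> E \<Longrightarrow> length vs = 2 \<Longrightarrow>
      \<bar>D (?f + v) vs - D ?f vs - D ?f (v # vs)\<bar> \<le> 1 * N v * prod_list (map N vs)"
  proof -
    have "\<exists>\<delta>>0. \<forall>v\<in>E. N v < \<delta> \<and> ?f + v \<in> U \<longrightarrow> (\<forall>vs. set vs \<subseteq> E \<and> length vs = 2 \<longrightarrow>
        \<bar>D (?f + v) vs - D ?f vs - D ?f (v # vs)\<bar> \<le> 1 * N v * prod_list (map N vs))"
      using bspec[OF D0 f, THEN conjunct2, THEN conjunct2, rule_format, of 2 1] by simp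
    then show ?thesis using that by blast
  qed
  let ?e = "\<lambda>s. N (\<gamma> s - \<gamma> t)" and ?d = "\<lambda>s. N (\<gamma>' s - \<gamma>' t)"
  let ?k = "\<lambda>s. 2 * (N ?h + ?d s)"
  let ?bound = "\<lambda>s. (\<bar>B3\<bar> + 1) * (?e s * (?k s * ?k s)) + \<bar>B2\<bar> * (?d s * ?k s) + \<bar>B2\<bar> * (N ?h * ?d s)"
  have e0: "(?e \<longlongrightarrow> 0) (at t within {a..b})" by (rule C1_curve_tendsto[OF \<gamma> t U])
  have d0: "(?d \<longlongrightarrow> 0) (at t within {a..b})" by (rule C1_curve_velocity_tendsto[OF \<gamma> t])
  have est: "\<bar>G (\<gamma> s) (\<gamma>' s) (\<gamma>' s) - G ?f ?h ?h\<bar> \<le> ?bound s" if s: "s \<in> {a..b}" and es: "?e s < \<delta>" for s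
  proof -
    let ?v = "\<gamma> s - \<gamma> t" and ?w = "\<gamma>' s - \<gamma>' t" and ?l = "\<gamma>' s"
    have m: "?v \<in> E" "?w \<in> E" "?l \<in> E" "\<gamma> s \<in> U" using mem s t diff_mem by auto
    have Nl: "N ?l \<le> ?k s"
      using quasi_triangle[OF h m(2)] by simp
    have T1: "\<bar>G (\<gamma> s) ?l ?l - G ?f ?l ?l - D ?f [?v, ?l, ?l]\<bar> \<le> ?e s * (N ?l * N ?l)"
      using \<delta>(2)[OF m(1) es, of "[?l, ?l]"] m by (simp add: D(1) f)
    have T2: "\<bar>D ?f [?v, ?l, ?l]\<bar> \<le> \<bar>B3\<bar> * (?e s * (N ?l * N ?l))"
      using B3[of "[?v, ?l, ?l]"] m mult_right_mono[OF abs_ge_self[of B3], of "?e s * (N ?l * N ?l)"]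
      by (simp add: nonneg)
    have B2': "\<bar>G ?f x y\<bar> \<le> \<bar>B2\<bar> * (N x * N y)" if "x \<in> E" "y \<in> E" for x y
      using B2[of "[x, y]"] that mult_right_mono[OF abs_ge_self[of B2], of "N x * N y"]
      by (simp add: nonneg D(1)[OF f])
    have "G ?f ?l ?l = G ?f ?w ?l + G ?f ?h ?l"
      using lin[of "[]" "[?l]" ?w ?h 1] m h by (simp add: D(1)[OF f])
    moreover have "G ?f ?h ?l = G ?f ?h ?w + G ?f ?h ?h"
      using lin[of "[?h]" "[]" ?w ?h 1] m h by (simp add: D(1)[OF f])
    moreover have "\<bar>G ?f ?w ?l\<bar> \<le> \<bar>B2\<bar> * (?d s * ?k s)"
      using B2'[OF m(2,3)] mult_left_mono[OF mult_left_mono[OF Nl nonneg[of ?w]], of "\<bar>B2\<bar>"] by simp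
    moreover have "\<bar>G ?f ?h ?w\<bar> \<le> \<bar>B2\<bar> * (N ?h * ?d s)" by (rule B2'[OF h m(2)])
    moreover have "\<bar>B3\<bar> * (?e s * (N ?l * N ?l)) + ?e s * (N ?l * N ?l) \<le> (\<bar>B3\<bar> + 1) * (?e s * (?k s * ?k s))"
    proof -
      have "\<bar>B3\<bar> * (?e s * (N ?l * N ?l)) + ?e s * (N ?l * N ?l) = (\<bar>B3\<bar> + 1) * (?e s * (N ?l * N ?l))"
        by (simp add: distrib_right)
      also have "\<dots> \<le> (\<bar>B3\<bar> + 1) * (?e s * (?k s * ?k s))"
        using Nl nonneg by (intro mult_left_mono mult_mono) (auto intro: order_trans[OF nonneg Nl])
      finally show ?thesis .
    qed
    ultimately show ?thesis
      using T1 T2 unfolding abs_le_iff by linarith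
  qed
  have "(?bound \<longlongrightarrow> (\<bar>B3\<bar> + 1) * (0 * (2 * (N ?h + 0) * (2 * (N ?h + 0))))
      + \<bar>B2\<bar> * (0 * (2 * (N ?h + 0))) + \<bar>B2\<bar> * (N ?h * 0)) (at t within {a..b})"
    by (intro tendsto_intros e0 d0)
  then have "(?bound \<longlongrightarrow> 0) (at t within {a..b})" by simp
  moreover have "\<forall>\<^sub>F s in at t within {a..b}. ?e s < \<delta>"
    using order_tendstoD(2)[OF e0 \<delta>(1)] .
  then have "\<forall>\<^sub>F s in at t within {a..b}. norm (G (\<gamma> s) (\<gamma>' s) (\<gamma>' s) - G ?f ?h ?h) \<le> ?bound s"
    using eventually_at_topological[of _ t "{a..b}"] est
    by (auto simp: eventually_at_filter elim!: eventually_mono)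
  ultimately have "((\<lambda>s. G (\<gamma> s) (\<gamma>' s) (\<gamma>' s) - G ?f ?h ?h) \<longlongrightarrow> 0) (at t within {a..b})"
    by (rule Lim_null_comparison[rotated])
  then show "((\<lambda>s. G (\<gamma> s) (\<gamma>' s) (\<gamma>' s)) \<longlongrightarrow> G ?f ?h ?h) (at t within {a..b})"
    by (simp add: LIM_zero_iff)
qed

end

section \<open>Areas of parallelograms\<close>

text \<open>The area of the parallelogram spanned by \<open>a\<close> and \<open>b\<close>, that is, the norm of the bivector
\<open>a \<and> b\<close>. The volume density of an immersion is the area spanned by its partial derivatives.\<close>

definition area :: "'a::real_inner \<Rightarrow> 'a \<Rightarrow> real" where
  "area a b = sqrt ((a \<bullet> a) * (b \<bullet> b) - (a \<bullet> b)\<^sup>2)"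

text \<open>The derivative of \<open>area\<close> at \<open>(a, b)\<close> in direction \<open>(p, q)\<close>. If \<open>a, b\<close> are the columns of
\<open>\<nabla>f\<close> and \<open>p, q\<close> those of \<open>\<nabla>h\<close>, this is \<open>g\<^sup>i\<^sup>j \<langle>\<partial>\<^sub>if, \<partial>\<^sub>jh\<rangle>\<close> times the volume density.\<close>

definition area_deriv :: "'a::real_inner \<Rightarrow> 'a \<Rightarrow> 'a \<Rightarrow> 'a \<Rightarrow> real" where
  "area_deriv a b p q =
     ((a \<bullet> p) * (b \<bullet> b) + (a \<bullet> a) * (b \<bullet> q) - (a \<bullet> b) * (p \<bullet> b + a \<bullet> q)) / area a b"

text \<open>The Dirichlet integrand \<open>g\<^sup>i\<^sup>j \<langle>\<partial>\<^sub>ih, \<partial>\<^sub>jh\<rangle>\<close> with the inverse Gram matrix of \<open>(a, b)\<close> written out.\<close>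

definition dirichlet :: "'a::real_inner \<Rightarrow> 'a \<Rightarrow> 'a \<Rightarrow> 'a \<Rightarrow> real" where
  "dirichlet a b p q = ((b \<bullet> b) * (p \<bullet> p) - 2 * (a \<bullet> b) * (p \<bullet> q) + (a \<bullet> a) * (q \<bullet> q))
     / ((a \<bullet> a) * (b \<bullet> b) - (a \<bullet> b)\<^sup>2)"

lemma gram_nonneg: "0 \<le> (a \<bullet> a) * (b \<bullet> b) - (a \<bullet> b)\<^sup>2"
  using Cauchy_Schwarz_ineq[of a b] by simp

lemma area_nonneg: "0 \<le> area a b"
  using gram_nonneg by (simp add: area_def)

lemma area_square: "(area a b)\<^sup>2 = (a \<bullet> a) * (b \<bullet> b) - (a \<bullet> b)\<^sup>2"
  using gram_nonneg by (simp add: area_def)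

lemma area_commute: "area a b = area b a"
  by (simp add: area_def inner_commute mult.commute)

lemma area_pos_iff: "area a b > 0 \<longleftrightarrow> (a \<bullet> a) * (b \<bullet> b) - (a \<bullet> b)\<^sup>2 > 0"
  by (simp add: area_def)

lemma area_le: "area a b \<le> norm a * norm b"
  by (rule power2_le_imp_le) (simp_all add: area_square power_mult_distrib power2_norm_eq_inner)

text \<open>The right-hand side is the norm of a linear function of \<open>b\<close>. This makes \<open>area a\<close> a seminorm,
from which the Lipschitz estimates below follow. For \<open>a = 0\<close> both sides vanish, since division by
zero yields zero.\<close>

lemma area_eq_norm: "area a b = norm (norm a *\<^sub>R b - ((a \<bullet> b) / norm a) *\<^sub>R a)"
proof (rule power2_eq_imp_eq)
  show "(area a b)\<^sup>2 = (norm (norm a *\<^sub>R b - ((a \<bullet> b) / norm a) *\<^sub>R a))\<^sup>2"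
  proof (cases "a = 0")
    case False
    then have n: "a \<bullet> a = norm a * norm a" "norm a \<noteq> 0" by (auto simp: dot_square_norm power2_eq_square)
    then show ?thesis
      unfolding area_square power2_norm_eq_inner
      by (simp add: inner_diff_left inner_diff_right inner_commute power2_eq_square field_simps)
  qed (simp add: area_square)
qed (simp_all add: area_nonneg)

lemma area_diff_right: "\<bar>area a b - area a b'\<bar> \<le> norm a * norm (b - b')"
proof -
  have "(norm a *\<^sub>R b - ((a \<bullet> b) / norm a) *\<^sub>R a) - (norm a *\<^sub>R b' - ((a \<bullet> b') / norm a) *\<^sub>R a)
      = norm a *\<^sub>R (b - b') - ((a \<bullet> (b - b')) / norm a) *\<^sub>R a"
    by (simp add: algebra_simps inner_diff_right diff_divide_distrib)
  then have "\<bar>area a b - area a b'\<bar> \<le> area a (b - b')"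
    unfolding area_eq_norm by (metis norm_triangle_ineq3)
  then show ?thesis using area_le order_trans by blast
qed

text \<open>The local Lipschitz constant grows only linearly in the vectors. After integration this bounds the
difference of two volumes by the \<open>L\<^sup>2\<close> norms of the gradients.\<close>

lemma area_diff: "\<bar>area a b - area a' b'\<bar> \<le> norm (a - a') * norm b + norm a' * norm (b - b')"
  using area_diff_right[of b a a'] area_diff_right[of a' b b']
  by (simp add: area_commute[of _ b] mult.commute)

lemma has_real_derivative_sqrt:
  assumes "(f has_real_derivative D) (at x within S)" "f x > 0"
  shows "((\<lambda>s. sqrt (f s)) has_real_derivative D / (2 * sqrt (f x))) (at x within S)"
  by (rule DERIV_cong[OF DERIV_chain2[OF DERIV_real_sqrt[OF assms(2)] assms(1)]]) (simp add: field_simps)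

lemma area_has_derivative:
  assumes "area a b > 0"
  shows "((\<lambda>s. area (a + s *\<^sub>R p) (b + s *\<^sub>R q)) has_real_derivative area_deriv a b p q) (at 0)"
proof -
  define f where "f s = (a \<bullet> a + 2 * s * (a \<bullet> p) + s\<^sup>2 * (p \<bullet> p)) * (b \<bullet> b + 2 * s * (b \<bullet> q) + s\<^sup>2 * (q \<bullet> q))
      - (a \<bullet> b + s * (p \<bullet> b + a \<bullet> q) + s\<^sup>2 * (p \<bullet> q))\<^sup>2" for s
  have eq: "area (a + s *\<^sub>R p) (b + s *\<^sub>R q) = sqrt (f s)" for s
  proof -
    have sq: "(x + s *\<^sub>R z) \<bullet> (x + s *\<^sub>R z) = x \<bullet> x + 2 * s * (x \<bullet> z) + s\<^sup>2 * (z \<bullet> z)" for x z :: 'a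
      by (simp add: inner_add_left inner_add_right inner_commute[of z x] power2_eq_square distrib_left)
    have "(a + s *\<^sub>R p) \<bullet> (b + s *\<^sub>R q) = a \<bullet> b + s * (p \<bullet> b + a \<bullet> q) + s\<^sup>2 * (p \<bullet> q)"
      by (simp add: inner_add_left inner_add_right power2_eq_square distrib_left)
    then show ?thesis unfolding area_def f_def sq by simp
  qed
  let ?n = "(a \<bullet> p) * (b \<bullet> b) + (a \<bullet> a) * (b \<bullet> q) - (a \<bullet> b) * (p \<bullet> b + a \<bullet> q)"
  have "(f has_real_derivative 2 * ?n) (at 0)"
    unfolding f_def[abs_def] by (auto intro!: derivative_eq_intros simp: algebra_simps)
  moreover have f0: "f 0 = (a \<bullet> a) * (b \<bullet> b) - (a \<bullet> b)\<^sup>2" by (simp add: f_def)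
  moreover have "f 0 > 0" using assms by (simp add: f0 area_pos_iff)
  ultimately have "((\<lambda>s. sqrt (f s)) has_real_derivative 2 * ?n / (2 * sqrt (f 0))) (at 0)"
    by (intro has_real_derivative_sqrt)
  then show ?thesis
    unfolding eq f0 area_def[symmetric] mult_divide_mult_cancel_left_if by (simp add: area_deriv_def)
qed

text \<open>The pointwise Cauchy-Schwarz inequality \<open>(tr (g\<^sup>-\<^sup>1 \<langle>\<nabla>f, \<nabla>h\<rangle>))\<^sup>2 \<le> 2 |\<nabla>h|\<^sup>2\<close>, where \<open>2 = |\<nabla>f|\<^sup>2\<close> is the
dimension of the surface. Replacing \<open>b\<close> by its component \<open>b'\<close> orthogonal to \<open>a\<close>, and \<open>q\<close>
accordingly, makes the Gram matrix diagonal, and then each of the two diagonal terms is estimated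
separately.\<close>

lemma area_deriv_square_le:
  assumes "area a b > 0"
  shows "(area_deriv a b p q)\<^sup>2 \<le> 2 * dirichlet a b p q * (area a b)\<^sup>2" and "0 \<le> dirichlet a b p q"
proof -
  have a0: "a \<bullet> a > 0"
    using assms by (cases "a = 0") (auto simp: area_pos_iff)
  define r where "r = (a \<bullet> b) / (a \<bullet> a)"
  have r: "a \<bullet> b = r * (a \<bullet> a)" using a0 by (simp add: r_def)
  define b' q' where "b' = b - r *\<^sub>R a" and "q' = q - r *\<^sub>R p"
  have b: "b = b' + r *\<^sub>R a" and q: "q = q' + r *\<^sub>R p" by (simp_all add: b'_def q'_def)
  have ab': "a \<bullet> b' = 0" by (simp add: b'_def inner_diff_right r)
  have \<Delta>: "(area a b)\<^sup>2 = (a \<bullet> a) * (b' \<bullet> b')"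
    unfolding area_square b using ab'
    by (simp add: inner_add_left inner_add_right inner_commute[of b' a] power2_eq_square algebra_simps)
  define X Y where "X = (a \<bullet> p) * (b' \<bullet> b')" and "Y = (a \<bullet> a) * (b' \<bullet> q')"
  have XY: "area_deriv a b p q * area a b = X + Y"
  proof -
    have "area_deriv a b p q * area a b
        = (a \<bullet> p) * (b \<bullet> b) + (a \<bullet> a) * (b \<bullet> q) - (a \<bullet> b) * (p \<bullet> b + a \<bullet> q)"
      using assms by (simp add: area_deriv_def)
    also have "\<dots> = X + Y"
      unfolding X_def Y_def b q using ab'
      by (simp add: inner_add_left inner_add_right inner_commute[of b' a] inner_commute[of b' p]
          inner_commute[of a p] algebra_simps)
    finally show ?thesis .
  qed
  define Z where "Z = (b' \<bullet> b') * (p \<bullet> p) + (a \<bullet> a) * (q' \<bullet> q')"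
  have Z: "dirichlet a b p q * (area a b)\<^sup>2 = Z"
  proof -
    have "dirichlet a b p q * (area a b)\<^sup>2 = (b \<bullet> b) * (p \<bullet> p) - 2 * (a \<bullet> b) * (p \<bullet> q) + (a \<bullet> a) * (q \<bullet> q)"
      using assms by (simp add: dirichlet_def area_square[symmetric])
    also have "\<dots> = Z"
      unfolding Z_def b q using ab' by (simp add: algebra_simps inner_commute power2_eq_square)
    finally show ?thesis .
  qed
  have pos: "(area a b)\<^sup>2 > 0" using assms by simp
  have "0 \<le> Z" using a0 by (simp add: Z_def)
  then show nn: "0 \<le> dirichlet a b p q" using Z pos by (metis zero_le_mult_iff not_less)
  have "X\<^sup>2 \<le> (a \<bullet> a) * (p \<bullet> p) * (b' \<bullet> b')\<^sup>2"
    unfolding X_def power_mult_distrib by (intro mult_right_mono Cauchy_Schwarz_ineq) simp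
  moreover have "Y\<^sup>2 \<le> (a \<bullet> a)\<^sup>2 * ((b' \<bullet> b') * (q' \<bullet> q'))"
    unfolding Y_def power_mult_distrib by (intro mult_left_mono Cauchy_Schwarz_ineq) simp
  moreover have "(X + Y)\<^sup>2 \<le> 2 * X\<^sup>2 + 2 * Y\<^sup>2"
    using zero_le_power2[of "X - Y"] by (simp add: power2_eq_square algebra_simps)
  ultimately have "(X + Y)\<^sup>2 \<le> 2 * ((area a b)\<^sup>2 * Z)"
    unfolding \<Delta> Z_def by (simp add: power2_eq_square algebra_simps)
  then have "(area_deriv a b p q)\<^sup>2 * (area a b)\<^sup>2 \<le> 2 * Z * (area a b)\<^sup>2"
    unfolding power_mult_distrib[symmetric] XY by (simp add: mult.commute)
  then show "(area_deriv a b p q)\<^sup>2 \<le> 2 * dirichlet a b p q * (area a b)\<^sup>2"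
    using pos unfolding Z[symmetric] mult.assoc[symmetric] by (simp add: mult_le_cancel_right)
qed

text \<open>With a free parameter \<open>\<kappa>\<close> the right-hand side is linear in the two densities, hence can be integrated
chart by chart and summed; optimising \<open>\<kappa>\<close> afterwards gives the Cauchy-Schwarz inequality on the
whole surface.\<close>

lemma area_deriv_le:
  assumes "area a b > 0" "\<kappa> > 0"
  shows "\<bar>area_deriv a b p q\<bar> \<le> (\<kappa> * area a b + 2 / \<kappa> * (dirichlet a b p q * area a b)) / 2"
proof (rule power2_le_imp_le)
  let ?A = "area a b" and ?g = "dirichlet a b p q"
  have "0 \<le> (\<kappa> * ?A - 2 / \<kappa> * (?g * ?A))\<^sup>2" by simp
  then have "4 * (2 * ?g * ?A\<^sup>2) \<le> (\<kappa> * ?A + 2 / \<kappa> * (?g * ?A))\<^sup>2"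
    using assms(2) by (simp add: power2_eq_square field_simps)
  then have "2 * ?g * ?A\<^sup>2 \<le> ((\<kappa> * ?A + 2 / \<kappa> * (?g * ?A)) / 2)\<^sup>2"
    by (simp add: power_divide)
  then show "\<bar>area_deriv a b p q\<bar>\<^sup>2 \<le> ((\<kappa> * ?A + 2 / \<kappa> * (?g * ?A)) / 2)\<^sup>2"
    using area_deriv_square_le(1)[OF assms(1), of p q] by simp
  show "0 \<le> (\<kappa> * ?A + 2 / \<kappa> * (?g * ?A)) / 2"
    using assms area_deriv_square_le(2)[OF assms(1)] by simp
qed

lemma matrix_inv_eqI:
  fixes M J :: "real^'n^'n"
  assumes "M ** J = mat 1" "J ** M = mat 1"
  shows "matrix_inv M = J"
proof -
  have "matrix_inv M ** M = mat 1"
    unfolding matrix_inv_def using someI[of "\<lambda>X. M ** X = mat 1 \<and> X ** M = mat 1" J] assms by blast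
  then show ?thesis
    using assms by (metis matrix_mul_assoc matrix_mul_lid matrix_mul_rid)
qed

lemma vol_density_eq_area: "vol_density u y = area (partial 1 u y) (partial 2 u y)"
  by (simp add: vol_density_def area_def pullback_metric_def det_2 power2_eq_square inner_commute)

lemma grad_sq_eq_dirichlet:
  assumes "vol_density u y > 0"
  shows "grad_sq u w y = dirichlet (partial 1 u y) (partial 2 u y) (partial 1 w y) (partial 2 w y)"
proof -
  let ?M = "pullback_metric u y"
  define \<alpha> \<beta> \<eta> where "\<alpha> = partial 1 u y \<bullet> partial 1 u y" and "\<beta> = partial 1 u y \<bullet> partial 2 u y"
    and "\<eta> = partial 2 u y \<bullet> partial 2 u y"
  define d where "d = \<alpha> * \<eta> - \<beta>\<^sup>2"
  have d: "d \<noteq> 0" "\<alpha> * \<eta> = d + \<beta> * \<beta>"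
    using assms by (auto simp: vol_density_eq_area area_pos_iff d_def \<alpha>_def \<beta>_def \<eta>_def power2_eq_square)
  have M: "?M $ 1 $ 1 = \<alpha>" "?M $ 1 $ 2 = \<beta>" "?M $ 2 $ 1 = \<beta>" "?M $ 2 $ 2 = \<eta>"
    by (simp_all add: pullback_metric_def \<alpha>_def \<beta>_def \<eta>_def inner_commute)
  define J :: "real^2^2" where
    "J = (\<chi> i j. (if i = j then (if i = 1 then \<eta> else \<alpha>) else - \<beta>) / d)"
  have "?M ** J = mat 1"
    using d by (simp add: J_def vec_eq_iff forall_2 matrix_matrix_mult_def sum_2 mat_def M field_simps)
  moreover have "J ** ?M = mat 1"
    using calculation matrix_left_right_inverse by blast
  ultimately have "matrix_inv ?M = J"
    by (intro matrix_inv_eqI)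
  then show ?thesis
    unfolding dirichlet_def \<alpha>_def[symmetric] \<beta>_def[symmetric] \<eta>_def[symmetric] d_def[symmetric]
    using d(1) by (simp add: grad_sq_def sum_2 J_def inner_commute[of "partial 2 w y" "partial 1 w y"] field_simps)
qed

section \<open>Differentiating the area under the integral\<close>

lemma continuous_on_area [continuous_intros]:
  "continuous_on S a \<Longrightarrow> continuous_on S b \<Longrightarrow> continuous_on S (\<lambda>y. area (a y) (b y))"
  unfolding area_def by (intro continuous_intros)

lemma continuous_on_area_deriv:
  assumes "continuous_on S a" "continuous_on S b" "continuous_on S p" "continuous_on S q"
    and "\<And>y. y \<in> S \<Longrightarrow> area (a y) (b y) > 0"
  shows "continuous_on S (\<lambda>y. area_deriv (a y) (b y) (p y) (q y))"
proof -
  have "\<forall>y\<in>S. area (a y) (b y) \<noteq> 0" using assms(5) by fastforce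
  then show ?thesis
    unfolding area_deriv_def by (intro continuous_intros assms)
qed

lemma continuous_on_dirichlet:
  assumes "continuous_on S a" "continuous_on S b" "continuous_on S p" "continuous_on S q"
    and "\<And>y. y \<in> S \<Longrightarrow> area (a y) (b y) > 0"
  shows "continuous_on S (\<lambda>y. dirichlet (a y) (b y) (p y) (q y))"
proof -
  have "\<forall>y\<in>S. (a y \<bullet> a y) * (b y \<bullet> b y) - (a y \<bullet> b y)\<^sup>2 \<noteq> 0"
    using assms(5) by (fastforce simp: area_pos_iff)
  then show ?thesis
    unfolding dirichlet_def by (intro continuous_intros assms)
qed

text \<open>Differentiation under the integral along straight lines: the difference quotients are dominated by a
continuous function thanks to \<open>area_diff\<close>.\<close>

lemma area_integral_affine_derivative:
  fixes a b p q :: "real^2 \<Rightarrow> 'b::real_inner"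
  assumes cut: "cutoff \<Omega> \<rho>"
    and cont: "continuous_on \<Omega> a" "continuous_on \<Omega> b" "continuous_on \<Omega> p" "continuous_on \<Omega> q"
    and pos: "\<And>y. y \<in> \<Omega> \<Longrightarrow> area (a y) (b y) > 0"
  shows "((\<lambda>s. LINT y:\<Omega>|lborel. \<rho> y * area (a y + s *\<^sub>R p y) (b y + s *\<^sub>R q y)) has_real_derivative
    (LINT y:\<Omega>|lborel. \<rho> y * area_deriv (a y) (b y) (p y) (q y))) (at 0)"
proof -
  let ?V = "\<lambda>s y. area (a y + s *\<^sub>R p y) (b y + s *\<^sub>R q y)"
  let ?F = "\<lambda>s. LINT y:\<Omega>|lborel. \<rho> y * ?V s y"
  let ?D = "LINT y:\<Omega>|lborel. \<rho> y * area_deriv (a y) (b y) (p y) (q y)"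
  have contV: "continuous_on \<Omega> (?V s)" for s by (intro continuous_intros cont)
  have int: "set_integrable lborel \<Omega> (\<lambda>y. \<rho> y * ?V s y)" for s
    by (rule cutoff_integrable_continuous[OF cut contV])
  have "((\<lambda>s. (?F s - ?F 0) / (s - 0)) \<longlongrightarrow> ?D) (at 0)"
    unfolding tendsto_at_iff_sequentially comp_def
  proof (intro allI impI)
    fix X :: "nat \<Rightarrow> real" assume X: "\<forall>n. X n \<in> UNIV - {0}" and X0: "X \<longlonglongrightarrow> 0"
    have Xn: "X n \<noteq> 0" for n using X by auto
    have "bounded (range X)" using X0 by (rule convergent_imp_bounded)
    then obtain B where B: "\<And>n. \<bar>X n\<bar> \<le> B" by (auto simp: bounded_iff)
    let ?Q = "\<lambda>n y. (?V (X n) y - ?V 0 y) / X n"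
    let ?w = "\<lambda>y. norm (p y) * (norm (b y) + B * norm (q y)) + norm (a y) * norm (q y)"
    have Q: "(?F (X n) - ?F 0) / (X n - 0) = (LINT y:\<Omega>|lborel. \<rho> y * ?Q n y)" for n
    proof -
      have "?F (X n) - ?F 0 = (LINT y:\<Omega>|lborel. \<rho> y * ?V (X n) y - \<rho> y * ?V 0 y)"
        by (rule set_integral_diff(2)[OF int int, symmetric])
      also have "(\<lambda>y. \<rho> y * ?V (X n) y - \<rho> y * ?V 0 y) = (\<lambda>y. X n * (\<rho> y * ?Q n y))"
        using Xn[of n] by (simp add: fun_eq_iff field_simps)
      also have "(LINT y:\<Omega>|lborel. X n * (\<rho> y * ?Q n y)) = X n * (LINT y:\<Omega>|lborel. \<rho> y * ?Q n y)"
        by (rule set_integral_mult_right)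
      finally show ?thesis using Xn[of n] by simp
    qed
    have Qbound: "\<bar>?Q n y\<bar> \<le> ?w y" for n y
    proof -
      have "\<bar>?V (X n) y - ?V 0 y\<bar> \<le> norm (X n *\<^sub>R p y) * norm (b y + X n *\<^sub>R q y) + norm (a y) * norm (X n *\<^sub>R q y)"
        using area_diff[of "a y + X n *\<^sub>R p y" "b y + X n *\<^sub>R q y" "a y" "b y"] by simp
      also have "\<dots> = \<bar>X n\<bar> * (norm (p y) * norm (b y + X n *\<^sub>R q y) + norm (a y) * norm (q y))"
        by (simp add: algebra_simps)
      finally have "\<bar>?Q n y\<bar> \<le> norm (p y) * norm (b y + X n *\<^sub>R q y) + norm (a y) * norm (q y)"
        using Xn[of n] by (simp add: abs_divide divide_le_eq mult.commute)
      moreover have "norm (b y + X n *\<^sub>R q y) \<le> norm (b y) + B * norm (q y)"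
        using norm_triangle_ineq[of "b y" "X n *\<^sub>R q y"] mult_right_mono[OF B[of n], of "norm (q y)"] by simp
      ultimately show ?thesis
        using mult_left_mono[of "norm (b y + X n *\<^sub>R q y)" "norm (b y) + B * norm (q y)" "norm (p y)"] by simp
    qed
    have "(\<lambda>n. LINT y:\<Omega>|lborel. \<rho> y * ?Q n y) \<longlonglongrightarrow> ?D"
      unfolding set_lebesgue_integral_def
    proof (rule integral_dominated_convergence)
      show "integrable lborel (\<lambda>y. indicat_real \<Omega> y *\<^sub>R (\<rho> y * ?w y))"
        using cutoff_integrable_continuous[OF cut, of ?w] cont
        by (simp add: set_integrable_def continuous_intros)
      have "set_integrable lborel \<Omega> (\<lambda>y. \<rho> y * area_deriv (a y) (b y) (p y) (q y))"
        by (rule cutoff_integrable_continuous[OF cut continuous_on_area_deriv[OF cont pos]])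
      then show "(\<lambda>y. indicat_real \<Omega> y *\<^sub>R (\<rho> y * area_deriv (a y) (b y) (p y) (q y))) \<in> borel_measurable lborel"
        unfolding set_integrable_def by (rule borel_measurable_integrable)
      fix n
      have "continuous_on \<Omega> (?Q n)"
        using Xn[of n] contV by (intro continuous_intros cont) auto
      then have "set_integrable lborel \<Omega> (\<lambda>y. \<rho> y * ?Q n y)"
        by (rule cutoff_integrable_continuous[OF cut])
      then show "(\<lambda>y. indicat_real \<Omega> y *\<^sub>R (\<rho> y * ?Q n y)) \<in> borel_measurable lborel"
        unfolding set_integrable_def by (rule borel_measurable_integrable)
      show "AE y in lborel. norm (indicat_real \<Omega> y *\<^sub>R (\<rho> y * ?Q n y)) \<le> indicat_real \<Omega> y *\<^sub>R (\<rho> y * ?w y)"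
      proof (rule AE_I2)
        fix y
        show "norm (indicat_real \<Omega> y *\<^sub>R (\<rho> y * ?Q n y)) \<le> indicat_real \<Omega> y *\<^sub>R (\<rho> y * ?w y)"
        proof (cases "y \<in> \<Omega>")
          case True
          then show ?thesis
            using mult_left_mono[OF Qbound cutoffD(2)[OF cut True]] cutoffD(2)[OF cut True]
            by (simp add: abs_mult)
        qed simp
      qed
    next
      show "AE y in lborel. (\<lambda>n. indicat_real \<Omega> y *\<^sub>R (\<rho> y * ?Q n y))
          \<longlonglongrightarrow> indicat_real \<Omega> y *\<^sub>R (\<rho> y * area_deriv (a y) (b y) (p y) (q y))"
      proof (rule AE_I2)
        fix y
        show "(\<lambda>n. indicat_real \<Omega> y *\<^sub>R (\<rho> y * ?Q n y))
          \<longlonglongrightarrow> indicat_real \<Omega> y *\<^sub>R (\<rho> y * area_deriv (a y) (b y) (p y) (q y))"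
        proof (cases "y \<in> \<Omega>")
          case True
          have "((\<lambda>s. (?V s y - ?V 0 y) / (s - 0)) \<longlongrightarrow> area_deriv (a y) (b y) (p y) (q y)) (at 0)"
            using area_has_derivative[OF pos[OF True]] unfolding has_field_derivative_iff .
          then have "(\<lambda>n. (?V (X n) y - ?V 0 y) / (X n - 0)) \<longlonglongrightarrow> area_deriv (a y) (b y) (p y) (q y)"
            unfolding tendsto_at_iff_sequentially comp_def using X X0 by blast
          then show ?thesis
            by (intro tendsto_intros) simp
        qed simp
      qed
    qed
    then show "(\<lambda>n. (?F (X n) - ?F 0) / (X n - 0)) \<longlonglongrightarrow> ?D" unfolding Q .
  qed
  then show ?thesis unfolding has_field_derivative_iff .
qed

text \<open>Comparison with a point on the straight line through \<open>(x, z)\<close> in direction \<open>(p, q)\<close>. If \<open>\<eta>\<close> equals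
\<open>\<epsilon> |\<sigma>|\<close> and the \<open>L\<^sup>2\<close> norms of \<open>r1, r2\<close> are at most \<open>\<epsilon> |\<sigma>|\<close>, the integral of the right-hand side is
\<open>O(\<epsilon> |\<sigma>|)\<close>.\<close>

lemma area_perturb:
  fixes x z r1 r2 p q :: "'b::real_inner"
  assumes "\<eta> > 0" "\<bar>\<sigma>\<bar> \<le> 1"
  shows "\<bar>area (x + \<sigma> *\<^sub>R p + r1) (z + \<sigma> *\<^sub>R q + r2) - area (x + \<sigma> *\<^sub>R p) (z + \<sigma> *\<^sub>R q)\<bar>
    \<le> (1 + 1 / \<eta>) * ((norm r1)\<^sup>2 + (norm r2)\<^sup>2)
      + \<eta> * ((norm x)\<^sup>2 + (norm z)\<^sup>2 + (norm p)\<^sup>2 + (norm q)\<^sup>2)"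
proof -
  let ?a = "x + \<sigma> *\<^sub>R p" and ?b = "z + \<sigma> *\<^sub>R q"
  have young: "s * t \<le> (1 / \<eta> * s\<^sup>2 + \<eta> * t\<^sup>2) / 2" for s t :: real
  proof -
    have "0 \<le> (s - \<eta> * t)\<^sup>2 / \<eta>" using assms(1) by simp
    then show ?thesis using assms(1) by (simp add: field_simps power2_eq_square)
  qed
  have sq: "(norm (x + \<sigma> *\<^sub>R p))\<^sup>2 \<le> 2 * (norm x)\<^sup>2 + 2 * (norm p)\<^sup>2" for x p :: 'b
  proof -
    have "\<sigma>\<^sup>2 * (norm p)\<^sup>2 \<le> 1 * (norm p)\<^sup>2"
      using assms(2) by (intro mult_right_mono) (auto simp: abs_square_le_1)
    then show ?thesis
      using norm_add_square_le[of x "\<sigma> *\<^sub>R p"] by (simp add: power_mult_distrib)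
  qed
  have "\<bar>area (?a + r1) (?b + r2) - area ?a ?b\<bar> \<le> norm r1 * norm (?b + r2) + norm ?a * norm r2"
    using area_diff[of "?a + r1" "?b + r2" ?a ?b] by simp
  also have "\<dots> \<le> norm r1 * norm ?b + norm r1 * norm r2 + norm r2 * norm ?a"
    using mult_left_mono[OF norm_triangle_ineq[of ?b r2], of "norm r1"] by (simp add: algebra_simps)
  also have "\<dots> \<le> (1 / \<eta> * (norm r1)\<^sup>2 + \<eta> * (norm ?b)\<^sup>2) / 2 + ((norm r1)\<^sup>2 + (norm r2)\<^sup>2) / 2
      + (1 / \<eta> * (norm r2)\<^sup>2 + \<eta> * (norm ?a)\<^sup>2) / 2"
    using young[of "norm r1" "norm ?b"] young[of "norm r2" "norm ?a"] sum_squares_bound[of "norm r1" "norm r2"]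
    by (intro add_mono) simp_all
  also have "\<dots> = (1 + 1 / \<eta>) * ((norm r1)\<^sup>2 + (norm r2)\<^sup>2) / 2 + \<eta> * ((norm ?a)\<^sup>2 + (norm ?b)\<^sup>2) / 2"
    by (simp add: algebra_simps add_divide_distrib)
  also have "\<dots> \<le> (1 + 1 / \<eta>) * ((norm r1)\<^sup>2 + (norm r2)\<^sup>2)
      + \<eta> * ((norm x)\<^sup>2 + (norm z)\<^sup>2 + (norm p)\<^sup>2 + (norm q)\<^sup>2)"
  proof (rule add_mono)
    have half: "w / 2 \<le> w" if "0 \<le> w" for w :: real using that by simp
    have "0 \<le> (1 + 1 / \<eta>) * ((norm r1)\<^sup>2 + (norm r2)\<^sup>2)" using assms(1) by simp
    then show "(1 + 1 / \<eta>) * ((norm r1)\<^sup>2 + (norm r2)\<^sup>2) / 2 \<le> (1 + 1 / \<eta>) * ((norm r1)\<^sup>2 + (norm r2)\<^sup>2)"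
      by (rule half)
    have "((norm ?a)\<^sup>2 + (norm ?b)\<^sup>2) / 2 \<le> (norm x)\<^sup>2 + (norm z)\<^sup>2 + (norm p)\<^sup>2 + (norm q)\<^sup>2"
      using add_mono[OF sq[of x p] sq[of z q]] by simp
    from mult_left_mono[OF this, of \<eta>]
    show "\<eta> * ((norm ?a)\<^sup>2 + (norm ?b)\<^sup>2) / 2 \<le> \<eta> * ((norm x)\<^sup>2 + (norm z)\<^sup>2 + (norm p)\<^sup>2 + (norm q)\<^sup>2)"
      using assms(1) by simp
  qed
  finally show ?thesis .
qed

text \<open>The total area is differentiable along curves of pairs of vector fields that are differentiable merely
in \<open>L\<^sup>2\<close>: up to an error \<open>o(s - t)\<close>, controlled by \<open>area_perturb\<close>, the curve may be replaced by its
tangent line.\<close>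

lemma area_integral_curve_derivative:
  fixes a b :: "real \<Rightarrow> real^2 \<Rightarrow> 'b::real_inner"
  assumes cut: "cutoff \<Omega> \<rho>" and t: "t \<in> S"
    and conta: "\<And>s. s \<in> S \<Longrightarrow> continuous_on \<Omega> (a s)" and contb: "\<And>s. s \<in> S \<Longrightarrow> continuous_on \<Omega> (b s)"
    and contpq: "continuous_on \<Omega> p" "continuous_on \<Omega> q"
    and pos: "\<And>y. y \<in> \<Omega> \<Longrightarrow> area (a t y) (b t y) > 0"
    and rem: "\<And>\<epsilon>. \<epsilon> > 0 \<Longrightarrow> \<exists>\<delta>>0. \<forall>s\<in>S. \<bar>s - t\<bar> < \<delta> \<longrightarrow>
      (LINT y:\<Omega>|lborel. \<rho> y * (norm (a s y - a t y - (s - t) *\<^sub>R p y))\<^sup>2) \<le> (\<epsilon> * \<bar>s - t\<bar>)\<^sup>2 \<and>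
      (LINT y:\<Omega>|lborel. \<rho> y * (norm (b s y - b t y - (s - t) *\<^sub>R q y))\<^sup>2) \<le> (\<epsilon> * \<bar>s - t\<bar>)\<^sup>2"
  shows "((\<lambda>s. LINT y:\<Omega>|lborel. \<rho> y * area (a s y) (b s y)) has_real_derivative
    (LINT y:\<Omega>|lborel. \<rho> y * area_deriv (a t y) (b t y) (p y) (q y))) (at t within S)"
proof -
  note ct = conta[OF t] contb[OF t] contpq
  let ?F = "\<lambda>s. LINT y:\<Omega>|lborel. \<rho> y * area (a s y) (b s y)"
  let ?H = "\<lambda>\<sigma>. LINT y:\<Omega>|lborel. \<rho> y * area (a t y + \<sigma> *\<^sub>R p y) (b t y + \<sigma> *\<^sub>R q y)"
  let ?D = "LINT y:\<Omega>|lborel. \<rho> y * area_deriv (a t y) (b t y) (p y) (q y)"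
  let ?m = "\<lambda>y. (norm (a t y))\<^sup>2 + (norm (b t y))\<^sup>2 + (norm (p y))\<^sup>2 + (norm (q y))\<^sup>2"
  define M where "M = (LINT y:\<Omega>|lborel. \<rho> y * ?m y)"
  have contm: "continuous_on \<Omega> ?m" by (intro continuous_intros ct)
  have M0: "0 \<le> M" unfolding M_def by (rule cutoff_integral_nonneg[OF cut]) simp
  have est: "\<bar>?F s - ?H (s - t)\<bar> \<le> \<epsilon> * \<bar>s - t\<bar> * (4 + M)"
    if s: "s \<in> S" "s \<noteq> t" "\<bar>s - t\<bar> \<le> 1" and \<epsilon>: "0 < \<epsilon>" "\<epsilon> \<le> 1"
      and e1: "(LINT y:\<Omega>|lborel. \<rho> y * (norm (a s y - a t y - (s - t) *\<^sub>R p y))\<^sup>2) \<le> (\<epsilon> * \<bar>s - t\<bar>)\<^sup>2"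
      and e2: "(LINT y:\<Omega>|lborel. \<rho> y * (norm (b s y - b t y - (s - t) *\<^sub>R q y))\<^sup>2) \<le> (\<epsilon> * \<bar>s - t\<bar>)\<^sup>2"
    for s \<epsilon>
  proof -
    define \<eta> where "\<eta> = \<epsilon> * \<bar>s - t\<bar>"
    have \<eta>: "\<eta> > 0" "\<eta> \<le> 1" using s \<epsilon> by (auto simp: \<eta>_def intro: mult_le_one)
    let ?r1 = "\<lambda>y. a s y - a t y - (s - t) *\<^sub>R p y" and ?r2 = "\<lambda>y. b s y - b t y - (s - t) *\<^sub>R q y"
    let ?A = "\<lambda>y. area (a s y) (b s y)" and ?B = "\<lambda>y. area (a t y + (s - t) *\<^sub>R p y) (b t y + (s - t) *\<^sub>R q y)"
    let ?R = "\<lambda>y. (1 + 1 / \<eta>) * (\<rho> y * (norm (?r1 y))\<^sup>2) + (1 + 1 / \<eta>) * (\<rho> y * (norm (?r2 y))\<^sup>2)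
        + \<eta> * (\<rho> y * ?m y)"
    have contr: "continuous_on \<Omega> (\<lambda>y. (norm (?r1 y))\<^sup>2)" "continuous_on \<Omega> (\<lambda>y. (norm (?r2 y))\<^sup>2)"
      by (intro continuous_intros ct conta contb s)+
    note intr = cutoff_integrable_continuous[OF cut contr(1)] cutoff_integrable_continuous[OF cut contr(2)]
      cutoff_integrable_continuous[OF cut contm]
    have intA: "set_integrable lborel \<Omega> (\<lambda>y. \<rho> y * ?A y)" "set_integrable lborel \<Omega> (\<lambda>y. \<rho> y * ?B y)"
      by (intro cutoff_integrable_continuous[OF cut] continuous_intros ct conta contb s)+
    have intR: "set_integrable lborel \<Omega> ?R"
      by (intro set_integral_add(1) set_integrable_mult_right intr)
    have pw: "\<bar>\<rho> y * ?A y - \<rho> y * ?B y\<bar> \<le> ?R y" if "y \<in> \<Omega>" for y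
    proof -
      have "\<bar>?A y - ?B y\<bar> \<le> (1 + 1 / \<eta>) * ((norm (?r1 y))\<^sup>2 + (norm (?r2 y))\<^sup>2) + \<eta> * ?m y"
        using area_perturb[OF \<eta>(1) s(3), of "a t y" "p y" "?r1 y" "b t y" "q y" "?r2 y"]
        by (simp add: algebra_simps)
      from mult_left_mono[OF this cutoffD(2)[OF cut that]]
      have "\<rho> y * \<bar>?A y - ?B y\<bar> \<le> \<rho> y * ((1 + 1 / \<eta>) * ((norm (?r1 y))\<^sup>2 + (norm (?r2 y))\<^sup>2) + \<eta> * ?m y)" .
      also have "\<dots> = ?R y" by (simp only: distrib_left mult.left_commute[of "\<rho> y"])
      finally show ?thesis
        using cutoffD(2)[OF cut that] by (simp add: abs_mult right_diff_distrib[symmetric])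
    qed
    have "\<bar>?F s - ?H (s - t)\<bar> = \<bar>LINT y:\<Omega>|lborel. \<rho> y * ?A y - \<rho> y * ?B y\<bar>"
      using set_integral_diff(2)[OF intA] by simp
    also have "\<dots> \<le> (LINT y:\<Omega>|lborel. \<bar>\<rho> y * ?A y - \<rho> y * ?B y\<bar>)"
      using set_integral_norm_bound[OF set_integral_diff(1)[OF intA]] by simp
    also have "\<dots> \<le> (LINT y:\<Omega>|lborel. ?R y)"
      by (rule set_integral_mono[OF set_integrable_abs[OF set_integral_diff(1)[OF intA]] intR pw])
    also have "\<dots> = (1 + 1 / \<eta>) * (LINT y:\<Omega>|lborel. \<rho> y * (norm (?r1 y))\<^sup>2)
        + (1 + 1 / \<eta>) * (LINT y:\<Omega>|lborel. \<rho> y * (norm (?r2 y))\<^sup>2) + \<eta> * M"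
      unfolding M_def
      by (simp only: set_integral_add set_integrable_mult_right intr set_integral_mult_right)
    also have "\<dots> \<le> (1 + 1 / \<eta>) * \<eta>\<^sup>2 + (1 + 1 / \<eta>) * \<eta>\<^sup>2 + \<eta> * M"
      using e1 e2 \<eta> by (intro add_mono mult_left_mono) (auto simp: \<eta>_def)
    also have "\<dots> = \<eta> * (2 * \<eta> + 2 + M)"
      using \<eta> by (simp add: field_simps power2_eq_square)
    also have "\<dots> \<le> \<eta> * (4 + M)" using \<eta> by (intro mult_left_mono) auto
    finally show ?thesis by (simp add: \<eta>_def)
  qed
  have small: "((\<lambda>s. (?F s - ?H (s - t)) / (s - t)) \<longlongrightarrow> 0) (at t within S)"
  proof (rule tendstoI)
    fix e :: real assume e: "e > 0"
    \<comment> \<open>any constant above the 4 of est gives the strict inequality\<close>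
    define \<epsilon> where "\<epsilon> = min 1 (e / (5 + M))"
    have \<epsilon>: "\<epsilon> > 0" "\<epsilon> \<le> 1" using e M0 by (auto simp: \<epsilon>_def)
    have "\<epsilon> * (4 + M) < e"
    proof -
      have "\<epsilon> * (4 + M) \<le> e / (5 + M) * (4 + M)" using M0 by (intro mult_right_mono) (auto simp: \<epsilon>_def)
      also have "\<dots> < e" using e M0 by (simp add: field_simps)
      finally show ?thesis .
    qed
    note \<epsilon>e = this
    obtain \<delta> where \<delta>: "\<delta> > 0" "\<forall>s\<in>S. \<bar>s - t\<bar> < \<delta> \<longrightarrow>
      (LINT y:\<Omega>|lborel. \<rho> y * (norm (a s y - a t y - (s - t) *\<^sub>R p y))\<^sup>2) \<le> (\<epsilon> * \<bar>s - t\<bar>)\<^sup>2 \<and>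
      (LINT y:\<Omega>|lborel. \<rho> y * (norm (b s y - b t y - (s - t) *\<^sub>R q y))\<^sup>2) \<le> (\<epsilon> * \<bar>s - t\<bar>)\<^sup>2"
      using rem[OF \<epsilon>(1)] by blast
    show "\<forall>\<^sub>F s in at t within S. dist ((?F s - ?H (s - t)) / (s - t)) 0 < e"
      unfolding eventually_at
    proof (intro exI[of _ "min \<delta> 1"] conjI ballI impI)
      fix s assume s: "s \<in> S" "s \<noteq> t \<and> dist s t < min \<delta> 1"
      then have "\<bar>?F s - ?H (s - t)\<bar> \<le> \<epsilon> * \<bar>s - t\<bar> * (4 + M)"
        using \<delta>(2) \<epsilon> by (intro est) (auto simp: dist_real_def)
      then have "\<bar>?F s - ?H (s - t)\<bar> / \<bar>s - t\<bar> \<le> \<epsilon> * (4 + M)"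
        using s by (simp add: divide_le_eq algebra_simps)
      then show "dist ((?F s - ?H (s - t)) / (s - t)) 0 < e"
        using \<epsilon>e by (simp add: abs_divide)
    qed (use \<delta> in auto)
  qed
  have H: "((\<lambda>s. (?H (s - t) - ?H 0) / (s - t)) \<longlongrightarrow> ?D) (at t within S)"
  proof -
    have "((\<lambda>\<sigma>. (?H \<sigma> - ?H 0) / (\<sigma> - 0)) \<longlongrightarrow> ?D) (at 0)"
      using area_integral_affine_derivative[OF cut ct pos] unfolding has_field_derivative_iff .
    moreover have "filterlim (\<lambda>s. s - t) (at 0) (at t within S)"
    proof (rule filterlim_atI)
      have "((\<lambda>s. s - t) \<longlongrightarrow> t - t) (at t within S)" by (intro tendsto_intros)
      then show "((\<lambda>s. s - t) \<longlongrightarrow> 0) (at t within S)" by simp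
    qed (auto simp: eventually_at_filter)
    ultimately show ?thesis by (auto dest: filterlim_compose)
  qed
  have "((\<lambda>s. (?F s - ?H (s - t)) / (s - t) + (?H (s - t) - ?H 0) / (s - t)) \<longlongrightarrow> 0 + ?D) (at t within S)"
    by (rule tendsto_add[OF small H])
  then have "((\<lambda>s. (?F s - ?F t) / (s - t)) \<longlongrightarrow> ?D) (at t within S)"
    by (simp add: add_divide_distrib[symmetric])
  then show ?thesis unfolding has_field_derivative_iff .
qed

section \<open>The volume along paths of immersions\<close>

text \<open>Let \<open>a, b\<close> be the two partial derivatives. Injectivity gives \<open>a \<noteq> 0\<close>. If the area vanished,
\<open>(a \<bullet> a) e\<^sub>2 - (a \<bullet> b) e\<^sub>1\<close> would be a nonzero vector in the kernel of the derivative.\<close>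

lemma partials_independent:
  fixes u :: "real^2 \<Rightarrow> 'b::real_inner"
  assumes "u differentiable (at y)" "inj (frechet_derivative u (at y))"
  shows "area (partial 1 u y) (partial 2 u y) > 0"
proof -
  let ?D = "frechet_derivative u (at y)" and ?a = "partial 1 u y" and ?b = "partial 2 u y"
  define v :: "real^2" where "v = (?a \<bullet> ?a) *\<^sub>R axis 2 1 - (?a \<bullet> ?b) *\<^sub>R axis 1 1"
  have lin: "linear ?D" using assms(1) frechet_derivative_works has_derivative_linear by blast
  have ker: "w = 0" if "?D w = 0" for w
    using assms(2) that linear_0[OF lin] by (metis injD)
  have a0: "?a \<noteq> 0"
    using ker[of "axis 1 1"] by (auto simp: partial_def axis_eq_0_iff)
  have "v $ 2 = ?a \<bullet> ?a" by (simp add: v_def axis_def)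
  then have "v \<noteq> 0" using a0 by auto
  then have "?D v \<noteq> 0" using ker by blast
  then have "0 < ?D v \<bullet> ?D v" by simp
  also have "?D v = (?a \<bullet> ?a) *\<^sub>R ?b - (?a \<bullet> ?b) *\<^sub>R ?a"
    by (simp add: v_def linear_diff[OF lin] linear_scale[OF lin] partial_def)
  also have "\<dots> \<bullet> \<dots> = (?a \<bullet> ?a) * ((?a \<bullet> ?a) * (?b \<bullet> ?b) - (?a \<bullet> ?b)\<^sup>2)"
    by (simp add: inner_diff_left inner_diff_right inner_commute[of ?b ?a] power2_eq_square algebra_simps)
  finally show ?thesis
    unfolding area_pos_iff by (rule zero_less_mult_pos) (use a0 in simp)
qed

text \<open>For \<open>B > 0\<close> the minimum of the right-hand side of \<open>young\<close> over \<open>\<kappa>\<close> is attained at \<open>\<kappa> = sqrt B / sqrt A\<close>; the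
numerator is enlarged slightly to allow \<open>B = 0\<close>.\<close>

lemma le_sqrt_mult_if_young:
  fixes x A B :: real
  assumes "A > 0" "B \<ge> 0" and young: "\<And>\<kappa>. \<kappa> > 0 \<Longrightarrow> x \<le> (\<kappa> * A + 1 / \<kappa> * B) / 2"
  shows "x \<le> sqrt A * sqrt B"
proof -
  let ?r = "sqrt A" and ?g = "sqrt B"
  have r: "?r > 0" "A = ?r * ?r" and g: "?g \<ge> 0" "B = ?g * ?g" using assms by auto
  have "x / ?r \<le> ?g + e" if "e > 0" for e
  proof -
    have ge: "?g + e > 0" using g that by linarith
    have "?g * ?g \<le> (?g + e) * (?g + e)" using g that by (intro mult_mono) auto
    then have "B / (?g + e) \<le> ?g + e" using ge g(2) by (simp add: divide_le_eq)
    then have "B / (?g + e) * ?r \<le> (?g + e) * ?r" using r by (intro mult_right_mono) auto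
    moreover have "(?g + e) / ?r * A = (?g + e) * ?r"
    proof -
      have "(?g + e) / ?r * A = (?g + e) * (A / ?r)" by simp
      then show ?thesis using assms(1) by (simp only: real_div_sqrt less_imp_le)
    qed
    moreover have "1 / ((?g + e) / ?r) * B = B / (?g + e) * ?r" by simp
    moreover have "x \<le> ((?g + e) / ?r * A + 1 / ((?g + e) / ?r) * B) / 2"
      using ge r(1) by (intro young divide_pos_pos)
    ultimately have "x \<le> ((?g + e) * ?r + B / (?g + e) * ?r) / 2" by (simp only:)
    also have "\<dots> \<le> ((?g + e) * ?r + (?g + e) * ?r) / 2"
      using \<open>B / (?g + e) * ?r \<le> (?g + e) * ?r\<close> by (intro divide_right_mono add_left_mono) auto
    finally have "x \<le> (?g + e) * ?r" by (simp add: mult.commute)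
    then show ?thesis using r(1) by (simp add: divide_le_eq)
  qed
  then have "x / ?r \<le> ?g" by (rule field_le_epsilon)
  then show ?thesis using r(1) by (simp add: divide_le_eq mult.commute)
qed

text \<open>The differential of the total volume, \<open>\<integral> tr (g\<^sup>-\<^sup>1 \<langle>\<nabla>f, \<nabla>h\<rangle>) vol\<close>.\<close>

definition Vol_deriv :: "('m chart \<times> ('m \<Rightarrow> real)) set \<Rightarrow> ('m \<Rightarrow> real^'d) \<Rightarrow> ('m \<Rightarrow> real^'d) \<Rightarrow> real" where
  "Vol_deriv P f h = surface_integral P (\<lambda>c y.
     area_deriv (partial 1 (local_rep c f) y) (partial 2 (local_rep c f) y)
       (partial 1 (local_rep c h) y) (partial 2 (local_rep c h) y))"

context partitioned_surface
begin

lemma Imm_subset: "Imm A l \<subseteq> sobolev_space A l"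
  by (auto simp: Imm_def)

lemma continuous_on_partial:
  assumes "f \<in> sobolev_space A l" "c \<in> A"
  shows "continuous_on (chart_image c) (partial i (local_rep c f))"
  using sobolev_spaceD(1)[OF assms] by (simp add: C1_on_def)

lemma Imm_area_pos:
  assumes "f \<in> Imm A l" "c \<in> A" "y \<in> chart_image c"
  shows "area (partial 1 (local_rep c f) y) (partial 2 (local_rep c f) y) > 0"
proof (rule partials_independent)
  show "local_rep c f differentiable (at y)"
    using sobolev_spaceD(1)[OF subsetD[OF Imm_subset assms(1)] assms(2)] assms(3) by (simp add: C1_on_def)
  obtain x where "x \<in> fst c" "y = snd c x" using assms(3) by (auto simp: chart_image_def)
  then show "inj (frechet_derivative (local_rep c f) (at y))"
    using assms by (auto simp: Imm_def)
qed

lemma partial_local_rep_remainder: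
  assumes "f \<in> sobolev_space A l" "g \<in> sobolev_space A l" "h \<in> sobolev_space A l" "c \<in> A" "y \<in> chart_image c"
  shows "partial i (local_rep c (f - g - r *\<^sub>R h)) y
    = partial i (local_rep c f) y - partial i (local_rep c g) y - r *\<^sub>R partial i (local_rep c h) y"
proof -
  have d: "local_rep c f differentiable (at y)" "local_rep c g differentiable (at y)" "local_rep c h differentiable (at y)"
    using sobolev_spaceD(1) assms unfolding C1_on_def by blast+
  have "((\<lambda>y. local_rep c f y - local_rep c g y - r *\<^sub>R local_rep c h y) has_derivative
    (\<lambda>v. frechet_derivative (local_rep c f) (at y) v - frechet_derivative (local_rep c g) (at y) v
      - r *\<^sub>R frechet_derivative (local_rep c h) (at y) v)) (at y)"
    using d by (intro has_derivative_diff has_derivative_scaleR_right frechet_derivative_works[THEN iffD1])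
  from partialI[OF this] show ?thesis by (simp add: partial_def local_rep_diff local_rep_scaleR)
qed

lemma Vol_has_derivative:
  fixes \<gamma> \<gamma>' :: "real \<Rightarrow> 'm \<Rightarrow> real^'d"
  assumes \<gamma>: "C1_curve (sobolev_space A l) (sobolev_norm P l) (Imm A l) a b \<gamma> \<gamma>'"
    and t: "t \<in> {a..b}" and l: "1 \<le> l"
  shows "((\<lambda>s. Vol P (\<gamma> s)) has_real_derivative Vol_deriv P (\<gamma> t) (\<gamma>' t)) (at t within {a..b})"
  unfolding Vol_def Vol_deriv_def surface_integral_def case_prod_unfold vol_density_eq_area
proof (rule DERIV_sum)
  fix p assume p: "p \<in> P"
  then have cut: "cutoff (chart_image (fst p)) (local_rep (fst p) (snd p))" and c: "fst p \<in> A"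
    using cutoff_partition[of "fst p" "snd p"] chart_in_atlas[of "fst p" "snd p"] by auto
  have I: "\<gamma> s \<in> Imm A l" "\<gamma> s \<in> sobolev_space A l" "\<gamma>' s \<in> sobolev_space A l" if "s \<in> {a..b}" for s
    using \<gamma> that by (auto simp: C1_curve_def intro: subsetD[OF Imm_subset])
  show "((\<lambda>s. LINT y:chart_image (fst p)|lborel. local_rep (fst p) (snd p) y *
        area (partial 1 (local_rep (fst p) (\<gamma> s)) y) (partial 2 (local_rep (fst p) (\<gamma> s)) y)) has_real_derivative
      (LINT y:chart_image (fst p)|lborel. local_rep (fst p) (snd p) y *
        area_deriv (partial 1 (local_rep (fst p) (\<gamma> t)) y) (partial 2 (local_rep (fst p) (\<gamma> t)) y)
          (partial 1 (local_rep (fst p) (\<gamma>' t)) y) (partial 2 (local_rep (fst p) (\<gamma>' t)) y)))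
      (at t within {a..b})"
  proof (rule area_integral_curve_derivative[OF cut t])
    fix \<epsilon> :: real assume "\<epsilon> > 0"
    then obtain \<delta> where \<delta>: "\<delta> > 0" "\<And>s. s \<in> {a..b} \<Longrightarrow> \<bar>s - t\<bar> < \<delta> \<Longrightarrow>
        sobolev_norm P l (\<gamma> s - \<gamma> t - (s - t) *\<^sub>R \<gamma>' t) \<le> \<epsilon> * \<bar>s - t\<bar>"
      using \<gamma> t unfolding C1_curve_def by metis
    have "(LINT y:chart_image (fst p)|lborel. local_rep (fst p) (snd p) y *
        (norm (partial i (local_rep (fst p) (\<gamma> s)) y - partial i (local_rep (fst p) (\<gamma> t)) y
          - (s - t) *\<^sub>R partial i (local_rep (fst p) (\<gamma>' t)) y))\<^sup>2) \<le> (\<epsilon> * \<bar>s - t\<bar>)\<^sup>2"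
      if s: "s \<in> {a..b}" "\<bar>s - t\<bar> < \<delta>" for s i
    proof -
      let ?R = "\<gamma> s - \<gamma> t - (s - t) *\<^sub>R \<gamma>' t"
      have R: "?R \<in> sobolev_space A l"
        using I s t by (intro sobolev_space_diff sobolev_space_scaleR) auto
      have "(LINT y:chart_image (fst p)|lborel. local_rep (fst p) (snd p) y *
        (norm (partial i (local_rep (fst p) (\<gamma> s)) y - partial i (local_rep (fst p) (\<gamma> t)) y
          - (s - t) *\<^sub>R partial i (local_rep (fst p) (\<gamma>' t)) y))\<^sup>2)
        = (LINT y:chart_image (fst p)|lborel. local_rep (fst p) (snd p) y *
            (norm (partial i (local_rep (fst p) ?R) y))\<^sup>2)"
        using partial_local_rep_remainder[OF I(2)[OF s(1)] I(2)[OF t] I(3)[OF t] c] open_chart_image[OF c]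
        by (intro set_lebesgue_integral_cong) auto
      also have "\<dots> \<le> (sobolev_norm P l ?R)\<^sup>2"
        using gradient_le_sobolev_norm[OF R l, of "fst p" "snd p"] p by simp
      also have "\<dots> \<le> (\<epsilon> * \<bar>s - t\<bar>)\<^sup>2"
        using \<delta>(2)[OF s] sobolev_norm_nonneg by (intro power_mono) auto
      finally show ?thesis .
    qed
    with \<delta>(1) show "\<exists>\<delta>>0. \<forall>s\<in>{a..b}. \<bar>s - t\<bar> < \<delta> \<longrightarrow>
      (LINT y:chart_image (fst p)|lborel. local_rep (fst p) (snd p) y *
        (norm (partial 1 (local_rep (fst p) (\<gamma> s)) y - partial 1 (local_rep (fst p) (\<gamma> t)) y
          - (s - t) *\<^sub>R partial 1 (local_rep (fst p) (\<gamma>' t)) y))\<^sup>2) \<le> (\<epsilon> * \<bar>s - t\<bar>)\<^sup>2 \<and>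
      (LINT y:chart_image (fst p)|lborel. local_rep (fst p) (snd p) y *
        (norm (partial 2 (local_rep (fst p) (\<gamma> s)) y - partial 2 (local_rep (fst p) (\<gamma> t)) y
          - (s - t) *\<^sub>R partial 2 (local_rep (fst p) (\<gamma>' t)) y))\<^sup>2) \<le> (\<epsilon> * \<bar>s - t\<bar>)\<^sup>2"
      by blast
  qed (rule continuous_on_partial[OF _ c] Imm_area_pos[OF I(1)[OF t] c] I(2,3) t | assumption)+
qed

lemma Vol_nonneg: "0 \<le> Vol P f"
  unfolding Vol_def surface_integral_def case_prod_unfold vol_density_eq_area
  using cutoff_partition by (intro sum_nonneg cutoff_integral_nonneg area_nonneg) auto

lemma Vol_deriv_young:
  fixes f h :: "'m \<Rightarrow> real^'d"
  assumes f: "f \<in> Imm A l" and h: "h \<in> sobolev_space A l" and "\<kappa> > 0"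
  shows "\<bar>Vol_deriv P f h\<bar> \<le> (\<kappa> * Vol P f + 1 / \<kappa> * (2 * (grad_L2_norm P f h)\<^sup>2)) / 2"
proof -
  let ?\<Omega> = "\<lambda>p :: 'm chart \<times> ('m \<Rightarrow> real). chart_image (fst p)"
  let ?\<rho> = "\<lambda>p :: 'm chart \<times> ('m \<Rightarrow> real). local_rep (fst p) (snd p)"
  let ?u = "\<lambda>p i y. partial i (local_rep (fst p) f) y" and ?w = "\<lambda>p i y. partial i (local_rep (fst p) h) y"
  let ?V = "\<lambda>p y. area (?u p 1 y) (?u p 2 y)"
  let ?g = "\<lambda>p y. dirichlet (?u p 1 y) (?u p 2 y) (?w p 1 y) (?w p 2 y) * ?V p y"
  let ?d = "\<lambda>p y. area_deriv (?u p 1 y) (?u p 2 y) (?w p 1 y) (?w p 2 y)"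
  have P: "cutoff (?\<Omega> p) (?\<rho> p)" "fst p \<in> A" if "p \<in> P" for p
    using that cutoff_partition[of "fst p" "snd p"] chart_in_atlas[of "fst p" "snd p"] by auto
  have f': "f \<in> sobolev_space A l" using f by (rule subsetD[OF Imm_subset])
  have pos: "?V p y > 0" if "p \<in> P" "y \<in> ?\<Omega> p" for p y
    using Imm_area_pos[OF f P(2)] that by blast
  have Vol: "Vol P f = (\<Sum>p\<in>P. LINT y:?\<Omega> p|lborel. ?\<rho> p y * ?V p y)"
    by (simp add: Vol_def surface_integral_def case_prod_unfold vol_density_eq_area)
  have "surface_integral P (\<lambda>c y. grad_sq (local_rep c f) (local_rep c h) y * vol_density (local_rep c f) y)
      = (\<Sum>p\<in>P. LINT y:?\<Omega> p|lborel. ?\<rho> p y * ?g p y)"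
    unfolding surface_integral_def case_prod_unfold
  proof (intro sum.cong refl set_lebesgue_integral_cong allI impI)
    fix p y assume p: "p \<in> P" and y: "y \<in> ?\<Omega> p"
    show "?\<rho> p y * (grad_sq (local_rep (fst p) f) (local_rep (fst p) h) y * vol_density (local_rep (fst p) f) y)
        = ?\<rho> p y * ?g p y"
      using pos[OF p y] by (simp add: grad_sq_eq_dirichlet vol_density_eq_area)
  qed (use P cutoffD(1) in auto)
  moreover have "0 \<le> (\<Sum>p\<in>P. LINT y:?\<Omega> p|lborel. ?\<rho> p y * ?g p y)"
  proof (intro sum_nonneg cutoff_integral_nonneg P)
    fix p y assume "p \<in> P" "y \<in> ?\<Omega> p"
    then show "0 \<le> ?g p y"
      using area_deriv_square_le(2)[OF pos] area_nonneg by (intro mult_nonneg_nonneg) auto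
  qed
  ultimately have grad: "(grad_L2_norm P f h)\<^sup>2 = (\<Sum>p\<in>P. LINT y:?\<Omega> p|lborel. ?\<rho> p y * ?g p y)"
    by (simp add: grad_L2_norm_def)
  have chart: "\<bar>LINT y:?\<Omega> p|lborel. ?\<rho> p y * ?d p y\<bar> \<le> \<kappa> / 2 * (LINT y:?\<Omega> p|lborel. ?\<rho> p y * ?V p y)
      + 1 / \<kappa> * (LINT y:?\<Omega> p|lborel. ?\<rho> p y * ?g p y)" if p: "p \<in> P" for p
  proof -
    note c = continuous_on_partial[OF f' P(2)[OF p]] continuous_on_partial[OF h P(2)[OF p]]
    have int: "set_integrable lborel (?\<Omega> p) (\<lambda>y. ?\<rho> p y * ?V p y)"
        "set_integrable lborel (?\<Omega> p) (\<lambda>y. ?\<rho> p y * ?g p y)"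
        "set_integrable lborel (?\<Omega> p) (\<lambda>y. ?\<rho> p y * ?d p y)"
      by (intro cutoff_integrable_continuous[OF P(1)[OF p]] continuous_on_mult continuous_on_area
          continuous_on_dirichlet continuous_on_area_deriv c pos[OF p]; assumption)+
    have "\<bar>LINT y:?\<Omega> p|lborel. ?\<rho> p y * ?d p y\<bar> \<le> (LINT y:?\<Omega> p|lborel. \<bar>?\<rho> p y * ?d p y\<bar>)"
      using set_integral_norm_bound[OF int(3)] by simp
    also have "\<dots> \<le> (LINT y:?\<Omega> p|lborel. \<kappa> / 2 * (?\<rho> p y * ?V p y) + 1 / \<kappa> * (?\<rho> p y * ?g p y))"
    proof (rule set_integral_mono)
      show "set_integrable lborel (?\<Omega> p) (\<lambda>y. \<bar>?\<rho> p y * ?d p y\<bar>)" by (rule set_integrable_abs[OF int(3)])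
      show "set_integrable lborel (?\<Omega> p) (\<lambda>y. \<kappa> / 2 * (?\<rho> p y * ?V p y) + 1 / \<kappa> * (?\<rho> p y * ?g p y))"
        by (intro set_integral_add(1) set_integrable_mult_right int)
      fix y assume y: "y \<in> ?\<Omega> p"
      have r: "0 \<le> ?\<rho> p y" by (rule cutoffD(2)[OF P(1)[OF p] y])
      have "\<bar>?\<rho> p y * ?d p y\<bar> = ?\<rho> p y * \<bar>?d p y\<bar>" using r by (simp add: abs_mult)
      also have "\<dots> \<le> ?\<rho> p y * ((\<kappa> * ?V p y + 2 / \<kappa> * ?g p y) / 2)"
        by (rule mult_left_mono[OF area_deriv_le[OF pos[OF p y] \<open>\<kappa> > 0\<close>] r])
      also have "\<dots> = \<kappa> / 2 * (?\<rho> p y * ?V p y) + 1 / \<kappa> * (?\<rho> p y * ?g p y)"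
        by (simp add: add_divide_distrib distrib_left mult_ac)
      finally show "\<bar>?\<rho> p y * ?d p y\<bar> \<le> \<dots>" .
    qed
    also have "\<dots> = (LINT y:?\<Omega> p|lborel. \<kappa> / 2 * (?\<rho> p y * ?V p y)) + (LINT y:?\<Omega> p|lborel. 1 / \<kappa> * (?\<rho> p y * ?g p y))"
      by (intro set_integral_add(2) set_integrable_mult_right int)
    finally show ?thesis by (simp only: set_integral_mult_right)
  qed
  have "\<bar>Vol_deriv P f h\<bar> \<le> (\<Sum>p\<in>P. \<bar>LINT y:?\<Omega> p|lborel. ?\<rho> p y * ?d p y\<bar>)"
    unfolding Vol_deriv_def surface_integral_def case_prod_unfold by (rule sum_abs)
  also have "\<dots> \<le> (\<Sum>p\<in>P. \<kappa> / 2 * (LINT y:?\<Omega> p|lborel. ?\<rho> p y * ?V p y)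
      + 1 / \<kappa> * (LINT y:?\<Omega> p|lborel. ?\<rho> p y * ?g p y))"
    by (rule sum_mono[OF chart])
  also have "\<dots> = \<kappa> / 2 * Vol P f + 1 / \<kappa> * (grad_L2_norm P f h)\<^sup>2"
    unfolding Vol grad sum.distrib sum_distrib_left ..
  finally show "\<bar>Vol_deriv P f h\<bar> \<le> (\<kappa> * Vol P f + 1 / \<kappa> * (2 * (grad_L2_norm P f h)\<^sup>2)) / 2"
    by (simp add: add_divide_distrib)
qed

lemma grad_L2_norm_nonneg:
  assumes "f \<in> Imm A l"
  shows "0 \<le> grad_L2_norm P f h"
proof -
  have "0 \<le> surface_integral P (\<lambda>c y. grad_sq (local_rep c f) (local_rep c h) y * vol_density (local_rep c f) y)"
    unfolding surface_integral_def case_prod_unfold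
  proof (intro sum_nonneg cutoff_integral_nonneg)
    fix p assume p: "p \<in> P"
    then show "cutoff (chart_image (fst p)) (local_rep (fst p) (snd p))"
      using cutoff_partition by simp
    fix y assume "y \<in> chart_image (fst p)"
    then have "area (partial 1 (local_rep (fst p) f) y) (partial 2 (local_rep (fst p) f) y) > 0"
      using Imm_area_pos[OF assms] chart_in_atlas p by (metis prod.collapse)
    then show "0 \<le> grad_sq (local_rep (fst p) f) (local_rep (fst p) h) y * vol_density (local_rep (fst p) f) y"
      using area_deriv_square_le(2)[of "partial 1 (local_rep (fst p) f) y" "partial 2 (local_rep (fst p) f) y"]
      by (simp add: grad_sq_eq_dirichlet vol_density_eq_area area_nonneg)
  qed
  then show ?thesis by (simp add: grad_L2_norm_def)
qed

text \<open>Adding \<open>\<epsilon>\<close> keeps the argument of the root positive, so that the left-hand side is the derivative of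
\<open>sqrt (Vol P f + \<epsilon>)\<close> in direction \<open>h\<close>; the bound does not depend on \<open>\<epsilon>\<close>.\<close>

lemma sqrt_Vol_deriv_le:
  assumes f: "f \<in> Imm A l" and h: "h \<in> sobolev_space A l" and "\<epsilon> > 0"
  shows "\<bar>Vol_deriv P f h / (2 * sqrt (Vol P f + \<epsilon>))\<bar> \<le> grad_L2_norm P f h / sqrt 2"
proof -
  let ?g = "grad_L2_norm P f h"
  have A: "Vol P f + \<epsilon> > 0" using Vol_nonneg[of f] \<open>\<epsilon> > 0\<close> by linarith
  have "\<bar>Vol_deriv P f h\<bar> \<le> sqrt (Vol P f + \<epsilon>) * sqrt (2 * ?g\<^sup>2)"
  proof (rule le_sqrt_mult_if_young[OF A])
    fix \<kappa> :: real assume k: "\<kappa> > 0"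
    then have "\<kappa> * Vol P f \<le> \<kappa> * (Vol P f + \<epsilon>)" using \<open>\<epsilon> > 0\<close> by simp
    then show "\<bar>Vol_deriv P f h\<bar> \<le> (\<kappa> * (Vol P f + \<epsilon>) + 1 / \<kappa> * (2 * ?g\<^sup>2)) / 2"
      by (intro order_trans[OF Vol_deriv_young[OF f h k]] divide_right_mono add_right_mono) auto
  qed simp
  then have "\<bar>Vol_deriv P f h\<bar> \<le> sqrt (Vol P f + \<epsilon>) * (sqrt 2 * ?g)"
    using grad_L2_norm_nonneg[OF f, of h] by (simp add: real_sqrt_mult)
  then have "\<bar>Vol_deriv P f h\<bar> / (2 * sqrt (Vol P f + \<epsilon>)) \<le> sqrt (Vol P f + \<epsilon>) * (sqrt 2 * ?g) / (2 * sqrt (Vol P f + \<epsilon>))"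
    using A by (intro divide_right_mono) auto
  also have "\<dots> = sqrt 2 * ?g / 2" using A by simp
  also have "\<dots> = ?g / sqrt 2" by (simp add: field_simps)
  finally show ?thesis using A by (simp add: abs_divide)
qed

sublocale sobolev: quasi_normed_subspace "sobolev_space A l" "sobolev_norm P l" for l
  by unfold_locales
    (rule sobolev_space_add sobolev_space_scaleR sobolev_norm_nonneg sobolev_norm_add sobolev_norm_scaleR; assumption?)+

text \<open>The mean value inequality for \<open>sqrt (Vol P (\<gamma> t) + \<epsilon>)\<close>, whose derivative is bounded by a multiple of
the speed of \<open>\<gamma>\<close>; then \<open>\<epsilon>\<close> tends to \<open>0\<close>.\<close>

lemma sqrt_Vol_along_C1_curve:
  fixes \<gamma> \<gamma>' :: "real \<Rightarrow> 'm \<Rightarrow> real^'d" and G :: "('m \<Rightarrow> real^'d) \<Rightarrow> ('m \<Rightarrow> real^'d) \<Rightarrow> ('m \<Rightarrow> real^'d) \<Rightarrow> real"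
  assumes \<gamma>: "C1_curve (sobolev_space A l) (sobolev_norm P l) (Imm A l) a b \<gamma> \<gamma>'" and "a < b" and l: "1 \<le> l"
    and G: "smooth_bilinear_field (sobolev_space A l) (sobolev_norm P l) (Imm A l) G"
    and c: "c > 0" "\<And>f h. f \<in> Imm A l \<Longrightarrow> h \<in> sobolev_space A l \<Longrightarrow> c * grad_L2_norm P f h \<le> sqrt (G f h h)"
  shows "\<bar>sqrt (Vol P (\<gamma> b)) - sqrt (Vol P (\<gamma> a))\<bar>
    \<le> 1 / (sqrt 2 * c) * integral {a..b} (\<lambda>t. sqrt (G (\<gamma> t) (\<gamma>' t) (\<gamma>' t)))"
proof -
  let ?q = "\<lambda>t. sqrt (G (\<gamma> t) (\<gamma>' t) (\<gamma>' t))" and ?K = "1 / (sqrt 2 * c)"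
  let ?I = "\<lambda>t. integral {a..t} ?q"
  have q: "continuous_on {a..b} ?q"
    by (intro continuous_intros sobolev.continuous_on_speed_square[OF G \<gamma> Imm_subset])
  have mem: "\<gamma> t \<in> Imm A l" "\<gamma>' t \<in> sobolev_space A l" if "t \<in> {a..b}" for t
    using \<gamma> that by (auto simp: C1_curve_def)
  have reg: "\<bar>sqrt (Vol P (\<gamma> b) + \<epsilon>) - sqrt (Vol P (\<gamma> a) + \<epsilon>)\<bar> \<le> ?K * ?I b" if \<epsilon>: "\<epsilon> > 0" for \<epsilon>
  proof -
    let ?\<psi>' = "\<lambda>t. Vol_deriv P (\<gamma> t) (\<gamma>' t) / (2 * sqrt (Vol P (\<gamma> t) + \<epsilon>))"
    have \<psi>: "((\<lambda>s. sqrt (Vol P (\<gamma> s) + \<epsilon>)) has_vector_derivative ?\<psi>' t) (at t within {a..b})"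
      if t: "t \<in> {a..b}" for t
    proof -
      have "Vol P (\<gamma> t) + \<epsilon> > 0" using Vol_nonneg[of "\<gamma> t"] \<epsilon> by linarith
      moreover have "((\<lambda>s. Vol P (\<gamma> s) + \<epsilon>) has_real_derivative Vol_deriv P (\<gamma> t) (\<gamma>' t)) (at t within {a..b})"
        using DERIV_add[OF Vol_has_derivative[OF \<gamma> t l] DERIV_const] by simp
      ultimately show ?thesis
        unfolding has_real_derivative_iff_has_vector_derivative[symmetric]
        by (intro has_real_derivative_sqrt)
    qed
    have \<phi>: "((\<lambda>s. ?K * ?I s) has_vector_derivative ?K * ?q t) (at t within {a..b})" if t: "t \<in> {a..b}" for t
      using integral_has_vector_derivative[OF q t]
      unfolding has_real_derivative_iff_has_vector_derivative[symmetric] by (rule DERIV_cmult)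
    have int: "at t within {a..b} = at t" if "a < t" "t < b" for t
      using that by (simp add: at_within_Icc_at)
    have "norm (sqrt (Vol P (\<gamma> b) + \<epsilon>) - sqrt (Vol P (\<gamma> a) + \<epsilon>)) \<le> ?K * ?I b - ?K * ?I a"
    proof (rule differentiable_bound_general[OF \<open>a < b\<close>])
      show "continuous_on {a..b} (\<lambda>s. sqrt (Vol P (\<gamma> s) + \<epsilon>))"
        unfolding continuous_on_eq_continuous_within using \<psi> has_vector_derivative_continuous by blast
      show "continuous_on {a..b} (\<lambda>s. ?K * ?I s)"
        unfolding continuous_on_eq_continuous_within using \<phi> has_vector_derivative_continuous by blast
      fix t assume t: "a < t" "t < b"
      then have t': "t \<in> {a..b}" by simp
      show "((\<lambda>s. sqrt (Vol P (\<gamma> s) + \<epsilon>)) has_vector_derivative ?\<psi>' t) (at t)"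
        using \<psi>[OF t'] int[OF t] by simp
      show "((\<lambda>s. ?K * ?I s) has_vector_derivative ?K * ?q t) (at t)"
        using \<phi>[OF t'] int[OF t] by simp
      have "norm (?\<psi>' t) \<le> grad_L2_norm P (\<gamma> t) (\<gamma>' t) / sqrt 2"
        using sqrt_Vol_deriv_le[OF mem[OF t'] \<epsilon>] by simp
      also have "\<dots> = ?K * (c * grad_L2_norm P (\<gamma> t) (\<gamma>' t))" using c(1) by simp
      also have "\<dots> \<le> ?K * ?q t" using c(1) by (intro mult_left_mono c(2) mem t') auto
      finally show "norm (?\<psi>' t) \<le> ?K * ?q t" .
    qed
    then show ?thesis by simp
  qed
  have "((\<lambda>\<epsilon>. \<bar>sqrt (Vol P (\<gamma> b) + \<epsilon>) - sqrt (Vol P (\<gamma> a) + \<epsilon>)\<bar>)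
      \<longlongrightarrow> \<bar>sqrt (Vol P (\<gamma> b) + 0) - sqrt (Vol P (\<gamma> a) + 0)\<bar>) (at_right 0)"
    by (intro tendsto_intros)
  moreover have "\<forall>\<^sub>F \<epsilon> in at_right 0. \<bar>sqrt (Vol P (\<gamma> b) + \<epsilon>) - sqrt (Vol P (\<gamma> a) + \<epsilon>)\<bar> \<le> ?K * ?I b"
    using reg by (auto simp: eventually_at_filter)
  ultimately have "\<bar>sqrt (Vol P (\<gamma> b) + 0) - sqrt (Vol P (\<gamma> a) + 0)\<bar> \<le> ?K * ?I b"
    by (rule tendsto_upperbound) simp
  then show ?thesis by simp
qed

lemma sqrt_Vol_le_length:
  fixes G :: "('m \<Rightarrow> real^'d) \<Rightarrow> ('m \<Rightarrow> real^'d) \<Rightarrow> ('m \<Rightarrow> real^'d) \<Rightarrow> real"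
  assumes l: "1 \<le> l"
    and G: "smooth_bilinear_field (sobolev_space A l) (sobolev_norm P l) (Imm A l) G"
    and c: "c > 0" "\<And>f h. f \<in> Imm A l \<Longrightarrow> h \<in> sobolev_space A l \<Longrightarrow> c * grad_L2_norm P f h \<le> sqrt (G f h h)"
    and L: "joined_with_length (sobolev_space A l) (sobolev_norm P l) (Imm A l) G f0 f1 L"
  shows "\<bar>sqrt (Vol P f0) - sqrt (Vol P f1)\<bar> \<le> 1 / (sqrt 2 * c) * L"
proof -
  obtain n :: nat and \<tau> \<gamma> \<gamma>' where \<tau>: "\<tau> 0 = 0" "\<tau> n = 1" and ends: "\<gamma> 0 = f0" "\<gamma> 1 = f1"
    and piece: "\<And>i. i < n \<Longrightarrow> \<tau> i < \<tau> (Suc i) \<and>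
      C1_curve (sobolev_space A l) (sobolev_norm P l) (Imm A l) (\<tau> i) (\<tau> (Suc i)) \<gamma> (\<gamma>' i)"
    and L_eq: "L = (\<Sum>i<n. integral {\<tau> i..\<tau> (Suc i)} (\<lambda>t. sqrt (G (\<gamma> t) (\<gamma>' i t) (\<gamma>' i t))))"
    using L unfolding joined_with_length_def by blast
  let ?v = "\<lambda>i. sqrt (Vol P (\<gamma> (\<tau> i)))"
  have "(\<Sum>i<n. ?v (Suc i) - ?v i) = ?v n - ?v 0" by (rule sum_lessThan_telescope)
  then have "\<bar>sqrt (Vol P f0) - sqrt (Vol P f1)\<bar> = \<bar>\<Sum>i<n. ?v (Suc i) - ?v i\<bar>"
    unfolding \<tau> ends by (simp only: abs_minus_commute)
  also have "\<dots> \<le> (\<Sum>i<n. \<bar>?v (Suc i) - ?v i\<bar>)" by (rule sum_abs)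
  also have "\<dots> \<le> (\<Sum>i<n. 1 / (sqrt 2 * c) * integral {\<tau> i..\<tau> (Suc i)} (\<lambda>t. sqrt (G (\<gamma> t) (\<gamma>' i t) (\<gamma>' i t))))"
    using piece by (intro sum_mono sqrt_Vol_along_C1_curve[OF _ _ l G c]) auto
  also have "\<dots> = 1 / (sqrt 2 * c) * L" by (simp add: L_eq sum_distrib_left)
  finally show ?thesis .
qed

lemma sqrt_Vol_geodesic_lipschitz:
  fixes G :: "('m \<Rightarrow> real^'d) \<Rightarrow> ('m \<Rightarrow> real^'d) \<Rightarrow> ('m \<Rightarrow> real^'d) \<Rightarrow> real"
  assumes l: "1 \<le> l"
    and G: "smooth_bilinear_field (sobolev_space A l) (sobolev_norm P l) (Imm A l) G"
    and c: "c > 0" "\<And>f h. f \<in> Imm A l \<Longrightarrow> h \<in> sobolev_space A l \<Longrightarrow> c * grad_L2_norm P f h \<le> sqrt (G f h h)"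
  shows "ennreal \<bar>sqrt (Vol P f0) - sqrt (Vol P f1)\<bar> \<le> ennreal (1 / (sqrt 2 * c)) *
    geodesic_dist (sobolev_space A l) (sobolev_norm P l) (Imm A l) G f0 f1"
proof -
  let ?K = "1 / (sqrt 2 * c)" and ?\<Delta> = "\<bar>sqrt (Vol P f0) - sqrt (Vol P f1)\<bar>"
  have K: "?K > 0" using c(1) by simp
  have "ennreal (?\<Delta> / ?K) \<le> geodesic_dist (sobolev_space A l) (sobolev_norm P l) (Imm A l) G f0 f1"
    unfolding geodesic_dist_def
  proof (rule INF_greatest)
    fix L assume "L \<in> {L. joined_with_length (sobolev_space A l) (sobolev_norm P l) (Imm A l) G f0 f1 L}"
    then have "?\<Delta> \<le> ?K * L" using sqrt_Vol_le_length[OF l G c] by simp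
    then have "?\<Delta> / ?K \<le> L" using K by (simp add: divide_le_eq mult.commute del: divide_divide_eq_right)
    then show "ennreal (?\<Delta> / ?K) \<le> ennreal L" by (rule ennreal_leI)
  qed
  then have "ennreal ?K * ennreal (?\<Delta> / ?K)
      \<le> ennreal ?K * geodesic_dist (sobolev_space A l) (sobolev_norm P l) (Imm A l) G f0 f1"
    by (rule mult_left_mono) simp
  moreover have "ennreal ?K * ennreal (?\<Delta> / ?K) = ennreal ?\<Delta>"
  proof -
    have "?K * (?\<Delta> / ?K) = ?\<Delta>" using c(1) by simp
    then show ?thesis using K by (subst ennreal_mult[symmetric]) auto
  qed
  ultimately show ?thesis by simp
qed

end

theorem lemma5p2:
  fixes A :: "'m::t2_space chart set"
    and P :: "('m chart \<times> ('m \<Rightarrow> real)) set"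
    and l :: nat
    and G :: "('m \<Rightarrow> real^'d) \<Rightarrow> ('m \<Rightarrow> real^'d) \<Rightarrow> ('m \<Rightarrow> real^'d) \<Rightarrow> real"
  defines "H \<equiv> (sobolev_space A l :: ('m \<Rightarrow> real^'d) set)"
    and "N \<equiv> (sobolev_norm P l :: ('m \<Rightarrow> real^'d) \<Rightarrow> real)"
    and "I \<equiv> (Imm A l :: ('m \<Rightarrow> real^'d) set)"
  assumes "closed_oriented_surface A"
    and "partition_of_unity A P"
    and "CARD('d) \<ge> 3"
    and "l \<ge> 3"
    and "riemannian_metric H N I G"
    and "\<exists>c>0. \<forall>f\<in>I. \<forall>h\<in>H. sqrt (G f h h) \<ge> c * grad_L2_norm P f h"
  shows "\<forall>f0\<in>I. \<forall>r>0.
      (\<exists>C. geodesic_lipschitz_on H N I G C (geodesic_ball H N I G f0 r) (\<lambda>f. sqrt (Vol P f))) \<and>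
      (\<exists>B. \<forall>f\<in>geodesic_ball H N I G f0 r. \<bar>sqrt (Vol P f)\<bar> \<le> B)"
proof -
  interpret partitioned_surface A P
    by unfold_locales (fact assms)+
  obtain c where c: "c > 0" "\<And>f h. f \<in> I \<Longrightarrow> h \<in> H \<Longrightarrow> c * grad_L2_norm P f h \<le> sqrt (G f h h)"
    using assms(9) by blast
  have G: "smooth_bilinear_field H N I G" using assms(8) by (simp add: riemannian_metric_def)
  have l: "1 \<le> l" using \<open>l \<ge> 3\<close> by simp
  let ?K = "1 / (sqrt 2 * c)"
  have K: "?K \<ge> 0" using c(1) by simp
  have lip: "ennreal \<bar>sqrt (Vol P f) - sqrt (Vol P f')\<bar> \<le> ennreal ?K * geodesic_dist H N I G f f'" for f f'
    using sqrt_Vol_geodesic_lipschitz[OF l G[unfolded H_def N_def I_def] c[unfolded H_def I_def]]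
    unfolding H_def N_def I_def .
  show ?thesis
  proof (intro ballI allI impI conjI)
    fix f0 r assume "f0 \<in> I" and r: "(r::real) > 0"
    have "geodesic_lipschitz_on H N I G ?K (geodesic_ball H N I G f0 r) (\<lambda>f. sqrt (Vol P f))"
      using lip K by (simp add: geodesic_lipschitz_on_def)
    then show "\<exists>C. geodesic_lipschitz_on H N I G C (geodesic_ball H N I G f0 r) (\<lambda>f. sqrt (Vol P f))" ..
    show "\<exists>B. \<forall>f\<in>geodesic_ball H N I G f0 r. \<bar>sqrt (Vol P f)\<bar> \<le> B"
    proof (intro exI ballI)
      fix f assume "f \<in> geodesic_ball H N I G f0 r"
      then have "ennreal ?K * geodesic_dist H N I G f0 f \<le> ennreal ?K * ennreal r"
        by (intro mult_left_mono) (auto simp: geodesic_ball_def)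
      then have "ennreal \<bar>sqrt (Vol P f0) - sqrt (Vol P f)\<bar> \<le> ennreal (?K * r)"
        using lip[of f0 f] K r by (simp only: ennreal_mult[OF K less_imp_le[OF r]])
      then have "\<bar>sqrt (Vol P f0) - sqrt (Vol P f)\<bar> \<le> ?K * r"
        using K r by (subst (asm) ennreal_le_iff) auto
      then show "\<bar>sqrt (Vol P f)\<bar> \<le> \<bar>sqrt (Vol P f0)\<bar> + ?K * r" by linarith
    qed
  qed
qed

end
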